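(* The family of logics $\mathrm{MSO}$ is $\mathbb{T}^\times$-compositional and also $\mathbb{T}$-compositional.
   Context: Sorts are $\Xi=\omega$ (arities). For an $\omega$-sorted family of partial orders $A$ and $n<\omega$, $\mathbb{T}^\times_nA$ is the set of finite or infinite trees with ordered successors labelled by elements of $A$ or variables $x_0,\dots,x_{n-1}$ (arity $0$), where a vertex with label in $A_k$ has exactly $k$ successors, variables label leaves only, and the root is labelled by an element of $A$; ordered by same shape and vertexwise comparison of labels. $\mathbb{T}A\subseteq\mathbb{T}^\times A$ consists of the trees using each variable at most once. $\mathbb{T}^\times$ is a monad with $\mathrm{sing}(a)=a(x_0,\dots,x_{n-1})$ and $\mathrm{flat}$ given by substituting, for each vertex $v$ of a tree of trees, the tree $T(v)$ with its $x_i$-leaves linked to the root of the tree at the $(i+1)$-st successor of $v$ and unravelling; $\mathbb{T}$ is a submonad. For an alphabet (finite unordered set) $\Sigma$, a tree $t$ of sort $n$ is identified with the structure $\langle\mathrm{dom}(t),\preceq,(S_i)_{i<\omega},(P_c)_{c\in\Sigma},(Q_i)_{i<n},R\rangle$ (tree order, successor relations, label predicates, variable predicates, root). MSO is the family of logics assigning to $\Sigma$ the monadic second-order sentences over this signature, a sentence of sort $n$ being evaluated on trees of sort $n$. For a monad $\mathbb{M}\in\{\mathbb{T},\mathbb{T}^\times\}$ and a set $\Delta$ of formulae, $s\sqsubseteq_\Delta t$ iff every formula in $\Delta$ satisfied by $s$ is satisfied by $t$. A preorder $\sqsubseteq$ on $\mathbb{M}\Sigma$ is a congruence ordering if $\mathbb{M}q(S)\leq\mathbb{M}q(T)$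 implies $\mathrm{flat}(S)\sqsubseteq\mathrm{flat}(T)$ for $S,T\in\mathbb{M}\mathbb{M}\Sigma$, $q$ the quotient map onto the ordered set of classes. A family of logics $L$ is $\mathbb{M}$-compositional if for every finite subfamily $\Phi$ (finitely many formulae per alphabet) there is $\Delta$ with $\Phi\subseteq\Delta\subseteq L$, finite in each sort for each alphabet up to equivalence, such that $\sqsubseteq_{\Delta[\Sigma]}$ is a congruence ordering on $\mathbb{M}\Sigma$ for every alphabet $\Sigma$. *)

theory Defs
  imports Main
begin

text \<open>A tree of sort n over a ranked set A (arity function ar): its sort together with a
partial labelling of addresses (lists of successor indices). The domain is the set of
addresses with a label. Labels are Inl a (a in A, with exactly ar a successors) or
Inr i (the variable x_i, i < n, only at leaves). The root carries a label from A.\<close>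

type_synonym 'a tr = "nat \<times> (nat list \<Rightarrow> ('a + nat) option)"

datatype monad = TTimes | TLin

definition wf_tree :: "bool \<Rightarrow> ('a \<Rightarrow> nat) \<Rightarrow> 'a set \<Rightarrow> nat \<Rightarrow> 'a tr \<Rightarrow> bool" where
  "wf_tree lin ar A n t \<longleftrightarrow>
     fst t = n
   \<and> (\<exists>a. snd t [] = Some (Inl a))
   \<and> (\<forall>v i. snd t (v @ [i]) \<noteq> None \<longrightarrow> snd t v \<noteq> None)
   \<and> (\<forall>v a. snd t v = Some (Inl a) \<longrightarrow> a \<in> A \<and> (\<forall>i. snd t (v @ [i]) \<noteq> None \<longleftrightarrow> i < ar a))
   \<and> (\<forall>v j. snd t v = Some (Inr j) \<longrightarrow> j < n \<and> (\<forall>i. snd t (v @ [i]) = None))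
   \<and> (lin \<longrightarrow> (\<forall>v w j. snd t v = Some (Inr j) \<longrightarrow> snd t w = Some (Inr j) \<longrightarrow> v = w))"

definition Mtrees :: "monad \<Rightarrow> ('a \<Rightarrow> nat) \<Rightarrow> 'a set \<Rightarrow> nat \<Rightarrow> 'a tr set" where
  "Mtrees M ar A n = {t. wf_tree (M = TLin) ar A n t}"

definition MMtrees :: "monad \<Rightarrow> ('a \<Rightarrow> nat) \<Rightarrow> 'a set \<Rightarrow> nat \<Rightarrow> 'a tr tr set" where
  "MMtrees M ar A n = Mtrees M fst (\<Union>k. Mtrees M ar A k) n"

text \<open>Flattening (substitution followed by unravelling), computed address-wise.
  State: current vertex v of the outer tree, current position u in its label tree,
  remaining address w. The fuel 2*length w + 2 suffices for well-formed trees.\<close>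
primrec flk :: "nat \<Rightarrow> 'a tr tr \<Rightarrow> nat list \<Rightarrow> nat list \<Rightarrow> nat list \<Rightarrow> ('a + nat) option" where
  "flk 0 S v u w = None"
| "flk (Suc f) S v u w =
     (case snd S v of
        Some (Inl T) \<Rightarrow>
          (case snd T u of
             None \<Rightarrow> None
           | Some (Inl c) \<Rightarrow> (case w of [] \<Rightarrow> Some (Inl c) | i # w' \<Rightarrow> flk f S v (u @ [i]) w')
           | Some (Inr j) \<Rightarrow>
               (case snd S (v @ [j]) of
                  None \<Rightarrow> None
                | Some (Inr l) \<Rightarrow> (if w = [] then Some (Inr l) else None)
                | Some (Inl _) \<Rightarrow> flk f S (v @ [j]) [] w))
      | _ \<Rightarrow> None)"

definition flat :: "'a tr tr \<Rightarrow> 'a tr" where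
  "flat S = (fst S, \<lambda>w. flk (2 * length w + 2) S [] [] w)"

datatype 'c mso =
    MLeq nat nat
  | MSucc nat nat nat
  | MLab 'c nat
  | MQ nat nat
  | MRoot nat
  | MEq nat nat
  | MMem nat nat
  | MNeg "'c mso"
  | MConj "'c mso" "'c mso"
  | MEx1 nat "'c mso"
  | MEx2 nat "'c mso"

fun fv1 :: "'c mso \<Rightarrow> nat set" where
  "fv1 (MLeq x y) = {x, y}"
| "fv1 (MSucc i x y) = {x, y}"
| "fv1 (MLab c x) = {x}"
| "fv1 (MQ i x) = {x}"
| "fv1 (MRoot x) = {x}"
| "fv1 (MEq x y) = {x, y}"
| "fv1 (MMem x X) = {x}"
| "fv1 (MNeg \<phi>) = fv1 \<phi>"
| "fv1 (MConj \<phi> \<psi>) = fv1 \<phi> \<union> fv1 \<psi>"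
| "fv1 (MEx1 x \<phi>) = fv1 \<phi> - {x}"
| "fv1 (MEx2 X \<phi>) = fv1 \<phi>"

fun fv2 :: "'c mso \<Rightarrow> nat set" where
  "fv2 (MMem x X) = {X}"
| "fv2 (MNeg \<phi>) = fv2 \<phi>"
| "fv2 (MConj \<phi> \<psi>) = fv2 \<phi> \<union> fv2 \<psi>"
| "fv2 (MEx1 x \<phi>) = fv2 \<phi>"
| "fv2 (MEx2 X \<phi>) = fv2 \<phi> - {X}"
| "fv2 _ = {}"

fun mso_wf :: "'c set \<Rightarrow> nat \<Rightarrow> 'c mso \<Rightarrow> bool" where
  "mso_wf \<Sigma> n (MLab c x) = (c \<in> \<Sigma>)"
| "mso_wf \<Sigma> n (MQ i x) = (i < n)"
| "mso_wf \<Sigma> n (MNeg \<phi>) = mso_wf \<Sigma> n \<phi>"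
| "mso_wf \<Sigma> n (MConj \<phi> \<psi>) = (mso_wf \<Sigma> n \<phi> \<and> mso_wf \<Sigma> n \<psi>)"
| "mso_wf \<Sigma> n (MEx1 x \<phi>) = mso_wf \<Sigma> n \<phi>"
| "mso_wf \<Sigma> n (MEx2 X \<phi>) = mso_wf \<Sigma> n \<phi>"
| "mso_wf \<Sigma> n _ = True"

fun sat :: "(nat list \<Rightarrow> ('c + nat) option) \<Rightarrow> (nat \<Rightarrow> nat list) \<Rightarrow> (nat \<Rightarrow> nat list set) \<Rightarrow> 'c mso \<Rightarrow> bool" where
  "sat t f F (MLeq x y) = (\<exists>z. f y = f x @ z)"
| "sat t f F (MSucc i x y) = (f y = f x @ [i])"
| "sat t f F (MLab c x) = (t (f x) = Some (Inl c))"
| "sat t f F (MQ i x) = (t (f x) = Some (Inr i))"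
| "sat t f F (MRoot x) = (f x = [])"
| "sat t f F (MEq x y) = (f x = f y)"
| "sat t f F (MMem x X) = (f x \<in> F X)"
| "sat t f F (MNeg \<phi>) = (\<not> sat t f F \<phi>)"
| "sat t f F (MConj \<phi> \<psi>) = (sat t f F \<phi> \<and> sat t f F \<psi>)"
| "sat t f F (MEx1 x \<phi>) = (\<exists>v. t v \<noteq> None \<and> sat t (f(x := v)) F \<phi>)"
| "sat t f F (MEx2 X \<phi>) = (\<exists>V. V \<subseteq> {v. t v \<noteq> None} \<and> sat t f (F(X := V)) \<phi>)"

definition models :: "'c tr \<Rightarrow> 'c mso \<Rightarrow> bool" where
  "models t \<phi> \<longleftrightarrow> sat (snd t) (\<lambda>_. []) (\<lambda>_. {}) \<phi>"

definition MSO :: "'c set \<Rightarrow> (nat \<times> 'c mso) set" where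
  "MSO \<Sigma> = {(n, \<phi>). fv1 \<phi> = {} \<and> fv2 \<phi> = {} \<and> mso_wf \<Sigma> n \<phi>}"

definition sqsub :: "(nat \<times> 'c mso) set \<Rightarrow> 'c tr \<Rightarrow> 'c tr \<Rightarrow> bool" where
  "sqsub \<Delta> s t \<longleftrightarrow> fst s = fst t \<and> (\<forall>(n, \<phi>) \<in> \<Delta>. n = fst s \<longrightarrow> models s \<phi> \<longrightarrow> models t \<phi>)"

text \<open>M q (S) \<le> M q (T): same sort and shape, same variables, labels related by R.\<close>
definition pw_le :: "('a tr \<Rightarrow> 'a tr \<Rightarrow> bool) \<Rightarrow> 'a tr tr \<Rightarrow> 'a tr tr \<Rightarrow> bool" where
  "pw_le R S T \<longleftrightarrow> fst S = fst T \<and>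
     (\<forall>v. case (snd S v, snd T v) of
            (None, None) \<Rightarrow> True
          | (Some (Inr i), Some (Inr j)) \<Rightarrow> i = j
          | (Some (Inl s), Some (Inl t)) \<Rightarrow> R s t
          | _ \<Rightarrow> False)"

definition congruence_ordering :: "monad \<Rightarrow> ('c \<Rightarrow> nat) \<Rightarrow> 'c set \<Rightarrow> ('c tr \<Rightarrow> 'c tr \<Rightarrow> bool) \<Rightarrow> bool" where
  "congruence_ordering M ar \<Sigma> R \<longleftrightarrow>
     (\<forall>n. \<forall>s \<in> Mtrees M ar \<Sigma> n. R s s)
   \<and> (\<forall>n. \<forall>s \<in> Mtrees M ar \<Sigma> n. \<forall>t \<in> Mtrees M ar \<Sigma> n. \<forall>u \<in> Mtrees M ar \<Sigma> n.
          R s t \<longrightarrow> R t u \<longrightarrow> R s u)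
   \<and> (\<forall>n. \<forall>S \<in> MMtrees M ar \<Sigma> n. \<forall>T \<in> MMtrees M ar \<Sigma> n. pw_le R S T \<longrightarrow> R (flat S) (flat T))"

text \<open>Alphabets are finite subsets of the symbol type 'c, with arities given by ar.\<close>
definition compositional :: "monad \<Rightarrow> ('c \<Rightarrow> nat) \<Rightarrow> ('c set \<Rightarrow> (nat \<times> 'c mso) set) \<Rightarrow> bool" where
  "compositional M ar L \<longleftrightarrow>
     (\<forall>\<Phi>. (\<forall>\<Sigma>. finite \<Sigma> \<longrightarrow> \<Phi> \<Sigma> \<subseteq> L \<Sigma> \<and> finite (\<Phi> \<Sigma>)) \<longrightarrow>
        (\<exists>\<Delta>. \<forall>\<Sigma>. finite \<Sigma> \<longrightarrow>
            \<Phi> \<Sigma> \<subseteq> \<Delta> \<Sigma> \<and> \<Delta> \<Sigma> \<subseteq> L \<Sigma>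
          \<and> (\<forall>n. finite ((\<lambda>(m, \<phi>). {t \<in> Mtrees M ar \<Sigma> n. models t \<phi>}) ` {p \<in> \<Delta> \<Sigma>. fst p = n}))
          \<and> congruence_ordering M ar \<Sigma> (sqsub (\<Delta> \<Sigma>))))"

end

theory Submission
  imports Defs "HOL-Library.Ramsey" "HOL-Library.FuncSet"
begin

text \<open>Every sentence is equivalent to a nondeterministic parity automaton on infinite trees (Rabin's theorem). A partial
  run of such an automaton on a tree with variables is summarised by its initial state and, for every variable, the
  set of pairs (state, maximal priority on the way) occurring at the leaves with that variable. Comparing trees by the
  bounds that hold for some of their partial runs is a congruence ordering: a run on the flattening of \<open>S\<close> is transferred
  to the flattening of \<open>T\<close> component by component, and since every infinite branch of the new run that crosses infinitely
  many components has the same sequence of component-wise maximal priorities as some branch of the old one, it is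
  accepted. There are only finitely many such bounds for trees of a given sort, and each of them is expressed by a sentence.
  Linear trees need no extra argument, as linear trees of linear trees are trees of trees.

  Rabin's theorem is obtained from positional determinacy of parity games and from McNaughton's theorem. The latter is
  proved with a finite semigroup and Ramsey's theorem, the priorities being given by the sizes of right ideals.\<close>

section \<open>Limit superior of priority sequences\<close>

text \<open>Trees are compared through bounds on leaf triples and not through single triples,
  because a variable may occur at infinitely many leaves, each with a triple of its own; a set of
  allowed triples is all that the outer tree can know about a component. Maximal priorities enter
  because a limit superior does not change when consecutive finite blocks are replaced by their
  maxima.

  The labels of a tree of trees have arbitrary sorts, while the automaton for a sentence of sort
  \<open>n0\<close> knows only the variables below \<open>n0\<close>. This does no harm: a partial
  run stops on reaching a variable and reads only letters of \<open>\<Sigma>\<close>, and the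
  variables of the sentence are absorbed in the bound required at the leaves. Likewise, a finite
  alphabet has a largest arity, and missing directions of the full tree are absorbed in a set of
  final states.\<close>

definition lsup :: "(nat \<Rightarrow> nat) \<Rightarrow> nat \<Rightarrow> bool" where
  "lsup x k \<longleftrightarrow> (\<forall>m. \<exists>i\<ge>m. x i = k) \<and> (\<exists>m. \<forall>i\<ge>m. x i \<le> k)"

text \<open>Max-parity condition. Unbounded sequences have no limit superior and are rejected, which
  is why complementation by \<open>parity_ok_Suc\<close> asks for a bound.\<close>

definition parity_ok :: "(nat \<Rightarrow> nat) \<Rightarrow> bool" where
  "parity_ok x \<longleftrightarrow> (\<exists>k. even k \<and> lsup x k)"

lemma lsup_unique: "lsup x k \<Longrightarrow> lsup x l \<Longrightarrow> k = l"
  unfolding lsup_def by (metis le_antisym)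

text \<open>The least eventual upper bound is attained infinitely often, as otherwise its
  predecessor would be an eventual upper bound too.\<close>

lemma lsup_ex:
  assumes "\<And>i. x i \<le> B"
  shows "\<exists>k. lsup x k"
proof -
  let ?P = "\<lambda>k. \<exists>m. \<forall>i\<ge>m. x i \<le> k"
  have B: "?P B" using assms by auto
  define k where "k = (LEAST k. ?P k)"
  have k: "?P k" unfolding k_def by (rule LeastI[of ?P, OF B])
  then obtain m0 where m0: "\<forall>i\<ge>m0. x i \<le> k" by auto
  have "\<exists>i\<ge>m. x i = k" for m
  proof (rule ccontr)
    assume "\<not> ?thesis"
    then have lt: "\<forall>i\<ge>max m m0. x i < k" using m0
      by (metis le_neq_implies_less max.boundedE)
    then have "0 < k" by (metis le_refl gr_zeroI not_less0)
    then have "\<forall>i\<ge>max m m0. x i \<le> k - 1" using lt by fastforce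
    then have "?P (k - 1)" by blast
    then have "k \<le> k - 1" unfolding k_def by (rule Least_le)
    with \<open>0 < k\<close> show False by simp
  qed
  with k show ?thesis unfolding lsup_def by auto
qed

lemma lsup_shift: "lsup (\<lambda>i. x (i + m)) k \<longleftrightarrow> lsup x k"
proof
  assume l: "lsup (\<lambda>i. x (i + m)) k"
  show "lsup x k" unfolding lsup_def
  proof (intro conjI allI)
    fix n
    obtain i where "i \<ge> n" "x (i + m) = k" using l unfolding lsup_def by blast
    then show "\<exists>i\<ge>n. x i = k" by (intro exI[of _ "i+m"]) auto
  next
    obtain n where n: "\<forall>i\<ge>n. x (i + m) \<le> k" using l unfolding lsup_def by blast
    have "x i \<le> k" if "i \<ge> n + m" for i
      using n[rule_format, of "i - m"] that by auto
    then show "\<exists>n. \<forall>i\<ge>n. x i \<le> k" by blast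
  qed
next
  assume l: "lsup x k"
  show "lsup (\<lambda>i. x (i + m)) k" unfolding lsup_def
  proof (intro conjI allI)
    fix n
    obtain i where "i \<ge> n + m" "x i = k" using l unfolding lsup_def by blast
    then show "\<exists>i\<ge>n. x (i + m) = k" by (intro exI[of _ "i-m"]) auto
  next
    obtain n where n: "\<forall>i\<ge>n. x i \<le> k" using l unfolding lsup_def by blast
    show "\<exists>n. \<forall>i\<ge>n. x (i + m) \<le> k" by (rule exI[of _ n]) (use n in auto)
  qed
qed

lemma parity_ok_shift: "parity_ok (\<lambda>i. x (i + m)) \<longleftrightarrow> parity_ok x"
  unfolding parity_ok_def lsup_shift ..

lemma lsup_Suc: "lsup (\<lambda>i. Suc (x i)) k \<longleftrightarrow> (\<exists>l. k = Suc l \<and> lsup x l)"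
  unfolding lsup_def by (cases k) auto

lemma parity_ok_Suc:
  assumes "\<And>i. x i \<le> B"
  shows "parity_ok (\<lambda>i. Suc (x i)) \<longleftrightarrow> \<not> parity_ok x"
proof -
  obtain k where k: "lsup x k" using lsup_ex[of x B, OF assms] by blast
  have "lsup x l \<longleftrightarrow> l = k" for l using k lsup_unique by blast
  then show ?thesis unfolding parity_ok_def lsup_Suc by auto
qed

lemma strict_mono_block:
  fixes c :: "nat \<Rightarrow> nat"
  assumes "strict_mono c" "c 0 \<le> t"
  shows "\<exists>i. c i \<le> t \<and> t < c (Suc i)"
proof -
  let ?P = "\<lambda>i. t < c i"
  have "?P (Suc t)" using strict_mono_imp_increasing[OF assms(1), of "Suc t"] by simp
  then have L: "?P (LEAST i. ?P i)" by (rule LeastI)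
  moreover have "(LEAST i. ?P i) \<noteq> 0" using L assms(2) by (metis not_less)
  ultimately obtain i where i: "(LEAST i. ?P i) = Suc i" by (metis not0_implies_Suc)
  then have "\<not> ?P i" using not_less_Least[of i ?P] by simp
  with L i show ?thesis by (intro exI[of _ i]) auto
qed

lemma strict_mono_block_unique:
  fixes c :: "nat \<Rightarrow> nat"
  assumes "strict_mono c" "c i \<le> t" "t < c (Suc i)" "c j \<le> t" "t < c (Suc j)"
  shows "i = j"
  using assms by (metis Suc_leI le_less_trans linorder_neqE_nat not_le strict_mono_less_eq)

text \<open>A block is nonempty, its maximum bounds its entries and is one of them, so both halves
  of the definition of \<open>lsup\<close> pass between entries and block maxima. This is what
  allows a run to be judged by the maximal priority of each component that it crosses.\<close>

lemma lsup_blocks: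
  fixes c :: "nat \<Rightarrow> nat"
  assumes c: "strict_mono c"
  shows "lsup (\<lambda>i. Max (x ` {c i..<c (Suc i)})) k \<longleftrightarrow> lsup x k"
proof -
  define y where "y i = Max (x ` {c i..<c (Suc i)})" for i
  have ne: "x ` {c i..<c (Suc i)} \<noteq> {}" for i using c by (simp add: strict_mono_Suc_iff)
  have fin: "finite (x ` {c i..<c (Suc i)})" for i by simp
  have le: "x t \<le> y i" if "c i \<le> t" "t < c (Suc i)" for t i
    unfolding y_def using that by (intro Max_ge) auto
  have att: "\<exists>t. c i \<le> t \<and> t < c (Suc i) \<and> x t = y i" for i
  proof -
    have "y i \<in> x ` {c i..<c (Suc i)}" unfolding y_def using Max_in[OF fin ne] .
    then show ?thesis by force
  qed
  have inc: "i \<le> c i" for i using strict_mono_imp_increasing[OF c] .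
  have bnd: "(\<exists>m. \<forall>i\<ge>m. y i \<le> k) \<longleftrightarrow> (\<exists>m. \<forall>i\<ge>m. x i \<le> k)"
  proof
    assume "\<exists>m. \<forall>i\<ge>m. y i \<le> k"
    then obtain m where m: "\<And>i. i\<ge>m \<Longrightarrow> y i \<le> k" by auto
    have "x t \<le> k" if "t \<ge> c m" for t
    proof -
      have "c 0 \<le> t" using that strict_mono_less_eq[OF c, of 0 m] by simp
      then obtain i where i: "c i \<le> t" "t < c (Suc i)" using strict_mono_block[OF c] by blast
      then have "m \<le> i" using that c by (metis le_less_trans less_Suc_eq_le strict_mono_less)
      then show ?thesis using le[OF i] m by fastforce
    qed
    then show "\<exists>m. \<forall>i\<ge>m. x i \<le> k" by auto
  next
    assume "\<exists>m. \<forall>i\<ge>m. x i \<le> k"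
    then obtain m where m: "\<And>i. i\<ge>m \<Longrightarrow> x i \<le> k" by auto
    have "y i \<le> k" if "i \<ge> m" for i
      using att[of i] m inc[of i] that by (metis le_trans)
    then show "\<exists>m. \<forall>i\<ge>m. y i \<le> k" by auto
  qed
  have "lsup y k \<longleftrightarrow> lsup x k"
  proof
    assume l: "lsup y k"
    have "\<exists>i\<ge>m. x i = k" for m
    proof -
      obtain i where "i \<ge> m" "y i = k" using l unfolding lsup_def by blast
      then show ?thesis using att[of i] inc[of i] by (metis le_trans)
    qed
    then show "lsup x k" using l bnd unfolding lsup_def by blast
  next
    assume l: "lsup x k"
    then obtain m0 where m0: "\<And>i. i \<ge> m0 \<Longrightarrow> y i \<le> k" using bnd unfolding lsup_def by blast
    have "\<exists>i\<ge>m. y i = k" for m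
    proof -
      obtain t where t: "t \<ge> c (max m m0)" "x t = k" using l unfolding lsup_def by blast
      have "c 0 \<le> t" using t(1) strict_mono_less_eq[OF c, of 0 "max m m0"] by simp
      then obtain i where i: "c i \<le> t" "t < c (Suc i)" using strict_mono_block[OF c] by blast
      then have "max m m0 \<le> i" using t(1) c by (metis le_less_trans less_Suc_eq_le strict_mono_less)
      then show ?thesis using le[OF i] m0[of i] t(2) by (intro exI[of _ i]) auto
    qed
    then show "lsup y k" using l bnd unfolding lsup_def by blast
  qed
  then show ?thesis unfolding y_def .
qed

lemma parity_ok_blocks:
  fixes c :: "nat \<Rightarrow> nat"
  assumes "strict_mono c"
  shows "parity_ok (\<lambda>i. Max (x ` {c i..<c (Suc i)})) \<longleftrightarrow> parity_ok x"
  using lsup_blocks[OF assms, of x] unfolding parity_ok_def by blast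

section \<open>Positional strategies in parity games\<close>

text \<open>The set \<open>W i\<close> is what is generated strictly before stage \<open>i\<close> of the transfinite
  iteration; the stages are indexed by a well-order on a type too large to be exhausted injectively.\<close>

lemma lfp_rank:
  fixes F :: "'p set \<Rightarrow> 'p set"
  assumes F: "mono F"
  shows "\<exists>(R :: 'p set rel) rk W. wf R \<and> (\<forall>p \<in> lfp F. p \<in> F (W (rk p)) \<and> F (W (rk p)) \<subseteq> lfp F
     \<and> (\<forall>p' \<in> F (W (rk p)). (rk p', rk p) \<in> R\<^sup>=) \<and> (\<forall>p' \<in> W (rk p). p' \<in> lfp F \<and> (rk p', rk p) \<in> R))"
proof -
  obtain r :: "'p set rel" where r: "well_order_on UNIV r"
    using well_order_on by blast
  define R where "R = r - Id"
  have wf: "wf R" using r unfolding R_def by (simp add: well_order_on_def)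
  have tot: "(a, b) \<in> R \<or> a = b \<or> (b, a) \<in> R" for a b
    using r unfolding R_def well_order_on_def linear_order_on_def total_on_def by blast
  define G where "G = wfrec R (\<lambda>g i. F (\<Union>j\<in>{j. (j, i) \<in> R}. g j))"
  define W where "W i = (\<Union>j\<in>{j. (j, i) \<in> R}. G j)" for i
  have G: "G i = F (W i)" for i
  proof -
    have "G i = F (\<Union>j\<in>{j. (j, i) \<in> R}. cut G R i j)"
      unfolding G_def by (subst wfrec[OF wf]) simp
    also have "(\<Union>j\<in>{j. (j, i) \<in> R}. cut G R i j) = W i"
      unfolding W_def by (intro SUP_cong) (auto simp: cut_def)
    finally show ?thesis .
  qed
  have sub: "G i \<subseteq> lfp F" for i
  proof (induction i rule: wf_induct_rule[OF wf])
    case (1 i)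
    then have "W i \<subseteq> lfp F" unfolding W_def by blast
    then show ?case unfolding G using F lfp_unfold[OF F] by (metis monoD)
  qed
  have "\<exists>i. G i \<subseteq> W i"
  proof (rule ccontr)
    assume "\<not> ?thesis"
    then have "\<forall>i. \<exists>x. x \<in> G i - W i" by blast
    from choice[OF this] obtain h where h: "\<And>i. h i \<in> G i - W i" by blast
    have "inj h"
    proof (rule injI)
      fix a b assume eq: "h a = h b"
      have "h a \<noteq> h b" if "(a, b) \<in> R" for a b
        using h[of a] h[of b] that unfolding W_def by auto
      then show "a = b" using tot[of a b] eq by metis
    qed
    then have "surj (inv h)" by (rule inj_imp_surj_inv)
    then have "(inv h) ` UNIV = Pow UNIV" by simp
    then show False using Cantors_theorem[of UNIV] by blast
  qed
  then obtain i0 where "G i0 \<subseteq> W i0" by blast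
  \<comment> \<open>A stage that adds nothing new is a pre-fixpoint, hence contains the least
    fixpoint.\<close>
  then have "lfp F \<subseteq> W i0" unfolding G by (rule lfp_lowerbound)
  then have cov: "\<exists>i. p \<in> G i" if "p \<in> lfp F" for p using that unfolding W_def by blast
  have "\<exists>i. p \<in> G i \<and> (\<forall>j. p \<in> G j \<longrightarrow> (i, j) \<in> R\<^sup>=)" if "p \<in> lfp F" for p
  proof -
    obtain i where "i \<in> {i. p \<in> G i}" using cov[OF \<open>p \<in> lfp F\<close>] by blast
    then obtain k where k: "k \<in> {i. p \<in> G i}" "\<And>j. (j, k) \<in> R \<Longrightarrow> j \<notin> {i. p \<in> G i}"
      using wfE_min[OF wf] by metis
    have "(k, j) \<in> R\<^sup>=" if "p \<in> G j" for j using tot[of k j] k(2)[of j] that by auto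
    then show ?thesis using k(1) by blast
  qed
  then obtain rk where rk: "\<And>p. p \<in> lfp F \<Longrightarrow> p \<in> G (rk p)"
    "\<And>p j. p \<in> lfp F \<Longrightarrow> p \<in> G j \<Longrightarrow> (rk p, j) \<in> R\<^sup>=" by metis
  have tr: "trans R" using r unfolding R_def well_order_on_def linear_order_on_def partial_order_on_def
      preorder_on_def by (simp add: trans_diff_Id)
  have "p' \<in> lfp F \<and> (rk p', rk p) \<in> R" if pW: "p' \<in> W (rk p)" for p p'
  proof -
    obtain j where j: "(j, rk p) \<in> R" "p' \<in> G j" using pW unfolding W_def by blast
    then have "p' \<in> lfp F" using sub by blast
    then show ?thesis using rk(2)[of p' j] j transD[OF tr] by blast
  qed
  then show ?thesis using wf rk sub unfolding G
    by (intro exI[of _ R] exI[of _ rk] exI[of _ W] conjI ballI) blast+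
qed

lemma wf_nonincreasing:
  assumes wf: "wf R" and le: "\<And>i. i \<ge> m \<Longrightarrow> (a (Suc i), a i) \<in> R\<^sup>="
  shows "\<exists>m'\<ge>m. \<forall>i\<ge>m'. a i = (a m' :: 'a)"
proof -
  obtain z where z: "z \<in> a ` {m..}" "\<And>y. (y, z) \<in> R \<Longrightarrow> y \<notin> a ` {m..}"
    using wfE_min[OF wf, of "a m" "a ` {m..}"] by blast
  then obtain m' where m': "m' \<ge> m" "a m' = z" by auto
  have "a i = z" if "i \<ge> m'" for i
    using that
  proof (induction i rule: dec_induct)
    case (step i)
    then have "(a (Suc i), z) \<in> R\<^sup>=" using le[of i] m' by simp
    then show ?case using z(2)[of "a (Suc i)"] step m'(1) by auto
  qed (simp add: m')
  with m' show ?thesis by blast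
qed

text \<open>The winning region of the player with parity \<open>b\<close>, as a nested fixpoint: positions of priority
  at least \<open>n\<close> are terminal and won precisely in \<open>Z\<close>; \<open>C\<close> is the controllable predecessor operator.\<close>

primrec win :: "bool \<Rightarrow> ('p set \<Rightarrow> 'p set) \<Rightarrow> ('p \<Rightarrow> nat) \<Rightarrow> nat \<Rightarrow> 'p set \<Rightarrow> 'p set" where
  "win b C pr 0 Z = Z"
| "win b C pr (Suc n) Z = (if even n = b then gfp else lfp)
     (\<lambda>X. win b C pr n {p. if pr p = n then p \<in> C X else p \<in> Z})"

lemma win_mono:
  assumes C: "mono C"
  shows "Z \<subseteq> Z' \<Longrightarrow> win b C pr n Z \<subseteq> win b C pr n Z'"
proof (induction n arbitrary: Z Z')
  case (Suc n)
  have "win b C pr n {p. if pr p = n then p \<in> C X else p \<in> Z}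
      \<subseteq> win b C pr n {p. if pr p = n then p \<in> C X else p \<in> Z'}" for X
    by (rule Suc.IH) (use Suc.prems in auto)
  then show ?case by (simp add: gfp_mono lfp_mono)
qed simp

lemma win_step_mono:
  assumes C: "mono C"
  shows "mono (\<lambda>X. win b C pr n {p. if pr p = n then p \<in> C X else p \<in> Z})"
  by (intro monoI win_mono[OF C]) (use monoD[OF C] in auto)

lemma win_Suc:
  assumes C: "mono C"
  shows "win b C pr (Suc n) Z
    = win b C pr n {p. if pr p = n then p \<in> C (win b C pr (Suc n) Z) else p \<in> Z}"
proof (cases "even n = b")
  case True
  show ?thesis unfolding win.simps if_P[OF True] by (rule gfp_unfold[OF win_step_mono[OF C]])
next
  case False
  show ?thesis unfolding win.simps if_not_P[OF False] by (rule lfp_unfold[OF win_step_mono[OF C]])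
qed

text \<open>Positions of priority at least \<open>n\<close> are never expanded by the fixpoints of
  index below \<open>n\<close>, so one unfolding and induction lead back to
  \<open>Z\<close>.\<close>

lemma win_terminal:
  assumes C: "mono C"
  shows "p \<in> win b C pr n Z \<Longrightarrow> n \<le> pr p \<Longrightarrow> p \<in> Z"
proof (induction n arbitrary: Z)
  case (Suc n)
  from Suc.prems(1) have "p \<in> {p. if pr p = n then p \<in> C (win b C pr (Suc n) Z) else p \<in> Z}"
    using Suc.IH[of "{p. if pr p = n then p \<in> C (win b C pr (Suc n) Z) else p \<in> Z}"] Suc.prems(2)
    unfolding win_Suc[OF C, of b pr n Z, symmetric] by linarith
  then show ?case using Suc.prems(2) by auto
qed simp

text \<open>Complementation exchanges least and greatest fixpoints and the controllable predecessor
  operators of the two players. This is determinacy: the complement of the winning region of one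
  player is the winning region of the other.\<close>

lemma win_dual:
  assumes "\<And>X. D X = - C (- X)"
  shows "win (\<not> b) D pr n (- Z) = - win b C pr n Z"
proof (induction n arbitrary: Z)
  case (Suc n)
  let ?f = "\<lambda>X. win b C pr n {p. if pr p = n then p \<in> C X else p \<in> Z}"
  let ?g = "\<lambda>X. win (\<not> b) D pr n {p. if pr p = n then p \<in> D X else p \<in> - Z}"
  have g: "?g X = - ?f (- X)" for X
  proof -
    have "{p. if pr p = n then p \<in> D X else p \<in> - Z} = - {p. if pr p = n then p \<in> C (- X) else p \<in> Z}"
      by (auto simp: assms)
    then show ?thesis by (simp only: Suc)
  qed
  have lg: "lfp (\<lambda>X. - f (- X)) = - gfp f" for f :: "'a set \<Rightarrow> 'a set"
  proof (rule antisym)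
    have "- X \<subseteq> f (- X) \<Longrightarrow> - X \<subseteq> gfp f" for X by (rule gfp_upperbound)
    then show "- gfp f \<subseteq> lfp (\<lambda>X. - f (- X))" by (intro lfp_greatest) blast
    have "X \<subseteq> f X \<Longrightarrow> lfp (\<lambda>X. - f (- X)) \<subseteq> - X" for X by (rule lfp_lowerbound) auto
    then show "lfp (\<lambda>X. - f (- X)) \<subseteq> - gfp f" unfolding gfp_def by blast
  qed
  have gl: "gfp (\<lambda>X. - f (- X)) = - lfp f" for f :: "'a set \<Rightarrow> 'a set"
    using lg[of "\<lambda>X. - f (- X)"] by simp
  have "win (\<not> b) D pr (Suc n) (- Z) = (if even n = (\<not> b) then gfp ?g else lfp ?g)"
    unfolding win.simps(2) by (rule if_distrib[of "\<lambda>h. h ?g"])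
  also have "\<dots> = - (if even n = b then gfp ?f else lfp ?f)"
    unfolding g using lg[of ?f] gl[of ?f] by (cases "even n"; cases b) (simp_all only: simp_thms if_True if_False)
  also have "\<dots> = - win b C pr (Suc n) Z"
    unfolding win.simps(2) by (simp only: if_distrib[of "\<lambda>h. h ?f"])
  finally show ?case .
qed simp

text \<open>A move of the player is a set \<open>Y\<close> in \<open>Opt p\<close>, from which the
  opponent picks the next position; \<open>\<sigma>\<close> is positional. Induction on the number
  of priorities. If the top priority \<open>n\<close> is good for the player, a play seeing it
  infinitely often is won, and any other play eventually follows the inductive strategy. If it is
  bad, the rank of the least fixpoint falls at each visit to \<open>n\<close>, so there are only
  finitely many visits.\<close>

lemma parity_strategy:
  fixes Opt :: "'p \<Rightarrow> 'p set set" and pr :: "'p \<Rightarrow> nat"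
  assumes C: "\<And>X. C X = {p. \<exists>Y\<in>Opt p. Y \<subseteq> X}"
  shows "\<exists>\<sigma>. (\<forall>p\<in>win b C pr n Z. pr p < n \<longrightarrow> \<sigma> p \<in> Opt p \<and> \<sigma> p \<subseteq> win b C pr n Z)
    \<and> (\<forall>\<pi>. \<pi> 0 \<in> win b C pr n Z \<longrightarrow> (\<forall>i. pr (\<pi> i) < n) \<longrightarrow> (\<forall>i. \<pi> (Suc i) \<in> \<sigma> (\<pi> i))
       \<longrightarrow> (\<exists>k. even k = b \<and> lsup (\<lambda>i. pr (\<pi> i)) k))"
proof (induction n arbitrary: Z)
  case 0
  then show ?case by simp
next
  case (Suc n)
  have mC: "mono C" unfolding C by (auto intro!: monoI)
  define N where "N X = {p. if pr p = n then p \<in> C X else p \<in> Z}" for X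
  define F where "F X = win b C pr n (N X)" for X
  have mF: "mono F" unfolding F_def N_def by (rule win_step_mono[OF mC])
  define X where "X = win b C pr (Suc n) Z"
  have X: "X = F X" unfolding X_def F_def N_def by (rule win_Suc[OF mC])
  obtain sg where sg: "\<And>A p. p \<in> F A \<Longrightarrow> pr p < n \<Longrightarrow> sg A p \<in> Opt p \<and> sg A p \<subseteq> F A"
    and sgw: "\<And>A \<pi>. \<pi> 0 \<in> F A \<Longrightarrow> (\<And>i. pr (\<pi> i) < n) \<Longrightarrow> (\<And>i. \<pi> (Suc i) \<in> sg A (\<pi> i))
       \<Longrightarrow> \<exists>k. even k = b \<and> lsup (\<lambda>i. pr (\<pi> i)) k"
  proof -
    have "\<forall>A. \<exists>\<sigma>. (\<forall>p\<in>F A. pr p < n \<longrightarrow> \<sigma> p \<in> Opt p \<and> \<sigma> p \<subseteq> F A)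
      \<and> (\<forall>\<pi>. \<pi> 0 \<in> F A \<longrightarrow> (\<forall>i. pr (\<pi> i) < n) \<longrightarrow> (\<forall>i. \<pi> (Suc i) \<in> \<sigma> (\<pi> i))
       \<longrightarrow> (\<exists>k. even k = b \<and> lsup (\<lambda>i. pr (\<pi> i)) k))"
      unfolding F_def using Suc.IH by blast
    then obtain sg where "\<forall>A. (\<forall>p\<in>F A. pr p < n \<longrightarrow> sg A p \<in> Opt p \<and> sg A p \<subseteq> F A)
      \<and> (\<forall>\<pi>. \<pi> 0 \<in> F A \<longrightarrow> (\<forall>i. pr (\<pi> i) < n) \<longrightarrow> (\<forall>i. \<pi> (Suc i) \<in> sg A (\<pi> i))
       \<longrightarrow> (\<exists>k. even k = b \<and> lsup (\<lambda>i. pr (\<pi> i)) k))" by metis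
    then show thesis using that[of sg] by blast
  qed
  have top: "\<exists>Y\<in>Opt p. Y \<subseteq> A" if "p \<in> F A" "pr p = n" for p A
    using win_terminal[OF mC, of p b pr n "N A"] that unfolding F_def N_def C by auto
  show ?case
  proof (cases "even n = b")
    case True
    define \<sigma> where "\<sigma> p = (if pr p < n then sg X p else SOME Y. Y \<in> Opt p \<and> Y \<subseteq> X)" for p
    have \<sigma>: "\<sigma> p \<in> Opt p \<and> \<sigma> p \<subseteq> X" if "p \<in> X" "pr p < Suc n" for p
    proof (cases "pr p < n")
      case True
      then show ?thesis using sg[of p X] that X unfolding \<sigma>_def by auto
    next
      case False
      then have "\<exists>Y. Y \<in> Opt p \<and> Y \<subseteq> X" using top[of p X] that X by auto
      from someI_ex[OF this] show ?thesis using False unfolding \<sigma>_def by simp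
    qed
    have "\<exists>k. even k = b \<and> lsup (\<lambda>i. pr (\<pi> i)) k"
      if p0: "\<pi> 0 \<in> X" and pn: "\<And>i. pr (\<pi> i) < Suc n" and st: "\<And>i. \<pi> (Suc i) \<in> \<sigma> (\<pi> i)" for \<pi>
    proof -
      have inX: "\<pi> i \<in> X" for i by (induction i) (use p0 \<sigma> pn st in blast)+
      show ?thesis
      proof (cases "\<exists>m. \<forall>i\<ge>m. pr (\<pi> i) < n")
        case True
        then obtain m where m: "\<And>i. pr (\<pi> (i + m)) < n" by (metis le_add2)
        have "\<exists>k. even k = b \<and> lsup (\<lambda>i. pr (\<pi> (i + m))) k"
        proof (rule sgw[of "\<lambda>i. \<pi> (i + m)" X])
          show "\<pi> (0 + m) \<in> F X" using inX X by simp
          show "\<pi> (Suc i + m) \<in> sg X (\<pi> (i + m))" for i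
            using st[of "i + m"] m[of i] unfolding \<sigma>_def by simp
        qed (rule m)
        then show ?thesis by (simp add: lsup_shift[where x = "\<lambda>i. pr (\<pi> i)"])
      next
        case False
        then have "lsup (\<lambda>i. pr (\<pi> i)) n" unfolding lsup_def using pn by (metis less_Suc_eq less_Suc_eq_le)
        then show ?thesis using \<open>even n = b\<close> by blast
      qed
    qed
    then show ?thesis using \<sigma> unfolding X_def by (intro exI[of _ \<sigma>]) blast
  next
    case False
    have XF: "X = lfp F" unfolding X_def F_def N_def win.simps if_not_P[OF False] ..
    obtain R :: "'p set rel" and rk W where wf: "wf R" and rk: "\<And>p. p \<in> X \<Longrightarrow> p \<in> F (W (rk p))"
      "\<And>p. p \<in> X \<Longrightarrow> F (W (rk p)) \<subseteq> X" "\<And>p p'. p \<in> X \<Longrightarrow> p' \<in> F (W (rk p)) \<Longrightarrow> (rk p', rk p) \<in> R\<^sup>="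
      "\<And>p p'. p \<in> X \<Longrightarrow> p' \<in> W (rk p) \<Longrightarrow> p' \<in> X \<and> (rk p', rk p) \<in> R"
      using lfp_rank[OF mF] unfolding XF by metis
    \<comment> \<open>The inductive strategy that is used depends on the stage
      \<open>W (rk p)\<close>. The result is still positional, since the stage is a function of the
      position.\<close>
    define \<sigma> where "\<sigma> p = (if pr p < n then sg (W (rk p)) p else SOME Y. Y \<in> Opt p \<and> Y \<subseteq> W (rk p))" for p
    have \<sigma>1: "\<sigma> p \<in> Opt p \<and> \<sigma> p \<subseteq> F (W (rk p))" if "p \<in> X" "pr p < n" for p
      using sg[of p "W (rk p)"] that rk(1) unfolding \<sigma>_def by auto
    have \<sigma>2: "\<sigma> p \<in> Opt p \<and> \<sigma> p \<subseteq> W (rk p)" if "p \<in> X" "pr p = n" for p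
    proof -
      have "\<exists>Y. Y \<in> Opt p \<and> Y \<subseteq> W (rk p)" using top[of p "W (rk p)"] that rk(1) by auto
      from someI_ex[OF this] show ?thesis using that unfolding \<sigma>_def by simp
    qed
    have \<sigma>: "\<sigma> p \<in> Opt p \<and> \<sigma> p \<subseteq> X" if "p \<in> X" "pr p < Suc n" for p
      using \<sigma>1[of p] \<sigma>2[of p] rk(2,4)[of p] that by (cases "pr p = n") auto
    have "\<exists>k. even k = b \<and> lsup (\<lambda>i. pr (\<pi> i)) k"
      if p0: "\<pi> 0 \<in> X" and pn: "\<And>i. pr (\<pi> i) < Suc n" and st: "\<And>i. \<pi> (Suc i) \<in> \<sigma> (\<pi> i)" for \<pi>
    proof -
      have inX: "\<pi> i \<in> X" for i by (induction i) (use p0 \<sigma> pn st in blast)+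
      have dec: "(rk (\<pi> (Suc i)), rk (\<pi> i)) \<in> R\<^sup>=" for i
        using \<sigma>1[OF inX, of i] \<sigma>2[OF inX, of i] rk(3,4)[OF inX, of _ i] st[of i] pn[of i]
        by (cases "pr (\<pi> i) = n") auto
      \<comment> \<open>Ranks never increase along the play, so they become constant. From then on
        one and the same inductive strategy is followed, and priority \<open>n\<close>, which would
        lower the rank, cannot occur.\<close>
      obtain m where m: "\<And>i. i \<ge> m \<Longrightarrow> rk (\<pi> i) = rk (\<pi> m)"
        using wf_nonincreasing[OF wf, of 0 "\<lambda>i. rk (\<pi> i)"] dec by blast
      have lt: "pr (\<pi> i) < n" if "i \<ge> m" for i
      proof (rule ccontr)
        assume "\<not> ?thesis"
        then have "pr (\<pi> i) = n" using pn[of i] by simp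
        then have "(rk (\<pi> (Suc i)), rk (\<pi> i)) \<in> R" using \<sigma>2[OF inX] rk(4)[OF inX] st by blast
        then show False using m[of i] m[of "Suc i"] that wf by auto
      qed
      have "\<exists>k. even k = b \<and> lsup (\<lambda>i. pr (\<pi> (i + m))) k"
      proof (rule sgw[of "\<lambda>i. \<pi> (i + m)" "W (rk (\<pi> m))"])
        show "\<pi> (0 + m) \<in> F (W (rk (\<pi> m)))" using rk(1)[OF inX[of m]] by simp
        show "\<pi> (Suc i + m) \<in> sg (W (rk (\<pi> m))) (\<pi> (i + m))" for i
          using st[of "i + m"] lt[of "i + m"] m[of "i + m"] unfolding \<sigma>_def by simp
      qed (simp add: lt)
      then show ?thesis by (simp add: lsup_shift[where x = "\<lambda>i. pr (\<pi> i)"])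
    qed
    then show ?thesis using \<sigma> unfolding X_def by (intro exI[of _ \<sigma>]) blast
  qed
qed

section \<open>Deterministic parity word automata\<close>

primrec drun :: "('q \<Rightarrow> 'l \<Rightarrow> 'q) \<Rightarrow> 'q \<Rightarrow> (nat \<Rightarrow> 'l) \<Rightarrow> nat \<Rightarrow> 'q" where
  "drun \<delta> q w 0 = q"
| "drun \<delta> q w (Suc i) = \<delta> (drun \<delta> q w i) (w i)"

text \<open>States are natural numbers because a definition cannot quantify over the type of states;
  \<open>drecI\<close> admits any finite state set through an injection. Nothing is said about words
  with letters outside \<open>A\<close>.\<close>

definition drec :: "'l set \<Rightarrow> ((nat \<Rightarrow> 'l) \<Rightarrow> bool) \<Rightarrow> bool" where
  "drec A L \<longleftrightarrow> (\<exists>(Q::nat set) q0 \<delta> pr. finite Q \<and> q0 \<in> Q \<and> (\<forall>q\<in>Q. \<forall>a\<in>A. \<delta> q a \<in> Q) \<and>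
     (\<forall>w. (\<forall>i. w i \<in> A) \<longrightarrow> L w = parity_ok (\<lambda>i. pr (drun \<delta> q0 w i))))"

lemma drun_in:
  assumes "q \<in> Q" "\<And>q a. q \<in> Q \<Longrightarrow> a \<in> A \<Longrightarrow> \<delta> q a \<in> Q" "\<And>i. w i \<in> A"
  shows "drun \<delta> q w i \<in> Q"
  by (induction i) (simp_all add: assms)

lemma drecI:
  fixes Q :: "'q set"
  assumes fin: "finite Q" and q0: "q0 \<in> Q" and cl: "\<And>q a. q \<in> Q \<Longrightarrow> a \<in> A \<Longrightarrow> \<delta> q a \<in> Q"
    and L: "\<And>w. (\<And>i. w i \<in> A) \<Longrightarrow> L w = parity_ok (\<lambda>i. pr (drun \<delta> q0 w i))"
  shows "drec A L"
proof -
  obtain f :: "'q \<Rightarrow> nat" where f: "inj_on f Q"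
    using finite_imp_inj_to_nat_seg[OF fin] by blast
  define g where "g = the_inv_into Q f"
  have gf: "g (f q) = q" if "q \<in> Q" for q using the_inv_into_f_f[OF f that] unfolding g_def .
  have run: "drun (\<lambda>n a. f (\<delta> (g n) a)) (f q0) w i = f (drun \<delta> q0 w i)" if "\<And>i. w i \<in> A" for w i
  proof (induction i)
    case (Suc i)
    then show ?case using gf[OF drun_in[OF q0 cl that]] by simp
  qed simp
  have "parity_ok (\<lambda>i. pr (g (drun (\<lambda>n a. f (\<delta> (g n) a)) (f q0) w i))) = L w" if w: "\<And>i. w i \<in> A" for w
    by (simp add: run[OF w] gf[OF drun_in[OF q0 cl w]] L[OF w])
  then show ?thesis unfolding drec_def
    by (intro exI[of _ "f ` Q"] exI[of _ "f q0"] exI[of _ "\<lambda>n a. f (\<delta> (g n) a)"] exI[of _ "\<lambda>n. pr (g n)"])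
       (use fin q0 cl gf in simp)
qed

lemma drecE:
  assumes "drec A L"
  obtains Q :: "nat set" and q0 \<delta> pr B where "finite Q" "q0 \<in> Q" "\<And>q a. q \<in> Q \<Longrightarrow> a \<in> A \<Longrightarrow> \<delta> q a \<in> Q"
    "\<And>w. (\<And>i. w i \<in> A) \<Longrightarrow> L w = parity_ok (\<lambda>i. pr (drun \<delta> q0 w i))" "\<And>q. pr q \<le> (B::nat)"
proof -
  from assms obtain Q :: "nat set" and q0 \<delta> pr where Q: "finite Q" "q0 \<in> Q" "\<forall>q\<in>Q. \<forall>a\<in>A. \<delta> q a \<in> Q"
    "\<forall>w. (\<forall>i. w i \<in> A) \<longrightarrow> L w = parity_ok (\<lambda>i. pr (drun \<delta> q0 w i))"
    unfolding drec_def by blast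
  \<comment> \<open>Resetting the priorities outside \<open>Q\<close> gives a bound that holds for
    every number, without a membership condition.\<close>
  define pr' where "pr' q = (if q \<in> Q then pr q else 0)" for q
  have "L w = parity_ok (\<lambda>i. pr' (drun \<delta> q0 w i))" if "\<And>i. w i \<in> A" for w
  proof -
    have "pr' (drun \<delta> q0 w i) = pr (drun \<delta> q0 w i)" for i
      using drun_in[of q0 Q A \<delta> w i] Q that unfolding pr'_def by auto
    then show ?thesis using Q that by simp
  qed
  moreover have "pr' q \<le> Max (insert 0 (pr ` Q))" for q
    using Q(1) unfolding pr'_def by auto
  ultimately show thesis using that[of Q q0 \<delta> pr' "Max (insert 0 (pr ` Q))"] Q by blast
qed

lemma drec_compl:
  assumes "drec A L"
  shows "drec A (\<lambda>w. \<not> L w)"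
proof -
  obtain Q :: "nat set" and q0 \<delta> pr B where Q: "finite Q" "q0 \<in> Q" "\<And>q a. q \<in> Q \<Longrightarrow> a \<in> A \<Longrightarrow> \<delta> q a \<in> Q"
    "\<And>w. (\<And>i. w i \<in> A) \<Longrightarrow> L w = parity_ok (\<lambda>i. pr (drun \<delta> q0 w i))" "\<And>q. pr q \<le> (B::nat)"
    using drecE[OF assms] by metis
  show ?thesis
    by (rule drecI[where pr = "\<lambda>q. Suc (pr q)", OF Q(1-3)])
       (simp_all add: Q(4) parity_ok_Suc[where B = B, OF Q(5)])
qed

lemma drun_map: "drun (\<lambda>q a. \<delta> q (f a)) q0 w i = drun \<delta> q0 (\<lambda>i. f (w i)) i"
  by (induction i) simp_all

lemma drec_map:
  fixes f :: "'b \<Rightarrow> 'a"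
  assumes "drec B L" "\<And>a. a \<in> A \<Longrightarrow> f a \<in> B"
  shows "drec A (\<lambda>w. L (\<lambda>i. f (w i)))"
proof -
  obtain Q :: "nat set" and q0 \<delta> pr M where Q: "finite Q" "q0 \<in> Q" "\<And>q a. q \<in> Q \<Longrightarrow> a \<in> B \<Longrightarrow> \<delta> q a \<in> Q"
    "\<And>w. (\<And>i. w i \<in> B) \<Longrightarrow> L w = parity_ok (\<lambda>i. pr (drun \<delta> q0 w i))" "\<And>q. pr q \<le> (M::nat)"
    using drecE[OF assms(1)] by metis
  show ?thesis
  proof (rule drecI[where \<delta> = "\<lambda>q a. \<delta> q (f a)" and pr = pr, OF Q(1,2)])
    fix w :: "nat \<Rightarrow> 'b" assume "\<And>i. w i \<in> A"
    then show "L (\<lambda>i. f (w i)) = parity_ok (\<lambda>i. pr (drun (\<lambda>q a. \<delta> q (f a)) q0 w i))"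
      unfolding drun_map using Q(4)[of "\<lambda>i. f (w i)"] assms(2) by simp
  qed (use Q(3) assms(2) in blast)
qed

section \<open>Transition profiles of finite words and their infinite products\<close>

text \<open>A triple \<open>(q, p, q')\<close> stands for a finite run from \<open>q\<close> to
  \<open>q'\<close> with maximal priority \<open>p\<close>; a set of such triples is the profile of
  a finite word, and \<open>mul\<close> is concatenation in the semigroup of profiles.\<close>

definition mul :: "('q \<times> nat \<times> 'q) set \<Rightarrow> ('q \<times> nat \<times> 'q) set \<Rightarrow> ('q \<times> nat \<times> 'q) set" where
  "mul X Y = {(q, max p p', q'') |q p q' p' q''. (q, p, q') \<in> X \<and> (q', p', q'') \<in> Y}"

lemma mul_iff: "(q, m, q'') \<in> mul X Y \<longleftrightarrow> (\<exists>q' p p'. (q, p, q') \<in> X \<and> (q', p', q'') \<in> Y \<and> m = max p p')"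
  unfolding mul_def by blast

lemma mul_assoc: "mul (mul X Y) Z = mul X (mul Y Z)"
proof (rule set_eqI)
  fix t :: "'a \<times> nat \<times> 'a"
  obtain q m q'' where t: "t = (q, m, q'')" by (cases t)
  show "t \<in> mul (mul X Y) Z \<longleftrightarrow> t \<in> mul X (mul Y Z)"
  proof
    assume "t \<in> mul (mul X Y) Z"
    then obtain q1 p1 q2 p2 p3 where "(q,p1,q1) \<in> X" "(q1,p2,q2) \<in> Y" "(q2,p3,q'') \<in> Z" "m = max (max p1 p2) p3"
      unfolding t mul_iff by blast
    then show "t \<in> mul X (mul Y Z)" unfolding t mul_iff by (metis max.assoc)
  next
    assume "t \<in> mul X (mul Y Z)"
    then obtain q1 p1 q2 p2 p3 where "(q,p1,q1) \<in> X" "(q1,p2,q2) \<in> Y" "(q2,p3,q'') \<in> Z" "m = max p1 (max p2 p3)"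
      unfolding t mul_iff by blast
    then show "t \<in> mul (mul X Y) Z" unfolding t mul_iff by (metis max.assoc)
  qed
qed

text \<open>Segment products; the value on empty segments is junk that is never used.\<close>

fun seg :: "(nat \<Rightarrow> ('q \<times> nat \<times> 'q) set) \<Rightarrow> nat \<Rightarrow> nat \<Rightarrow> ('q \<times> nat \<times> 'q) set" where
  "seg g i 0 = {}"
| "seg g i (Suc j) = (if i < j then mul (seg g i j) (g j) else g j)"

lemma seg_step: "i < j \<Longrightarrow> seg g i (Suc j) = mul (seg g i j) (g j)" by simp

lemma seg_split: "i < j \<Longrightarrow> j < k \<Longrightarrow> seg g i k = mul (seg g i j) (seg g j k)"
proof (induction k)
  case (Suc k)
  show ?case
  proof (cases "j < k")
    case True
    then show ?thesis using Suc by (simp add: mul_assoc)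
  next
    case False
    then have "j = k" using Suc.prems by simp
    then show ?thesis using Suc.prems by simp
  qed
qed simp

text \<open>Induction on the right end. Segments of length one form a separate case, since the junk
  value of an empty segment is not a unit for \<open>mul\<close>.\<close>

lemma seg_path:
  "i < j \<Longrightarrow> (q, m, q') \<in> seg g i j \<longleftrightarrow> (\<exists>qs ps. qs i = q \<and> qs j = q' \<and>
     (\<forall>t. i \<le> t \<longrightarrow> t < j \<longrightarrow> (qs t, ps t, qs (Suc t)) \<in> g t) \<and> m = Max (ps ` {i..<j}))"
proof (induction j arbitrary: m q')
  case (Suc j)
  show ?case
  proof (cases "i < j")
    case False
    then have ij: "i = j" using Suc.prems by simp
    show ?thesis
    proof
      assume "(q, m, q') \<in> seg g i (Suc j)"
      then show "\<exists>qs ps. qs i = q \<and> qs (Suc j) = q' \<and>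
         (\<forall>t. i \<le> t \<longrightarrow> t < Suc j \<longrightarrow> (qs t, ps t, qs (Suc t)) \<in> g t) \<and> m = Max (ps ` {i..<Suc j})"
        using ij by (intro exI[of _ "\<lambda>t. if t = i then q else q'"] exI[of _ "\<lambda>t. m"])
          (auto simp: less_Suc_eq)
    next
      assume "\<exists>qs ps. qs i = q \<and> qs (Suc j) = q' \<and>
         (\<forall>t. i \<le> t \<longrightarrow> t < Suc j \<longrightarrow> (qs t, ps t, qs (Suc t)) \<in> g t) \<and> m = Max (ps ` {i..<Suc j})"
      then obtain qs ps where "qs i = q" "qs (Suc j) = q'" "(qs i, ps i, qs (Suc i)) \<in> g i" "m = Max (ps ` {i..<Suc j})"
        using ij by blast
      moreover have "{i..<Suc j} = {i}" using ij by auto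
      ultimately show "(q, m, q') \<in> seg g i (Suc j)" using ij by simp
    qed
  next
    case True
    have set: "{i..<Suc j} = insert j {i..<j}" using True by auto
    have ne: "{i..<j} \<noteq> {}" using True by simp
    show ?thesis
    proof
      assume "(q, m, q') \<in> seg g i (Suc j)"
      then obtain q1 p p' where 1: "(q, p, q1) \<in> seg g i j" "(q1, p', q') \<in> g j" "m = max p p'"
        unfolding seg_step[OF True] mul_iff by blast
      then obtain qs ps where 2: "qs i = q" "qs j = q1" "\<forall>t. i \<le> t \<longrightarrow> t < j \<longrightarrow> (qs t, ps t, qs (Suc t)) \<in> g t"
        "p = Max (ps ` {i..<j})" unfolding Suc.IH[OF True] by blast
      have "ps(j := p') ` {i..<j} = ps ` {i..<j}" by auto
      then have "ps(j := p') ` {i..<Suc j} = insert p' (ps ` {i..<j})" unfolding set image_insert by simp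
      then have "Max (ps(j := p') ` {i..<Suc j}) = max p' p" using 2(4) ne
        by (simp only: Max_insert finite_imageI finite_atLeastLessThan image_is_empty not_False_eq_True)
      then show "\<exists>qs ps. qs i = q \<and> qs (Suc j) = q' \<and>
         (\<forall>t. i \<le> t \<longrightarrow> t < Suc j \<longrightarrow> (qs t, ps t, qs (Suc t)) \<in> g t) \<and> m = Max (ps ` {i..<Suc j})"
        using 1 2 True by (intro exI[of _ "qs(Suc j := q')"] exI[of _ "ps(j := p')"])
          (auto simp: less_Suc_eq max.commute)
    next
      assume "\<exists>qs ps. qs i = q \<and> qs (Suc j) = q' \<and>
         (\<forall>t. i \<le> t \<longrightarrow> t < Suc j \<longrightarrow> (qs t, ps t, qs (Suc t)) \<in> g t) \<and> m = Max (ps ` {i..<Suc j})"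
      then obtain qs ps where 1: "qs i = q" "qs (Suc j) = q'"
         "\<forall>t. i \<le> t \<longrightarrow> t < Suc j \<longrightarrow> (qs t, ps t, qs (Suc t)) \<in> g t" "m = Max (ps ` {i..<Suc j})" by blast
      have "(q, Max (ps ` {i..<j}), qs j) \<in> seg g i j" unfolding Suc.IH[OF True]
        using 1 by (intro exI[of _ qs] exI[of _ ps]) auto
      moreover have "(qs j, ps j, q') \<in> g j" using 1 True by auto
      moreover have "m = max (Max (ps ` {i..<j})) (ps j)" using 1(4) ne unfolding set by (simp add: max.commute)
      ultimately show "(q, m, q') \<in> seg g i (Suc j)" unfolding seg_step[OF True] mul_iff by blast
    qed
  qed
qed simp

text \<open>Acceptance of an infinite word by a nondeterministic parity automaton, read off the
  profiles of its factors alone.\<close>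

definition acc_seq :: "'q \<Rightarrow> (nat \<Rightarrow> ('q \<times> nat \<times> 'q) set) \<Rightarrow> bool" where
  "acc_seq q g \<longleftrightarrow> (\<exists>qs ps. qs 0 = q \<and> (\<forall>i. (qs i, ps i, qs (Suc i)) \<in> g i) \<and> parity_ok ps)"

text \<open>A run is cut into blocks, whose maxima have the same limit superior. Conversely each
  triple of a grouped product expands into a path, and consecutive paths fit together because they
  share the state at the cut.\<close>

lemma acc_seq_group:
  assumes c: "strict_mono c" "c 0 = 0"
  shows "acc_seq q (\<lambda>i. seg g (c i) (c (Suc i))) \<longleftrightarrow> acc_seq q g"
proof
  have lt: "c i < c (Suc i)" for i using c(1) by (simp add: strict_mono_Suc_iff)
  {
    assume "acc_seq q g"
    then obtain qs ps where 1: "qs 0 = q" "\<forall>i. (qs i, ps i, qs (Suc i)) \<in> g i" "parity_ok ps"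
      unfolding acc_seq_def by blast
    have "(qs (c i), Max (ps ` {c i..<c (Suc i)}), qs (c (Suc i))) \<in> seg g (c i) (c (Suc i))" for i
      unfolding seg_path[OF lt] using 1(2) by (intro exI[of _ qs] exI[of _ ps]) simp
    moreover have "parity_ok (\<lambda>i. Max (ps ` {c i..<c (Suc i)}))" using 1(3) parity_ok_blocks[OF c(1)] by blast
    ultimately show "acc_seq q (\<lambda>i. seg g (c i) (c (Suc i)))" unfolding acc_seq_def
      using 1(1) c(2) by (intro exI[of _ "\<lambda>i. qs (c i)"] exI[of _ "\<lambda>i. Max (ps ` {c i..<c (Suc i)})"]) simp
  }
  assume "acc_seq q (\<lambda>i. seg g (c i) (c (Suc i)))"
  then obtain qs ps where 1: "qs 0 = q" "\<forall>i. (qs i, ps i, qs (Suc i)) \<in> seg g (c i) (c (Suc i))" "parity_ok ps"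
    unfolding acc_seq_def by blast
  have "\<forall>i. \<exists>qt pt. qt (c i) = qs i \<and> qt (c (Suc i)) = qs (Suc i) \<and>
     (\<forall>t. c i \<le> t \<longrightarrow> t < c (Suc i) \<longrightarrow> (qt t, pt t, qt (Suc t)) \<in> g t) \<and> ps i = Max (pt ` {c i..<c (Suc i)})"
    using 1(2) unfolding seg_path[OF lt] by blast
  then obtain qt pt where 2: "\<And>i. qt i (c i) = qs i" "\<And>i. qt i (c (Suc i)) = qs (Suc i)"
     "\<And>i t. c i \<le> t \<Longrightarrow> t < c (Suc i) \<Longrightarrow> (qt i t, pt i t, qt i (Suc t)) \<in> g t"
     "\<And>i. ps i = Max (pt i ` {c i..<c (Suc i)})" by metis
  obtain b where b: "\<And>t. c (b t) \<le> t" "\<And>t. t < c (Suc (b t))"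
    using strict_mono_block[OF c(1)] c(2) by (metis zero_le)
  have bu: "b t = i" if "c i \<le> t" "t < c (Suc i)" for i t
    using strict_mono_block_unique[OF c(1) b that] .
  define Qs Ps where "Qs t = qt (b t) t" and "Ps t = pt (b t) t" for t
  have "(Qs t, Ps t, Qs (Suc t)) \<in> g t" for t
  proof (cases "Suc t < c (Suc (b t))")
    case True
    then have "b (Suc t) = b t" using b(1)[of t] by (intro bu) auto
    then show ?thesis using 2(3)[OF b] unfolding Qs_def Ps_def by simp
  next
    case False
    then have e: "Suc t = c (Suc (b t))" using b(2)[of t] by simp
    then have "b (Suc t) = Suc (b t)" using lt by (intro bu) auto
    then have "Qs (Suc t) = qt (b t) (Suc t)" unfolding Qs_def using e 2(1)[of "Suc (b t)"] 2(2)[of "b t"] by simp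
    then show ?thesis using 2(3)[OF b] unfolding Qs_def Ps_def by simp
  qed
  moreover have "Qs 0 = q" using 2(1)[of 0] bu[of 0 0] lt[of 0] 1(1) c(2) unfolding Qs_def by simp
  moreover have "parity_ok Ps"
  proof -
    have "Ps ` {c i..<c (Suc i)} = pt i ` {c i..<c (Suc i)}" for i
      unfolding Ps_def by (intro image_cong refl) (metis atLeastLessThan_iff bu)
    then have "(\<lambda>i. Max (Ps ` {c i..<c (Suc i)})) = ps" by (simp only: 2(4)[symmetric])
    then show ?thesis using 1(3) parity_ok_blocks[OF c(1), of Ps] by simp
  qed
  ultimately show "acc_seq q g" unfolding acc_seq_def by blast
qed

type_synonym 'q elt = "('q \<times> nat \<times> 'q) set"

text \<open>Linked pairs: the possible values of a Ramsey factorisation into a prefix and equal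
  idempotent factors.\<close>

definition lin :: "('q \<times> nat \<times> 'q) set \<Rightarrow> ('q \<times> nat \<times> 'q) set \<Rightarrow> bool" where
  "lin s f \<longleftrightarrow> mul f f = f \<and> mul s f = s"

definition acc_lin :: "'q \<Rightarrow> ('q \<times> nat \<times> 'q) set \<Rightarrow> ('q \<times> nat \<times> 'q) set \<Rightarrow> bool" where
  "acc_lin q s f \<longleftrightarrow> acc_seq q (case_nat s (\<lambda>_. f))"

text \<open>Insert \<open>f\<close> and \<open>f'\<close> alternately and bracket in two ways:
  \<open>s \<cdot> (f f') \<cdot> (f f') \<dots> = (s f) \<cdot> (f' f) \<cdot> (f' f) \<dots>\<close>.\<close>

lemma acc_lin_eq:
  assumes "mul f f' = f'" "mul f' f = f" "mul s f = s"
  shows "acc_lin q s f \<longleftrightarrow> acc_lin q s f'"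
proof -
  define G where "G i = (if i = 0 then s else if odd i then f else f')" for i :: nat
  define c where "c i = (if i = 0 then 0 else 2 * i - 1)" for i :: nat
  have c: "strict_mono c" by (auto simp: strict_mono_Suc_iff c_def)
  have "seg G (c i) (c (Suc i)) = case_nat s (\<lambda>_. f') i" for i
    by (cases i) (simp_all add: c_def G_def assms)
  then have 1: "acc_lin q s f' \<longleftrightarrow> acc_seq q G"
    using acc_seq_group[OF c, of q G] by (simp add: acc_lin_def c_def)
  have d: "strict_mono (\<lambda>i::nat. 2 * i)" by (simp add: strict_mono_Suc_iff)
  have "seg G (2 * i) (2 * Suc i) = case_nat s (\<lambda>_. f) i" for i
  proof (cases i)
    case (Suc k)
    have "seg G (2 * i) (2 * Suc i) = mul (G (2 * i)) (G (2 * i + 1))" by simp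
    then show ?thesis using assms Suc by (simp add: G_def)
  qed (simp add: G_def assms numeral_2_eq_2)
  then have 2: "acc_lin q s f \<longleftrightarrow> acc_seq q G"
    using acc_seq_group[OF d, of q G] by (simp add: acc_lin_def)
  show ?thesis using 1 2 by simp
qed

section \<open>Recurring linked pairs and Ramsey factorisations\<close>

text \<open>Taking the first return to \<open>f\<close> gives each start \<open>m\<close> at most
  one event, so infinitely many events have infinitely many different starts.\<close>

definition ev :: "(nat \<Rightarrow> ('q \<times> nat \<times> 'q) set) \<Rightarrow> ('q \<times> nat \<times> 'q) set \<Rightarrow> ('q \<times> nat \<times> 'q) set \<Rightarrow> nat \<Rightarrow> bool" where
  "ev g s f n \<longleftrightarrow> (\<exists>m. 0 < m \<and> m < n \<and> seg g 0 m = s \<and> seg g m n = f \<and> (\<forall>k. m < k \<longrightarrow> k < n \<longrightarrow> seg g m k \<noteq> f))"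

definition ev_inf where "ev_inf g s f \<longleftrightarrow> (\<forall>m. \<exists>n\<ge>m. ev g s f n)"

definition cuts :: "(nat \<Rightarrow> ('q \<times> nat \<times> 'q) set) \<Rightarrow> ('q \<times> nat \<times> 'q) set \<Rightarrow> ('q \<times> nat \<times> 'q) set \<Rightarrow> (nat \<Rightarrow> nat) \<Rightarrow> bool" where
  "cuts g s f c \<longleftrightarrow> strict_mono c \<and> 0 < c 0 \<and> (\<forall>i. seg g 0 (c i) = s) \<and> (\<forall>i j. i < j \<longrightarrow> seg g (c i) (c j) = f)"

lemma cuts_lin:
  assumes "cuts g s f c"
  shows "lin s f"
proof -
  have c: "strict_mono c" "0 < c 0" "\<And>i. seg g 0 (c i) = s" "\<And>i j. i < j \<Longrightarrow> seg g (c i) (c j) = f"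
    using assms unfolding cuts_def by auto
  have lt: "c i < c j" if "i < j" for i j using c(1) that by (simp add: strict_mono_less)
  have "mul f f = f" using seg_split[OF lt lt, of 0 1 2 g] c(4)[of 0 1] c(4)[of 1 2] c(4)[of 0 2] by simp
  moreover have "mul s f = s" using seg_split[OF c(2) lt, of 1 g] c(3)[of 0] c(3)[of 1] c(4)[of 0 1] by simp
  ultimately show ?thesis unfolding lin_def by simp
qed

text \<open>From every cut the value \<open>f\<close> is reached again, at the latest at the next
  cut; the first time it is reached is an event.\<close>

lemma cuts_ev_inf:
  assumes "cuts g s f c"
  shows "ev_inf g s f"
  unfolding ev_inf_def
proof
  fix m
  have c: "strict_mono c" "0 < c 0" "\<And>i. seg g 0 (c i) = s" "\<And>i j. i < j \<Longrightarrow> seg g (c i) (c j) = f"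
    using assms unfolding cuts_def by auto
  let ?P = "\<lambda>n. c m < n \<and> seg g (c m) n = f"
  have "?P (c (Suc m))" using c by (simp add: strict_mono_less)
  then have L: "?P (LEAST n. ?P n)" by (rule LeastI)
  have "c 0 \<le> c m" using c(1) by (simp add: strict_mono_less_eq)
  then have "0 < c m" using c(2) by simp
  moreover have "seg g (c m) k \<noteq> f" if "c m < k" "k < (LEAST n. ?P n)" for k
    using not_less_Least[OF that(2)] that(1) by blast
  ultimately have "ev g s f (LEAST n. ?P n)" unfolding ev_def using L c(3) by blast
  moreover have "m \<le> (LEAST n. ?P n)" using L strict_mono_imp_increasing[OF c(1), of m] by linarith
  ultimately show "\<exists>n\<ge>m. ev g s f n" by blast
qed

lemma cuts_acc:
  assumes "cuts g s f c"
  shows "acc_seq q g \<longleftrightarrow> acc_lin q s f"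
proof -
  have c: "strict_mono c" "0 < c 0" "\<And>i. seg g 0 (c i) = s" "\<And>i j. i < j \<Longrightarrow> seg g (c i) (c j) = f"
    using assms unfolding cuts_def by auto
  define d where "d = case_nat 0 c"
  have d: "strict_mono d" unfolding strict_mono_Suc_iff d_def
  proof
    fix n show "case_nat 0 c n < case_nat 0 c (Suc n)"
      using c(1,2) by (cases n) (simp_all add: strict_mono_Suc_iff)
  qed
  have "seg g (d i) (d (Suc i)) = case_nat s (\<lambda>_. f) i" for i
    by (cases i) (simp_all add: d_def c(3,4))
  then show ?thesis using acc_seq_group[OF d, of q g] by (simp add: acc_lin_def d_def)
qed

text \<open>The deterministic automaton remembers the value of the prefix read so far and, for the
  segments still waited for, the triples (value before the start, target value, current value).\<close>

definition mc_step :: "('q elt) set \<Rightarrow> 'q elt option \<times> ('q elt \<times> 'q elt \<times> 'q elt) set \<Rightarrow> 'q elt \<Rightarrow>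
    'q elt option \<times> ('q elt \<times> 'q elt \<times> 'q elt) set" where
  "mc_step S st a = (Some (case fst st of None \<Rightarrow> a | Some x \<Rightarrow> mul x a),
     {(s, f, mul y a) |s f y. (s, f, y) \<in> snd st \<and> y \<noteq> f} \<union> {(s, f, a) |s f. fst st = Some s \<and> f \<in> S})"

text \<open>A smaller right ideal of \<open>f\<close> gives a larger priority, so the limit superior
  selects a recurring linked pair whose right ideal has least size. The last bit makes the priority
  even exactly if that pair describes an accepted word. With \<open>S\<close> finite the subtraction
  is never truncated.\<close>

definition mc_val :: "'q \<Rightarrow> ('q elt) set \<Rightarrow> 'q elt \<Rightarrow> 'q elt \<Rightarrow> nat" where
  "mc_val q S s f = 2 * (card S - card (mul f ` S)) + (if acc_lin q s f then 0 else 1)"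

definition mc_pr :: "'q \<Rightarrow> ('q elt) set \<Rightarrow> 'q elt option \<times> ('q elt \<times> 'q elt \<times> 'q elt) set \<Rightarrow> nat" where
  "mc_pr q S st = Max (insert 0 {mc_val q S s f |s f. (s, f) \<in> S \<times> S \<and> lin s f \<and> (s, f, f) \<in> snd st})"

context
  fixes S :: "('q \<times> nat \<times> 'q) set set" and g :: "nat \<Rightarrow> ('q \<times> nat \<times> 'q) set"
  assumes fin: "finite S" and closed: "\<forall>x\<in>S. \<forall>y\<in>S. mul x y \<in> S" and vals: "\<forall>i. g i \<in> S"
begin

lemma seg_in: "i < j \<Longrightarrow> seg g i j \<in> S"
  by (induction j) (auto simp: vals[rule_format] closed[rule_format] less_Suc_eq)

text \<open>Ramsey's theorem for pairs of positions coloured by the value of the segment between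
  them. The positions come from a given infinite set, so that the cuts can be forced to lie at
  starts of events.\<close>

lemma ramsey_cuts:
  assumes Z: "infinite Z"
  obtains c :: "nat \<Rightarrow> nat" and f where "strict_mono c" "\<forall>i. c i \<in> Z" "\<forall>i j. i < j \<longrightarrow> seg g (c i) (c j) = f"
proof -
  obtain e :: "_ \<Rightarrow> nat" and N :: nat where e: "inj_on e S" "e ` S = {i. i < N}"
    using finite_imp_inj_to_nat_seg[OF fin] by metis
  define col where "col X = e (seg g (Min X) (Max X))" for X
  have col2: "col {x, y} = e (seg g x y)" if "x < y" for x y using that unfolding col_def by simp
  have eN: "e (seg g x y) < N" if "x < y" for x y using seg_in[OF that] e(2) by blast
  have "\<forall>x\<in>Z. \<forall>y\<in>Z. x \<noteq> y \<longrightarrow> col {x, y} < N"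
    using eN col2 by (metis insert_commute linorder_neqE_nat)
  from Ramsey2[OF Z this] obtain Y t where Y: "Y \<subseteq> Z" "infinite Y"
    "\<forall>x\<in>Y. \<forall>y\<in>Y. x \<noteq> y \<longrightarrow> col {x, y} = t" by blast
  define c where "c = enumerate Y"
  have c: "strict_mono c" "\<And>i. c i \<in> Y" unfolding c_def
    using Y(2) by (auto simp: strict_mono_enumerate enumerate_in_set)
  have col_c: "seg g (c i) (c j) = seg g (c 0) (c 1)" if "i < j" for i j
  proof -
    have lt: "c i < c j" "c 0 < c 1" using c(1) that by (simp_all add: strict_mono_less)
    then have "e (seg g (c i) (c j)) = e (seg g (c 0) (c 1))"
      using Y(3) c(2) col2[OF lt(1)] col2[OF lt(2)] by (metis less_irrefl)
    then show ?thesis using e(1) seg_in[OF lt(1)] seg_in[OF lt(2)] by (metis inj_onD)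
  qed
  then show thesis using that[OF c(1)] c(2) Y(1) by blast
qed

lemma cuts_exist: "\<exists>s f c. cuts g s f c"
proof -
  obtain c :: "nat \<Rightarrow> nat" and f where c: "strict_mono c" "\<forall>i. c i \<in> {0<..}" "\<forall>i j. i < j \<longrightarrow> seg g (c i) (c j) = f"
    by (rule ramsey_cuts[OF infinite_Ioi[of "0::nat"]])
  have c0: "0 < c i" for i using c(2) by simp
  \<comment> \<open>Dropping the first cut makes the prefix values equal: each is the prefix up to
    \<open>c 0\<close> followed by \<open>f\<close>.\<close>
  have "seg g 0 (c (Suc i)) = mul (seg g 0 (c 0)) f" for i
    using seg_split[of 0 "c 0" "c (Suc i)" g] c c0 by (simp add: strict_mono_less)
  then have "cuts g (mul (seg g 0 (c 0)) f) f (\<lambda>i. c (Suc i))" unfolding cuts_def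
    using c c0 by (simp add: strict_mono_Suc_iff)
  then show ?thesis by blast
qed

text \<open>Infinitely many events have infinitely many starts, all with prefix value
  \<open>s\<close>. Ramsey's theorem on the starts gives a factorisation with some idempotent
  \<open>f'\<close>, and the event belonging to the first cut puts an \<open>f\<close> at the
  beginning of a factor, hence \<open>f'\<close> into the right ideal of \<open>f\<close>.\<close>

lemma ev_inf_cuts:
  assumes "ev_inf g s f"
  shows "\<exists>f' c x. cuts g s f' c \<and> x \<in> S \<and> f' = mul f x"
proof -
  define P where "P m n \<longleftrightarrow> 0 < m \<and> m < n \<and> seg g 0 m = s \<and> seg g m n = f \<and> (\<forall>k. m < k \<longrightarrow> k < n \<longrightarrow> seg g m k \<noteq> f)" for m n
  define Z where "Z = {m. \<exists>n. P m n}"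
  have un: "n = n'" if "P m n" "P m n'" for m n n' using that unfolding P_def by (metis linorder_neqE_nat)
  have Zi: "infinite Z"
  proof
    assume Zf: "finite Z"
    define h where "h m = (THE n. P m n)" for m
    have h: "h m = n" if "P m n" for m n unfolding h_def using that un by blast
    obtain n where n: "n \<ge> Suc (Max (insert 0 (h ` Z)))" "ev g s f n"
      using assms unfolding ev_inf_def by blast
    then obtain m where "P m n" unfolding ev_def P_def by blast
    then have "m \<in> Z" "h m = n" using h unfolding Z_def by auto
    then have "n \<le> Max (insert 0 (h ` Z))" using Zf by (intro Max_ge) auto
    with n(1) show False by simp
  qed
  obtain c :: "nat \<Rightarrow> nat" and f' where c: "strict_mono c" "\<forall>i. c i \<in> Z" "\<forall>i j. i < j \<longrightarrow> seg g (c i) (c j) = f'"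
    by (rule ramsey_cuts[OF Zi])
  have "0 < c i \<and> seg g 0 (c i) = s" for i using c(2)[rule_format, of i] unfolding Z_def P_def by blast
  then have cu: "cuts g s f' c" unfolding cuts_def using c by blast
  obtain n where "P (c 0) n" using c(2)[rule_format, of 0] unfolding Z_def by blast
  then have n: "c 0 < n" "seg g (c 0) n = f" unfolding P_def by auto
  have n2: "n < c (Suc n)" using strict_mono_imp_increasing[OF c(1), of "Suc n"] by simp
  have "f' = mul f (seg g n (c (Suc n)))" using seg_split[OF n(1) n2, of g] n(2) c(3)[rule_format, of 0 "Suc n"] by simp
  then show ?thesis using cu seg_in[OF n2] by blast
qed

text \<open>If \<open>f\<close> generates a minimal right ideal among the values recurring after \<open>s\<close>, then the
  linked pair that really describes the word has the same right ideal, and \<open>acc_lin_eq\<close> applies.\<close>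

lemma ev_inf_acc:
  assumes s: "ev_inf g s f" "lin s f" "f \<in> S"
    and min: "\<And>f'. f' \<in> S \<Longrightarrow> lin s f' \<Longrightarrow> ev_inf g s f' \<Longrightarrow> card (mul f ` S) \<le> card (mul f' ` S)"
  shows "acc_seq q g \<longleftrightarrow> acc_lin q s f"
proof -
  obtain f' c x where f': "cuts g s f' c" "x \<in> S" "f' = mul f x" using ev_inf_cuts[OF s(1)] by blast
  have fS: "f' \<in> S" using f' closed[rule_format] s(3) by simp
  have lin: "lin s f'" by (rule cuts_lin[OF f'(1)])
  have "mul f' y \<in> mul f ` S" if "y \<in> S" for y
    using that f' closed by (auto simp: mul_assoc)
  then have "mul f' ` S \<subseteq> mul f ` S" by blast
  then have eq: "mul f' ` S = mul f ` S"
    using min[OF fS lin cuts_ev_inf[OF f'(1)]] fin by (simp add: card_seteq)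
  have "mul f f \<in> mul f' ` S" unfolding eq using s(3) by (rule imageI)
  then obtain y where y: "y \<in> S" "mul f f = mul f' y" by (rule imageE)
  then have y: "y \<in> S" "f = mul f' y" using s(2) unfolding lin_def by simp_all
  have 1: "mul f f' = f'" unfolding f'(3) using s(2) by (simp add: lin_def mul_assoc[symmetric])
  have 2: "mul f' f = f" using y(2) lin by (metis lin_def mul_assoc)
  have "acc_lin q s f = acc_lin q s f'" by (rule acc_lin_eq[OF 1 2]) (use s(2) in \<open>simp add: lin_def\<close>)
  then show ?thesis using cuts_acc[OF f'(1)] by simp
qed

text \<open>An awaited segment is dropped in the step after its value has become \<open>f\<close>,
  so a triple \<open>(s, f, f)\<close> is present exactly at events. Segments with equal triples
  share one entry, which keeps the state space finite.\<close>

lemma mc_run: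
  "drun (mc_step S) (None, {}) g n = (if n = 0 then None else Some (seg g 0 n),
     {(s, f, y). f \<in> S \<and> (\<exists>m. 0 < m \<and> m < n \<and> seg g 0 m = s \<and> seg g m n = y \<and> (\<forall>k. m < k \<longrightarrow> k < n \<longrightarrow> seg g m k \<noteq> f))})"
proof (induction n)
  case (Suc n)
  let ?Y = "\<lambda>n. {(s, f, y). f \<in> S \<and> (\<exists>m. 0 < m \<and> m < n \<and> seg g 0 m = s \<and> seg g m n = y \<and> (\<forall>k. m < k \<longrightarrow> k < n \<longrightarrow> seg g m k \<noteq> f))}"
  have "{(s, f, mul y (g n)) |s f y. (s, f, y) \<in> ?Y n \<and> y \<noteq> f} \<union> {(s, f, g n) |s f. n \<noteq> 0 \<and> s = seg g 0 n \<and> f \<in> S} = ?Y (Suc n)"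
    (is "?L \<union> ?M = _")
  proof (rule set_eqI)
    fix t :: "'q elt \<times> 'q elt \<times> 'q elt"
    obtain s f z where t: "t = (s, f, z)" by (cases t)
    have "(s, f, z) \<in> ?L \<longleftrightarrow> (\<exists>m. f \<in> S \<and> 0 < m \<and> m < n \<and> seg g 0 m = s \<and> mul (seg g m n) (g n) = z
        \<and> (\<forall>k. m < k \<longrightarrow> k < n \<longrightarrow> seg g m k \<noteq> f) \<and> seg g m n \<noteq> f)" by auto
    also have "\<dots> \<longleftrightarrow> (\<exists>m. f \<in> S \<and> 0 < m \<and> m < n \<and> seg g 0 m = s \<and> seg g m (Suc n) = z
        \<and> (\<forall>k. m < k \<longrightarrow> k < Suc n \<longrightarrow> seg g m k \<noteq> f))"
      by (intro ex_cong1) (auto simp: less_Suc_eq)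
    finally have L: "(s, f, z) \<in> ?L \<longleftrightarrow> \<dots>" .
    have M: "(s, f, z) \<in> ?M \<longleftrightarrow> (\<exists>m. f \<in> S \<and> 0 < m \<and> m = n \<and> seg g 0 m = s \<and> seg g m (Suc n) = z
        \<and> (\<forall>k. m < k \<longrightarrow> k < Suc n \<longrightarrow> seg g m k \<noteq> f))" by auto
    have "(s, f, z) \<in> ?Y (Suc n) \<longleftrightarrow> (\<exists>m. f \<in> S \<and> 0 < m \<and> m < Suc n \<and> seg g 0 m = s \<and> seg g m (Suc n) = z
        \<and> (\<forall>k. m < k \<longrightarrow> k < Suc n \<longrightarrow> seg g m k \<noteq> f))" by auto
    then show "t \<in> ?L \<union> ?M \<longleftrightarrow> t \<in> ?Y (Suc n)" unfolding t Un_iff L M less_Suc_eq by blast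
  qed
  moreover have "{(s, f, g n) |s f. (if n = 0 then None else Some (seg g 0 n)) = Some s \<and> f \<in> S}
      = {(s, f, g n) |s f. n \<noteq> 0 \<and> s = seg g 0 n \<and> f \<in> S}" by auto
  moreover have "(case if n = 0 then None else Some (seg g 0 n) of None \<Rightarrow> g n | Some x \<Rightarrow> mul x (g n)) = seg g 0 (Suc n)"
    by simp
  moreover have "drun (mc_step S) (None, {}) g (Suc n) = mc_step S (if n = 0 then None else Some (seg g 0 n), ?Y n) (g n)"
    by (simp only: drun.simps Suc)
  ultimately have "drun (mc_step S) (None, {}) g (Suc n) = (Some (seg g 0 (Suc n)), ?Y (Suc n))"
    by (simp only: mc_step_def[of S "(_, _)"] fst_conv snd_conv)
  then show ?case by (simp only: nat.distinct if_False)
qed simp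

lemma mc_event: "(s, f, f) \<in> snd (drun (mc_step S) (None, {}) g n) \<longleftrightarrow> f \<in> S \<and> ev g s f n"
  unfolding mc_run ev_def by auto

lemma mc_set_finite: "finite {mc_val q S s f |s f. (s, f) \<in> S \<times> S \<and> lin s f \<and> (s, f, f) \<in> snd st}"
proof -
  have "{mc_val q S s f |s f. (s, f) \<in> S \<times> S \<and> lin s f \<and> (s, f, f) \<in> snd st}
      \<subseteq> (\<lambda>(s, f). mc_val q S s f) ` (S \<times> S)" by auto
  then show ?thesis using fin by (rule_tac finite_subset) auto
qed

text \<open>By pigeonhole some linked pair that recurs infinitely often has the limit priority
  \<open>P\<close> as its value. No recurring linked pair has a larger value, so its right ideal is
  of least size among those recurring after the same \<open>s\<close>, and \<open>ev_inf_acc\<close>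
  decides acceptance by the parity of \<open>P\<close>.\<close>

lemma mc_correct:
  "acc_seq q g \<longleftrightarrow> parity_ok (\<lambda>i. mc_pr q S (drun (mc_step S) (None, {}) g i))"
proof -
  let ?x = "\<lambda>i. mc_pr q S (drun (mc_step S) (None, {}) g i)"
  have cl': "card (mul f ` S) \<le> card S" for f by (rule card_image_le[OF fin])
  have "?x i \<le> 2 * card S + 1" for i
  proof -
    have "mc_val q S s f \<le> 2 * card S + 1" for s f
      unfolding mc_val_def by (cases "acc_lin q s f") simp_all
    then show ?thesis unfolding mc_pr_def using mc_set_finite by (subst Max_le_iff) auto
  qed
  then obtain P where P: "lsup ?x P" using lsup_ex[of ?x] by blast
  have par: "parity_ok ?x \<longleftrightarrow> even P" using P lsup_unique[of ?x P] unfolding parity_ok_def by blast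
  have le: "mc_val q S s f \<le> ?x n" if "s \<in> S" "f \<in> S" "lin s f" "ev g s f n" for s f n
  proof -
    have "mc_val q S s f \<in> {mc_val q S s f |s f. (s, f) \<in> S \<times> S \<and> lin s f \<and> (s, f, f) \<in> snd (drun (mc_step S) (None, {}) g n)}"
      using that mc_event by blast
    then show ?thesis unfolding mc_pr_def using mc_set_finite by (intro Max_ge) blast+
  qed
  have leP: "mc_val q S s f \<le> P" if a: "s \<in> S" "f \<in> S" "lin s f" "ev_inf g s f" for s f
  proof -
    obtain m where m: "\<And>i. i \<ge> m \<Longrightarrow> ?x i \<le> P" using P unfolding lsup_def by blast
    obtain n where "n \<ge> m" "ev g s f n" using a(4) unfolding ev_inf_def by blast
    then show ?thesis using m[of n] le[OF a(1-3)] by (meson le_trans)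
  qed
  have "\<exists>s f. s \<in> S \<and> f \<in> S \<and> lin s f \<and> ev_inf g s f \<and> mc_val q S s f = P"
  proof (cases "P = 0")
    case True
    \<comment> \<open>Here \<open>P\<close> may come from the 0 inserted in \<open>mc_pr\<close>
      rather than from a pair. But every word has some Ramsey factorisation, and the value of its
      recurring pair is at most \<open>P\<close>.\<close>
    obtain s f c where c: "cuts g s f c" using cuts_exist by blast
    have "s = seg g 0 (c 0)" "0 < c 0" "f = seg g (c 0) (c 1)" "c 0 < c 1"
      using c unfolding cuts_def by (auto simp: strict_mono_less)
    then have "s \<in> S" "f \<in> S" using seg_in by auto
    then show ?thesis using leP[of s f] cuts_lin[OF c] cuts_ev_inf[OF c] True by auto
  next
    case False
    let ?I = "{n. ?x n = P}"
    have "infinite ?I" using P unfolding lsup_def infinite_nat_iff_unbounded_le by blast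
    have att: "\<exists>sf. sf \<in> S \<times> S \<and> lin (fst sf) (snd sf) \<and> ev g (fst sf) (snd sf) n \<and> mc_val q S (fst sf) (snd sf) = P"
      if "?x n = P" for n
    proof -
      have "P \<in> insert 0 {mc_val q S s f |s f. (s, f) \<in> S \<times> S \<and> lin s f \<and> (s, f, f) \<in> snd (drun (mc_step S) (None, {}) g n)}"
        using that mc_set_finite Max_in[OF finite.insertI[OF mc_set_finite[of q "drun (mc_step S) (None, {}) g n"]] insert_not_empty, of 0]
        unfolding mc_pr_def by simp
      then show ?thesis using False unfolding mc_event by auto
    qed
    define h where "h n = (SOME sf. sf \<in> S \<times> S \<and> lin (fst sf) (snd sf) \<and> ev g (fst sf) (snd sf) n
       \<and> mc_val q S (fst sf) (snd sf) = P)" for n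
    have h: "h n \<in> S \<times> S \<and> lin (fst (h n)) (snd (h n)) \<and> ev g (fst (h n)) (snd (h n)) n
       \<and> mc_val q S (fst (h n)) (snd (h n)) = P" if "n \<in> ?I" for n
      using someI_ex[OF att, of n] that unfolding h_def by simp
    have "h ` ?I \<subseteq> S \<times> S" using h by blast
    then have "finite (h ` ?I)" using finite_subset fin by blast
    from pigeonhole_infinite[OF \<open>infinite ?I\<close> this]
    obtain n0 where n0: "n0 \<in> ?I" "infinite {n\<in>?I. h n = h n0}" by (rule bexE)
    have "ev_inf g (fst (h n0)) (snd (h n0))" unfolding ev_inf_def
    proof
      fix m obtain n where "n \<ge> m" "n \<in> {n\<in>?I. h n = h n0}"
        using n0(2) unfolding infinite_nat_iff_unbounded_le by blast
      then show "\<exists>n\<ge>m. ev g (fst (h n0)) (snd (h n0)) n" using h[of n] by auto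
    qed
    then show ?thesis using h[OF n0(1)] by (metis mem_Times_iff)
  qed
  then obtain s f where sf: "s \<in> S" "f \<in> S" "lin s f" "ev_inf g s f" "mc_val q S s f = P" by blast
  have "acc_seq q g \<longleftrightarrow> acc_lin q s f"
  proof (rule ev_inf_acc[OF sf(4,3,2)])
    fix f' assume f': "f' \<in> S" "lin s f'" "ev_inf g s f'"
    have "mc_val q S s f' \<le> mc_val q S s f" using leP[OF sf(1) f'] sf(5) by simp
    then show "card (mul f ` S) \<le> card (mul f' ` S)"
      using cl'[of f] cl'[of f'] unfolding mc_val_def by (auto split: if_splits)
  qed
  also have "\<dots> \<longleftrightarrow> even P" unfolding sf(5)[symmetric] mc_val_def by simp
  finally show ?thesis using par by simp
qed

end

text \<open>McNaughton's theorem in the form needed for logic: guessing the second track makes the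
  automaton nondeterministic, and \<open>mc_step\<close> running on the profiles of single letters
  is deterministic again.\<close>

theorem drec_proj:
  assumes "drec (A \<times> B) L"
  shows "drec A (\<lambda>w. \<exists>\<beta>. (\<forall>i. \<beta> i \<in> B) \<and> L (\<lambda>i. (w i, \<beta> i)))"
proof -
  obtain Q :: "nat set" and q0 \<delta> pr M where Q: "finite Q" "q0 \<in> Q" "\<And>q a. q \<in> Q \<Longrightarrow> a \<in> A \<times> B \<Longrightarrow> \<delta> q a \<in> Q"
    "\<And>w. (\<And>i. w i \<in> A \<times> B) \<Longrightarrow> L w = parity_ok (\<lambda>i. pr (drun \<delta> q0 w i))" "\<And>q. pr q \<le> (M::nat)"
    using drecE[OF assms] by metis
  define S where "S = Pow (Q \<times> {..M} \<times> Q)"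
  \<comment> \<open>The profile of a letter: all transitions over the possible guesses, each with
    the priority of its source state.\<close>
  define h where "h a = {(q, pr q, \<delta> q (a, b)) |q b. q \<in> Q \<and> b \<in> B}" for a
  have fin: "finite S" unfolding S_def using Q(1) by simp
  have cl: "\<forall>x\<in>S. \<forall>y\<in>S. mul x y \<in> S"
    unfolding S_def mul_def by fastforce
  have hS: "h a \<in> S" if "a \<in> A" for a using that Q(3,5) unfolding S_def h_def by auto
  have acc: "(\<exists>\<beta>. (\<forall>i. \<beta> i \<in> B) \<and> L (\<lambda>i. (w i, \<beta> i))) \<longleftrightarrow> acc_seq q0 (\<lambda>i. h (w i))"
    if w: "\<And>i. w i \<in> A" for w
  proof
    assume "\<exists>\<beta>. (\<forall>i. \<beta> i \<in> B) \<and> L (\<lambda>i. (w i, \<beta> i))"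
    then obtain \<beta> where \<beta>: "\<And>i. \<beta> i \<in> B" "L (\<lambda>i. (w i, \<beta> i))" by blast
    let ?r = "drun \<delta> q0 (\<lambda>i. (w i, \<beta> i))"
    have "?r i \<in> Q" for i by (rule drun_in[where A = "A \<times> B", OF Q(2,3)]) (simp_all add: w \<beta>)
    then have "(?r i, pr (?r i), ?r (Suc i)) \<in> h (w i)" for i unfolding h_def using \<beta>(1) by auto
    moreover have "parity_ok (\<lambda>i. pr (?r i))" using Q(4) w \<beta> by simp
    ultimately show "acc_seq q0 (\<lambda>i. h (w i))" unfolding acc_seq_def
      by (intro exI[of _ ?r] exI[of _ "\<lambda>i. pr (?r i)"]) auto
  next
    assume "acc_seq q0 (\<lambda>i. h (w i))"
    then obtain qs ps where qs: "qs 0 = q0" "\<And>i. (qs i, ps i, qs (Suc i)) \<in> h (w i)" "parity_ok ps"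
      unfolding acc_seq_def by blast
    have "\<forall>i. \<exists>b. b \<in> B \<and> qs (Suc i) = \<delta> (qs i) (w i, b) \<and> ps i = pr (qs i)"
      using qs(2) unfolding h_def by blast
    then obtain \<beta> where \<beta>: "\<And>i. \<beta> i \<in> B" "\<And>i. qs (Suc i) = \<delta> (qs i) (w i, \<beta> i)" "\<And>i. ps i = pr (qs i)"
      by metis
    have "drun \<delta> q0 (\<lambda>i. (w i, \<beta> i)) i = qs i" for i by (induction i) (simp_all add: qs(1) \<beta>(2))
    moreover have "ps = (\<lambda>i. pr (qs i))" using \<beta>(3) by (rule ext)
    ultimately have "L (\<lambda>i. (w i, \<beta> i))" using Q(4)[of "\<lambda>i. (w i, \<beta> i)"] w \<beta>(1) qs(3) by simp
    then show "\<exists>\<beta>. (\<forall>i. \<beta> i \<in> B) \<and> L (\<lambda>i. (w i, \<beta> i))" using \<beta>(1) by blast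
  qed
  show ?thesis
  proof (rule drecI[where \<delta> = "\<lambda>st a. mc_step S st (h a)" and pr = "mc_pr q0 S"])
    show "finite (insert None (Some ` S) \<times> Pow (S \<times> S \<times> S))" using fin by simp
    show "(None, {}) \<in> insert None (Some ` S) \<times> Pow (S \<times> S \<times> S)" by simp
    show "mc_step S st (h a) \<in> insert None (Some ` S) \<times> Pow (S \<times> S \<times> S)"
      if "st \<in> insert None (Some ` S) \<times> Pow (S \<times> S \<times> S)" "a \<in> A" for st a
      using that cl hS[OF that(2)] unfolding mc_step_def by (auto split: option.splits)
    show "(\<exists>\<beta>. (\<forall>i. \<beta> i \<in> B) \<and> L (\<lambda>i. (w i, \<beta> i)))
        = parity_ok (\<lambda>i. mc_pr q0 S (drun (\<lambda>st a. mc_step S st (h a)) (None, {}) w i))"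
      if w: "\<And>i. w i \<in> A" for w
      unfolding acc[OF w] drun_map by (rule mc_correct[OF fin cl]) (simp add: hS w)
  qed
qed

section \<open>Recognisable sets of full N-ary trees\<close>

text \<open>A fresh initial state reads the first letter and then the chosen automaton takes over;
  only the priority at time 0 differs, which does not affect acceptance.\<close>

lemma drec_if_first:
  assumes "drec B L1" "drec B L2"
  shows "drec B (\<lambda>w. if c (w 0) then L1 w else L2 w)"
proof -
  obtain Q1 :: "nat set" and p1 \<delta>1 pr1 M1 where 1: "finite Q1" "p1 \<in> Q1" "\<And>q a. q \<in> Q1 \<Longrightarrow> a \<in> B \<Longrightarrow> \<delta>1 q a \<in> Q1"
    "\<And>w. (\<And>i. w i \<in> B) \<Longrightarrow> L1 w = parity_ok (\<lambda>i. pr1 (drun \<delta>1 p1 w i))" "\<And>q. pr1 q \<le> (M1::nat)"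
    using drecE[OF assms(1)] by metis
  obtain Q2 :: "nat set" and p2 \<delta>2 pr2 M2 where 2: "finite Q2" "p2 \<in> Q2" "\<And>q a. q \<in> Q2 \<Longrightarrow> a \<in> B \<Longrightarrow> \<delta>2 q a \<in> Q2"
    "\<And>w. (\<And>i. w i \<in> B) \<Longrightarrow> L2 w = parity_ok (\<lambda>i. pr2 (drun \<delta>2 p2 w i))" "\<And>q. pr2 q \<le> (M2::nat)"
    using drecE[OF assms(2)] by metis
  define \<delta> where "\<delta> s a = (case s of None \<Rightarrow> Some (if c a then Inl (\<delta>1 p1 a) else Inr (\<delta>2 p2 a))
     | Some (Inl q) \<Rightarrow> Some (Inl (\<delta>1 q a)) | Some (Inr q) \<Rightarrow> Some (Inr (\<delta>2 q a)))" for s a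
  define pr where "pr s = (case s of None \<Rightarrow> 0 | Some (Inl q) \<Rightarrow> pr1 q | Some (Inr q) \<Rightarrow> pr2 q)" for s
  have run1: "drun \<delta> None w (Suc i) = Some (Inl (drun \<delta>1 p1 w (Suc i)))" if "c (w 0)" for w i
    by (induction i) (simp_all add: \<delta>_def that)
  have run2: "drun \<delta> None w (Suc i) = Some (Inr (drun \<delta>2 p2 w (Suc i)))" if "\<not> c (w 0)" for w i
    by (induction i) (simp_all add: \<delta>_def that)
  show ?thesis
  proof (rule drecI[where \<delta> = \<delta> and pr = pr and Q = "insert None (Some ` (Inl ` Q1 \<union> Inr ` Q2))" and ?q0.0 = None])
    show "finite (insert None (Some ` (Inl ` Q1 \<union> Inr ` Q2)))" using 1(1) 2(1) by simp
    show "\<delta> q a \<in> insert None (Some ` (Inl ` Q1 \<union> Inr ` Q2))"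
      if "q \<in> insert None (Some ` (Inl ` Q1 \<union> Inr ` Q2))" "a \<in> B" for q a
      using that 1(2,3) 2(2,3) unfolding \<delta>_def by auto
    fix w :: "nat \<Rightarrow> 'a" assume w: "\<And>i. w i \<in> B"
    show "(if c (w 0) then L1 w else L2 w) = parity_ok (\<lambda>i. pr (drun \<delta> None w i))"
    proof (cases "c (w 0)")
      case True
      have "parity_ok (\<lambda>i. pr (drun \<delta> None w i)) = parity_ok (\<lambda>i. pr (drun \<delta> None w (Suc i)))"
        using parity_ok_shift[of "\<lambda>i. pr (drun \<delta> None w i)" 1] by simp
      also have "\<dots> = parity_ok (\<lambda>i. pr1 (drun \<delta>1 p1 w (Suc i)))" unfolding run1[of w, OF True] by (simp add: pr_def)
      also have "\<dots> = parity_ok (\<lambda>i. pr1 (drun \<delta>1 p1 w i))"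
        using parity_ok_shift[of "\<lambda>i. pr1 (drun \<delta>1 p1 w i)" 1] by simp
      finally show ?thesis using True 1(4)[OF w] by simp
    next
      case False
      have "parity_ok (\<lambda>i. pr (drun \<delta> None w i)) = parity_ok (\<lambda>i. pr (drun \<delta> None w (Suc i)))"
        using parity_ok_shift[of "\<lambda>i. pr (drun \<delta> None w i)" 1] by simp
      also have "\<dots> = parity_ok (\<lambda>i. pr2 (drun \<delta>2 p2 w (Suc i)))" unfolding run2[of w, OF False] by (simp add: pr_def)
      also have "\<dots> = parity_ok (\<lambda>i. pr2 (drun \<delta>2 p2 w i))"
        using parity_ok_shift[of "\<lambda>i. pr2 (drun \<delta>2 p2 w i)" 1] by simp
      finally show ?thesis using False 2(4)[OF w] by simp
    qed
  qed simp
qed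

lemma parity_ok_const0: "parity_ok (\<lambda>i. 0)" 
  unfolding parity_ok_def lsup_def by (intro exI[of _ 0]) auto

lemma parity_ok_stuck:
  assumes "\<And>i. i \<ge> m \<Longrightarrow> x i = 1"
  shows "\<not> parity_ok x"
proof
  assume "parity_ok x"
  then obtain k where k: "even k" "\<forall>m. \<exists>i\<ge>m. x i = k" unfolding parity_ok_def lsup_def by blast
  then obtain i where "i \<ge> m" "x i = k" by blast
  then have "k = 1" using assms by simp
  then show False using k(1) by simp
qed

text \<open>The automaton remembers the previous letter and falls into a sink of priority 1 at the
  first violation.\<close>

lemma drec_safe:
  assumes "finite B"
  shows "drec B (\<lambda>w. C0 (w 0) \<and> (\<forall>i. C (w i) (w (Suc i))))"
proof -
  define \<delta> where "\<delta> s a = (case s of None \<Rightarrow> Some (if C0 a then Some a else None)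
     | Some None \<Rightarrow> Some None | Some (Some b) \<Rightarrow> Some (if C b a then Some a else None))" for s a
  define pr :: "'a option option \<Rightarrow> nat" where "pr s = (if s = Some None then 1 else 0)" for s
  show ?thesis
  proof (rule drecI[where \<delta> = \<delta> and pr = pr and Q = "insert None (insert (Some None) (Some ` Some ` B))" and ?q0.0 = None])
    show "\<delta> q a \<in> insert None (insert (Some None) (Some ` Some ` B))"
      if "q \<in> insert None (insert (Some None) (Some ` Some ` B))" "a \<in> B" for q a
      using that unfolding \<delta>_def by auto
    fix w :: "nat \<Rightarrow> 'a"
    show "(C0 (w 0) \<and> (\<forall>i. C (w i) (w (Suc i)))) = parity_ok (\<lambda>i. pr (drun \<delta> None w i))"
    proof (cases "C0 (w 0) \<and> (\<forall>i. C (w i) (w (Suc i)))")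
      case True
      have "drun \<delta> None w (Suc i) = Some (Some (w i))" for i
        by (induction i) (use True in \<open>simp_all add: \<delta>_def\<close>)
      then have "pr (drun \<delta> None w i) = 0" for i by (cases i) (simp_all add: pr_def)
      then show ?thesis using True parity_ok_const0 by simp
    next
      case False
      have "\<exists>m. drun \<delta> None w m = Some None"
      proof (rule ccontr)
        assume neg: "\<not> ?thesis"
        have *: "drun \<delta> None w (Suc i) = Some (Some (w i))" for i
        proof (induction i)
          case 0
          have "drun \<delta> None w (Suc 0) = Some (if C0 (w 0) then Some (w 0) else None)" by (simp add: \<delta>_def)
          then show ?case using neg by (metis)
        next
          case (Suc i)
          have "drun \<delta> None w (Suc (Suc i)) = \<delta> (drun \<delta> None w (Suc i)) (w (Suc i))" by (rule drun.simps)
          also have "\<dots> = Some (if C (w i) (w (Suc i)) then Some (w (Suc i)) else None)" unfolding Suc by (simp add: \<delta>_def)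
          finally show ?case using neg by metis
        qed
        have "C0 (w 0)" using *[of 0] by (simp add: \<delta>_def split: if_splits)
        moreover have "C (w i) (w (Suc i))" for i
        proof -
          have "drun \<delta> None w (Suc (Suc i)) = \<delta> (Some (Some (w i))) (w (Suc i))" using *[of i] by simp
          then show ?thesis using *[of "Suc i"] by (simp add: \<delta>_def split: if_splits)
        qed
        ultimately show False using False by blast
      qed
      then obtain m where m: "drun \<delta> None w m = Some None" by blast
      have dead: "\<delta> (Some None) a = Some None" for a by (simp add: \<delta>_def)
      have "drun \<delta> None w i = Some None" if "i \<ge> m" for i
        using that by (induction i rule: dec_induct) (simp_all add: m dead)
      then have "\<not> parity_ok (\<lambda>i. pr (drun \<delta> None w i))" by (intro parity_ok_stuck[of m]) (simp add: pr_def)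
      then show ?thesis using False by simp
    qed
  qed (use assms in simp_all)
qed

definition pre :: "(nat \<Rightarrow> nat) \<Rightarrow> nat \<Rightarrow> nat list" where
  "pre \<pi> i = map \<pi> [0..<i]"

lemma pre_0 [simp]: "pre \<pi> 0 = []" by (simp add: pre_def)
lemma pre_Suc: "pre \<pi> (Suc i) = pre \<pi> i @ [\<pi> i]" by (simp add: pre_def)
lemma length_pre [simp]: "length (pre \<pi> i) = i" by (simp add: pre_def)

lemma pre_through: "pre (\<lambda>i. if i < length v then v ! i else f i) (length v) = v"
  by (rule nth_equalityI) (simp_all add: pre_def)

text \<open>A nondeterministic parity automaton on full \<open>N\<close>-ary trees over \<open>A\<close>, in the form of a choice labelling
  \<open>\<rho>\<close> such that a deterministic word automaton accepts every branch. It reads the direction taken as well, so it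
  can treat \<open>\<rho> v\<close> as the transition taken at \<open>v\<close>.\<close>

definition tword :: "(nat list \<Rightarrow> 'l) \<Rightarrow> (nat list \<Rightarrow> 'r) \<Rightarrow> (nat \<Rightarrow> nat) \<Rightarrow> nat \<Rightarrow> 'l \<times> 'r \<times> nat" where
  "tword \<tau> \<rho> \<pi> i = (\<tau> (pre \<pi> i), \<rho> (pre \<pi> i), \<pi> i)"

definition tacc :: "nat \<Rightarrow> 'r set \<Rightarrow> ((nat \<Rightarrow> 'l \<times> 'r \<times> nat) \<Rightarrow> bool) \<Rightarrow> (nat list \<Rightarrow> 'l) \<Rightarrow> bool" where
  "tacc N R L \<tau> \<longleftrightarrow> (\<exists>\<rho>. (\<forall>v. \<rho> v \<in> R) \<and> (\<forall>\<pi>. (\<forall>i. \<pi> i < N) \<longrightarrow> L (tword \<tau> \<rho> \<pi>)))"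

definition trec :: "nat \<Rightarrow> 'l set \<Rightarrow> ((nat list \<Rightarrow> 'l) \<Rightarrow> bool) \<Rightarrow> bool" where
  "trec N A P \<longleftrightarrow> (\<exists>(R :: nat set) L. finite R \<and> R \<noteq> {} \<and> drec (A \<times> R \<times> {..<N}) L \<and>
     (\<forall>\<tau>. (\<forall>v. \<tau> v \<in> A) \<longrightarrow> P \<tau> = tacc N R L \<tau>))"

lemma trecE:
  assumes "trec N A P"
  obtains R :: "nat set" and L where "finite R" "R \<noteq> {}" "drec (A \<times> R \<times> {..<N}) L"
    "\<And>\<tau>. (\<And>v. \<tau> v \<in> A) \<Longrightarrow> P \<tau> = tacc N R L \<tau>"
proof -
  from assms[unfolded trec_def] obtain R :: "nat set" and L where
    "finite R \<and> R \<noteq> {} \<and> drec (A \<times> R \<times> {..<N}) L \<and> (\<forall>\<tau>. (\<forall>v. \<tau> v \<in> A) \<longrightarrow> P \<tau> = tacc N R L \<tau>)" by blast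
  then show thesis using that[of R L] by simp
qed

lemma trecI:
  fixes R :: "'r set"
  assumes R: "finite R" "R \<noteq> {}" and L: "drec (A \<times> R \<times> {..<N}) L"
    and P: "\<And>\<tau>. (\<And>v. \<tau> v \<in> A) \<Longrightarrow> P \<tau> = tacc N R L \<tau>"
  shows "trec N A P"
proof -
  obtain f :: "'r \<Rightarrow> nat" where f: "inj_on f R"
    using finite_imp_inj_to_nat_seg[OF R(1)] by blast
  define g where "g = the_inv_into R f"
  have gf: "g (f q) = q" if "q \<in> R" for q using the_inv_into_f_f[OF f that] unfolding g_def .
  define L' where "L' w = L (\<lambda>i. (fst (w i), g (fst (snd (w i))), snd (snd (w i))))" for w
  have tw: "L' (tword \<tau> \<rho> \<pi>) = L (tword \<tau> (\<lambda>v. g (\<rho> v)) \<pi>)" for \<tau> \<rho> \<pi>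
    unfolding L'_def tword_def by simp
  have "drec (A \<times> f ` R \<times> {..<N}) L'" unfolding L'_def
    by (rule drec_map[OF L]) (auto simp: gf)
  moreover have "tacc N R L \<tau> = tacc N (f ` R) L' \<tau>" for \<tau> :: "nat list \<Rightarrow> 'a"
  proof
    assume "tacc N R L \<tau>"
    then obtain \<rho> where \<rho>: "\<And>v. \<rho> v \<in> R" "\<And>\<pi>. (\<And>i. \<pi> i < N) \<Longrightarrow> L (tword \<tau> \<rho> \<pi>)" unfolding tacc_def by blast
    have "L' (tword \<tau> (\<lambda>v. f (\<rho> v)) \<pi>)" if "\<And>i. \<pi> i < N" for \<pi> unfolding tw using \<rho>(2)[OF that] by (simp add: gf \<rho>(1))
    then show "tacc N (f ` R) L' \<tau>" unfolding tacc_def using \<rho>(1) by (intro exI[of _ "\<lambda>v. f (\<rho> v)"]) simp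
  next
    assume "tacc N (f ` R) L' \<tau>"
    then obtain \<rho> where \<rho>: "\<And>v. \<rho> v \<in> f ` R" "\<And>\<pi>. (\<And>i. \<pi> i < N) \<Longrightarrow> L' (tword \<tau> \<rho> \<pi>)" unfolding tacc_def by blast
    have "g (\<rho> v) \<in> R" for v using \<rho>(1)[of v] gf by auto
    then show "tacc N R L \<tau>" unfolding tacc_def using \<rho>(2) tw by (intro exI[of _ "\<lambda>v. g (\<rho> v)"]) simp
  qed
  ultimately show ?thesis unfolding trec_def using R P
    by (intro exI[of _ "f ` R"] exI[of _ L']) simp
qed

lemma trec_cong:
  assumes "trec N A P" "\<And>\<tau>. (\<And>v. \<tau> v \<in> A) \<Longrightarrow> P \<tau> = P' \<tau>"
  shows "trec N A P'"
  using assms(1)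
proof (rule trecE)
  fix R :: "nat set" and L
  assume "finite R" "R \<noteq> {}" "drec (A \<times> R \<times> {..<N}) L"
    and P: "\<And>\<tau>. (\<And>v. \<tau> v \<in> A) \<Longrightarrow> P \<tau> = tacc N R L \<tau>"
  then show ?thesis using assms(2) by (intro trecI) auto
qed

lemma trec_map:
  fixes f :: "'a \<Rightarrow> 'b"
  assumes "trec N B P" "\<And>a. a \<in> A \<Longrightarrow> f a \<in> B"
  shows "trec N A (\<lambda>\<tau>. P (\<lambda>v. f (\<tau> v)))"
  using assms(1)
proof (rule trecE)
  fix R :: "nat set" and L
  assume R: "finite R" "R \<noteq> {}" and L: "drec (B \<times> R \<times> {..<N}) L"
    and P: "\<And>\<tau>. (\<And>v. \<tau> v \<in> B) \<Longrightarrow> P \<tau> = tacc N R L \<tau>"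
  show ?thesis
  proof (rule trecI[OF R])
    show "drec (A \<times> R \<times> {..<N}) (\<lambda>w. L (\<lambda>i. (f (fst (w i)), snd (w i))))"
      by (rule drec_map[OF L]) (auto simp: assms(2))
    fix \<tau> :: "nat list \<Rightarrow> 'a" assume "\<And>v. \<tau> v \<in> A"
    then have "P (\<lambda>v. f (\<tau> v)) = tacc N R L (\<lambda>v. f (\<tau> v))" using P assms(2) by simp
    then show "P (\<lambda>v. f (\<tau> v)) = tacc N R (\<lambda>w. L (\<lambda>i. (f (fst (w i)), snd (w i)))) \<tau>"
      unfolding tacc_def by (simp add: tword_def[abs_def])
  qed
qed

text \<open>The labelling \<open>\<sigma>\<close> becomes part of the choice labelling, so
  projection costs nothing for nondeterministic tree automata.\<close>

lemma trec_proj: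
  fixes B :: "'b set"
  assumes "trec N (A \<times> B) P" "finite B" "B \<noteq> {}"
  shows "trec N A (\<lambda>\<tau>. \<exists>\<sigma>. (\<forall>v. \<sigma> v \<in> B) \<and> P (\<lambda>v. (\<tau> v, \<sigma> v)))"
  using assms(1)
proof (rule trecE)
  fix R :: "nat set" and L
  assume R: "finite R" "R \<noteq> {}" and L: "drec ((A \<times> B) \<times> R \<times> {..<N}) L"
    and P: "\<And>\<tau>. (\<And>v. \<tau> v \<in> A \<times> B) \<Longrightarrow> P \<tau> = tacc N R L \<tau>"
  define L' where "L' w = L (\<lambda>i. ((fst (w i), fst (fst (snd (w i)))), snd (fst (snd (w i))), snd (snd (w i))))" for w
  have tw: "L' (tword \<tau> (\<lambda>v. (\<sigma> v, \<rho> v)) \<pi>) = L (tword (\<lambda>v. (\<tau> v, \<sigma> v)) \<rho> \<pi>)" for \<tau> \<sigma> \<rho> \<pi>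
    unfolding L'_def tword_def by simp
  show ?thesis
  proof (rule trecI)
    show "finite (B \<times> R)" "B \<times> R \<noteq> {}" using R assms by simp_all
    show "drec (A \<times> (B \<times> R) \<times> {..<N}) L'" unfolding L'_def
      by (rule drec_map[OF L]) auto
    fix \<tau> :: "nat list \<Rightarrow> 'a" assume \<tau>: "\<And>v. \<tau> v \<in> A"
    show "(\<exists>\<sigma>. (\<forall>v. \<sigma> v \<in> B) \<and> P (\<lambda>v. (\<tau> v, \<sigma> v))) = tacc N (B \<times> R) L' \<tau>"
    proof
      assume "\<exists>\<sigma>. (\<forall>v. \<sigma> v \<in> B) \<and> P (\<lambda>v. (\<tau> v, \<sigma> v))"
      then obtain \<sigma> where \<sigma>: "\<And>v. \<sigma> v \<in> B" "P (\<lambda>v. (\<tau> v, \<sigma> v))" by blast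
      then have "tacc N R L (\<lambda>v. (\<tau> v, \<sigma> v))" using P[of "\<lambda>v. (\<tau> v, \<sigma> v)"] \<tau> by simp
      then obtain \<rho> where \<rho>: "\<And>v. \<rho> v \<in> R" "\<And>\<pi>. (\<And>i. \<pi> i < N) \<Longrightarrow> L (tword (\<lambda>v. (\<tau> v, \<sigma> v)) \<rho> \<pi>)" unfolding tacc_def by blast
      then show "tacc N (B \<times> R) L' \<tau>" unfolding tacc_def using \<sigma>(1) tw
        by (intro exI[of _ "\<lambda>v. (\<sigma> v, \<rho> v)"]) simp
    next
      assume "tacc N (B \<times> R) L' \<tau>"
      then obtain \<rho> where \<rho>: "\<And>v. \<rho> v \<in> B \<times> R" "\<And>\<pi>. (\<And>i. \<pi> i < N) \<Longrightarrow> L' (tword \<tau> \<rho> \<pi>)" unfolding tacc_def by blast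
      have mem: "fst (\<rho> v) \<in> B" "snd (\<rho> v) \<in> R" for v using \<rho>(1)[of v] by auto
      have "tacc N R L (\<lambda>v. (\<tau> v, fst (\<rho> v)))" unfolding tacc_def
        using \<rho>(2) mem tw[of \<tau> "\<lambda>v. fst (\<rho> v)" "\<lambda>v. snd (\<rho> v)"] by (intro exI[of _ "\<lambda>v. snd (\<rho> v)"]) simp
      then have "P (\<lambda>v. (\<tau> v, fst (\<rho> v)))" using P[of "\<lambda>v. (\<tau> v, fst (\<rho> v))"] \<tau> mem by simp
      then show "\<exists>\<sigma>. (\<forall>v. \<sigma> v \<in> B) \<and> P (\<lambda>v. (\<tau> v, \<sigma> v))" using mem by (intro exI[of _ "\<lambda>v. fst (\<rho> v)"]) simp
    qed
  qed
qed

text \<open>The choice labelling carries a bit and labellings for both automata. The bit at the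
  root, which belongs to the first letter of the word along every branch, decides which automaton is
  run.\<close>

lemma trec_disj:
  assumes "trec N A P1" "trec N A P2"
  shows "trec N A (\<lambda>\<tau>. P1 \<tau> \<or> P2 \<tau>)"
proof -
  obtain R1 :: "nat set" and L1 where 1: "finite R1" "R1 \<noteq> {}" "drec (A \<times> R1 \<times> {..<N}) L1"
    "\<And>\<tau>. (\<And>v. \<tau> v \<in> A) \<Longrightarrow> P1 \<tau> = tacc N R1 L1 \<tau>" using trecE[OF assms(1)] by metis
  obtain R2 :: "nat set" and L2 where 2: "finite R2" "R2 \<noteq> {}" "drec (A \<times> R2 \<times> {..<N}) L2"
    "\<And>\<tau>. (\<And>v. \<tau> v \<in> A) \<Longrightarrow> P2 \<tau> = tacc N R2 L2 \<tau>" using trecE[OF assms(2)] by metis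
  define L1' where "L1' w = L1 (\<lambda>i. (fst (w i), fst (snd (fst (snd (w i)))), snd (snd (w i))))"
    for w :: "nat \<Rightarrow> 'a \<times> (bool \<times> nat \<times> nat) \<times> nat"
  define L2' where "L2' w = L2 (\<lambda>i. (fst (w i), snd (snd (fst (snd (w i)))), snd (snd (w i))))"
    for w :: "nat \<Rightarrow> 'a \<times> (bool \<times> nat \<times> nat) \<times> nat"
  define L where "L w = (if fst (fst (snd (w 0))) then L1' w else L2' w)" for w
  have tw: "L1' (tword \<tau> \<rho> \<pi>) = L1 (tword \<tau> (\<lambda>v. fst (snd (\<rho> v))) \<pi>)"
     "L2' (tword \<tau> \<rho> \<pi>) = L2 (tword \<tau> (\<lambda>v. snd (snd (\<rho> v))) \<pi>)"
     "L (tword \<tau> \<rho> \<pi>) = (if fst (\<rho> []) then L1' (tword \<tau> \<rho> \<pi>) else L2' (tword \<tau> \<rho> \<pi>))" for \<tau> \<rho> \<pi>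
    unfolding L_def L1'_def L2'_def tword_def by simp_all
  obtain r1 r2 where r: "r1 \<in> R1" "r2 \<in> R2" using 1(2) 2(2) by blast
  let ?R = "UNIV \<times> R1 \<times> R2 :: (bool \<times> nat \<times> nat) set"
  show ?thesis
  proof (rule trecI)
    show "finite ?R" "?R \<noteq> {}" using 1 2 by simp_all
    have "drec (A \<times> ?R \<times> {..<N}) L1'" unfolding L1'_def by (rule drec_map[OF 1(3)]) auto
    moreover have "drec (A \<times> ?R \<times> {..<N}) L2'" unfolding L2'_def by (rule drec_map[OF 2(3)]) auto
    ultimately show "drec (A \<times> ?R \<times> {..<N}) L" unfolding L_def by (rule drec_if_first)
    fix \<tau> :: "nat list \<Rightarrow> 'a" assume \<tau>: "\<And>v. \<tau> v \<in> A"
    have "tacc N ?R L \<tau> \<longleftrightarrow> tacc N R1 L1 \<tau> \<or> tacc N R2 L2 \<tau>"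
    proof (intro iffI; (elim disjE)?)
      assume "tacc N ?R L \<tau>"
      then obtain \<rho> where \<rho>: "\<And>v. \<rho> v \<in> ?R" "\<And>\<pi>. (\<And>i. \<pi> i < N) \<Longrightarrow> L (tword \<tau> \<rho> \<pi>)" unfolding tacc_def by blast
      have mem: "fst (snd (\<rho> v)) \<in> R1" "snd (snd (\<rho> v)) \<in> R2" for v using \<rho>(1)[of v] by auto
      show "tacc N R1 L1 \<tau> \<or> tacc N R2 L2 \<tau>"
      proof (cases "fst (\<rho> [])")
        case True
        then have "tacc N R1 L1 \<tau>" unfolding tacc_def using mem \<rho>(2) tw
          by (intro exI[of _ "\<lambda>v. fst (snd (\<rho> v))"]) simp
        then show ?thesis ..
      next
        case False
        then have "tacc N R2 L2 \<tau>" unfolding tacc_def using mem \<rho>(2) tw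
          by (intro exI[of _ "\<lambda>v. snd (snd (\<rho> v))"]) simp
        then show ?thesis ..
      qed
    next
      assume "tacc N R1 L1 \<tau>"
      then obtain \<rho> where \<rho>: "\<And>v. \<rho> v \<in> R1" "\<And>\<pi>. (\<And>i. \<pi> i < N) \<Longrightarrow> L1 (tword \<tau> \<rho> \<pi>)" unfolding tacc_def by blast
      then show "tacc N ?R L \<tau>" unfolding tacc_def using r tw
        by (intro exI[of _ "\<lambda>v. (True, \<rho> v, r2)"]) simp
    next
      assume "tacc N R2 L2 \<tau>"
      then obtain \<rho> where \<rho>: "\<And>v. \<rho> v \<in> R2" "\<And>\<pi>. (\<And>i. \<pi> i < N) \<Longrightarrow> L2 (tword \<tau> \<rho> \<pi>)" unfolding tacc_def by blast
      then show "tacc N ?R L \<tau>" unfolding tacc_def using r tw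
        by (intro exI[of _ "\<lambda>v. (False, r1, \<rho> v)"]) simp
    qed
    then show "(P1 \<tau> \<or> P2 \<tau>) = tacc N ?R L \<tau>" using 1(4)[OF \<tau>] 2(4)[OF \<tau>] by simp
  qed
qed

text \<open>Every edge lies on an infinite branch, so a condition on edges is a safety condition on
  the words along branches.\<close>

lemma trec_safe:
  assumes A: "finite A" and N: "0 < N"
  shows "trec N A (\<lambda>\<tau>. C0 (\<tau> []) \<and> (\<forall>v\<in>lists {..<N}. \<forall>d<N. C (\<tau> v) d (\<tau> (v @ [d]))))"
proof (rule trecI)
  define L where "L w = (C0 (fst (w 0)) \<and> (\<forall>i. C (fst (w i)) (snd (snd (w i))) (fst (w (Suc i)))))"
    for w :: "nat \<Rightarrow> 'a \<times> nat \<times> nat"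
  show "finite {0::nat}" "{0::nat} \<noteq> {}" by simp_all
  show "drec (A \<times> {0::nat} \<times> {..<N}) L" unfolding L_def
    by (rule drec_safe) (use A in simp)
  fix \<tau> :: "nat list \<Rightarrow> 'a"
  have "(\<forall>v\<in>lists {..<N}. \<forall>d<N. C (\<tau> v) d (\<tau> (v @ [d])))
     \<longleftrightarrow> (\<forall>\<pi>. (\<forall>i. \<pi> i < N) \<longrightarrow> (\<forall>i. C (\<tau> (pre \<pi> i)) (\<pi> i) (\<tau> (pre \<pi> (Suc i)))))" (is "?l = ?r")
  proof
    assume l: ?l
    show ?r
    proof (intro allI impI)
      fix \<pi> :: "nat \<Rightarrow> nat" and i assume "\<forall>i. \<pi> i < N"
      moreover from this have "pre \<pi> i \<in> lists {..<N}" by (auto simp: pre_def)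
      ultimately show "C (\<tau> (pre \<pi> i)) (\<pi> i) (\<tau> (pre \<pi> (Suc i)))" using l unfolding pre_Suc by blast
    qed
  next
    assume r: ?r
    show ?l
    proof (intro ballI allI impI)
      fix v d assume v: "v \<in> lists {..<N}" "d < N"
      define \<pi> where "\<pi> i = (if i < length v then v ! i else d)" for i
      have "\<pi> i < N" for i using v nth_mem[of i v] unfolding \<pi>_def by (auto simp: in_lists_conv_set)
      moreover have "pre \<pi> (length v) = v" unfolding \<pi>_def by (rule pre_through)
      moreover have "\<pi> (length v) = d" by (simp add: \<pi>_def)
      ultimately show "C (\<tau> v) d (\<tau> (v @ [d]))" using r pre_Suc[of \<pi> "length v"] by metis
    qed
  qed
  moreover have "\<exists>\<pi> :: nat \<Rightarrow> nat. \<forall>i. \<pi> i < N" using N by (intro exI[of _ "\<lambda>_. 0"]) simp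
  ultimately have "(C0 (\<tau> []) \<and> (\<forall>v\<in>lists {..<N}. \<forall>d<N. C (\<tau> v) d (\<tau> (v @ [d]))))
     \<longleftrightarrow> (\<forall>\<pi>. (\<forall>i. \<pi> i < N) \<longrightarrow> C0 (\<tau> []) \<and> (\<forall>i. C (\<tau> (pre \<pi> i)) (\<pi> i) (\<tau> (pre \<pi> (Suc i)))))" by blast
  also have "\<dots> \<longleftrightarrow> tacc N {0::nat} L \<tau>" unfolding tacc_def L_def tword_def by auto
  finally show "(C0 (\<tau> []) \<and> (\<forall>v\<in>lists {..<N}. \<forall>d<N. C (\<tau> v) d (\<tau> (v @ [d])))) = tacc N {0::nat} L \<tau>" .
qed

section \<open>Complementation\<close>

text \<open>Addresses are reversed here, so that the recursion runs from a node to the root.\<close>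

primrec tst :: "('q \<Rightarrow> 'l \<times> 'r \<times> nat \<Rightarrow> 'q) \<Rightarrow> 'q \<Rightarrow> (nat list \<Rightarrow> 'l) \<Rightarrow> (nat list \<Rightarrow> 'q \<Rightarrow> 'r) \<Rightarrow> nat list \<Rightarrow> 'q" where
  "tst \<delta> q \<tau> rr [] = q"
| "tst \<delta> q \<tau> rr (d # u) = \<delta> (tst \<delta> q \<tau> rr u) (\<tau> (rev u), rr (rev u) (tst \<delta> q \<tau> rr u), d)"

lemma tst_run:
  "drun \<delta> q (tword \<tau> (\<lambda>v. rr v (tst \<delta> q \<tau> rr (rev v))) \<pi>) i = tst \<delta> q \<tau> rr (rev (pre \<pi> i))"
  by (induction i) (simp_all add: pre_Suc tword_def)

context
  fixes Q :: "'q set" and q0 :: 'q and \<delta> :: "'q \<Rightarrow> 'l \<times> 'r \<times> nat \<Rightarrow> 'q" and pr :: "'q \<Rightarrow> nat" and M N :: nat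
    and R :: "'r set" and A :: "'l set"
  assumes Q: "finite Q" "q0 \<in> Q" "\<forall>q\<in>Q. \<forall>a\<in>A \<times> R \<times> {..<N}. \<delta> q a \<in> Q" and M: "\<forall>q. pr q \<le> M"
    and R: "finite R" "R \<noteq> {}"
begin

section \<open>The acceptance game between automaton and pathfinder\<close>

definition gopt :: "(nat list \<Rightarrow> 'l) \<Rightarrow> nat list \<times> 'q \<Rightarrow> (nat list \<times> 'q) set set" where
  "gopt \<tau> p = (\<lambda>r. (\<lambda>d. (fst p @ [d], \<delta> (snd p) (\<tau> (fst p), r, d))) ` {..<N}) ` R"

text \<open>Moves of the pathfinder are functions \<open>g\<close>, because it answers after the
  transition \<open>r\<close> has been chosen; the automaton then picks \<open>r\<close> among the
  positions that \<open>g\<close> leaves.\<close>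

definition popt :: "(nat list \<Rightarrow> 'l) \<Rightarrow> nat list \<times> 'q \<Rightarrow> (nat list \<times> 'q) set set" where
  "popt \<tau> p = (\<lambda>g. (\<lambda>r. (fst p @ [g r], \<delta> (snd p) (\<tau> (fst p), r, g r))) ` R) ` {g. \<forall>r\<in>R. g r < N}"

text \<open>Exchanging the quantifiers over \<open>r\<close> and \<open>d\<close> is choice on
  \<open>R\<close>; it makes \<open>win_dual\<close> applicable.\<close>

lemma opt_dual: "{p. \<exists>Y\<in>popt \<tau> p. Y \<subseteq> X} = - {p. \<exists>Y\<in>gopt \<tau> p. Y \<subseteq> - X}"
proof (rule set_eqI)
  fix p
  let ?s = "\<lambda>r d. (fst p @ [d], \<delta> (snd p) (\<tau> (fst p), r, d))"
  have "(\<exists>Y\<in>popt \<tau> p. Y \<subseteq> X) \<longleftrightarrow> (\<exists>g. \<forall>r\<in>R. g r < N \<and> ?s r (g r) \<in> X)"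
    unfolding popt_def by fastforce
  also have "\<dots> \<longleftrightarrow> (\<forall>r\<in>R. \<exists>d. d < N \<and> ?s r d \<in> X)" by (rule bchoice_iff[symmetric])
  also have "\<dots> \<longleftrightarrow> \<not> (\<exists>Y\<in>gopt \<tau> p. Y \<subseteq> - X)" unfolding gopt_def by auto
  finally show "p \<in> {p. \<exists>Y\<in>popt \<tau> p. Y \<subseteq> X} \<longleftrightarrow> p \<in> - {p. \<exists>Y\<in>gopt \<tau> p. Y \<subseteq> - X}" by simp
qed

definition gwin :: "(nat list \<Rightarrow> 'l) \<Rightarrow> (nat list \<times> 'q) set" where
  "gwin \<tau> = win True (\<lambda>X. {p. \<exists>Y\<in>gopt \<tau> p. Y \<subseteq> X}) (\<lambda>p. pr (snd p)) (Suc M) {}"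

lemma prM: "pr q < Suc M"
  using M by (simp add: le_imp_less_Suc)

text \<open>An address is reached along only one path, so the state at \<open>v\<close> is a
  function of \<open>v\<close>, and a positional strategy turns into a choice labelling.\<close>

lemma gwin_acc:
  assumes \<tau>: "\<And>v. \<tau> v \<in> A" and w: "([], q0) \<in> gwin \<tau>"
  shows "\<exists>\<rho>. (\<forall>v. \<rho> v \<in> R) \<and> (\<forall>\<pi>. (\<forall>i. \<pi> i < N) \<longrightarrow> parity_ok (\<lambda>i. pr (drun \<delta> q0 (tword \<tau> \<rho> \<pi>) i)))"
proof -
  obtain \<sigma> where \<sigma>: "\<forall>p\<in>gwin \<tau>. pr (snd p) < Suc M \<longrightarrow> \<sigma> p \<in> gopt \<tau> p \<and> \<sigma> p \<subseteq> gwin \<tau>"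
    "\<forall>\<pi>. \<pi> 0 \<in> gwin \<tau> \<longrightarrow> (\<forall>i. pr (snd (\<pi> i)) < Suc M) \<longrightarrow> (\<forall>i. \<pi> (Suc i) \<in> \<sigma> (\<pi> i))
       \<longrightarrow> (\<exists>k. even k = True \<and> lsup (\<lambda>i. pr (snd (\<pi> i))) k)"
    using parity_strategy[of "\<lambda>X. {p. \<exists>Y\<in>gopt \<tau> p. Y \<subseteq> X}" "gopt \<tau>" True "\<lambda>p. pr (snd p)" "Suc M" "{}"]
    unfolding gwin_def by blast
  obtain r0 where r0: "r0 \<in> R" using R(2) by blast
  define rr where "rr v q = (if (v, q) \<in> gwin \<tau> then SOME r. r \<in> R \<and> (\<forall>d<N. (v @ [d], \<delta> q (\<tau> v, r, d)) \<in> \<sigma> (v, q)) else r0)" for v q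
  have rr: "rr v q \<in> R \<and> (\<forall>d<N. (v @ [d], \<delta> q (\<tau> v, rr v q, d)) \<in> \<sigma> (v, q))" if "(v, q) \<in> gwin \<tau>" for v q
  proof -
    have "\<sigma> (v, q) \<in> gopt \<tau> (v, q)" using \<sigma>(1) that prM by auto
    then have "\<exists>r. r \<in> R \<and> (\<forall>d<N. (v @ [d], \<delta> q (\<tau> v, r, d)) \<in> \<sigma> (v, q))" unfolding gopt_def by fastforce
    from someI_ex[OF this] show ?thesis using that unfolding rr_def by simp
  qed
  have rrR: "rr v q \<in> R" for v q using rr r0 unfolding rr_def by (cases "(v, q) \<in> gwin \<tau>") (auto simp: rr_def)
  let ?st = "\<lambda>v. tst \<delta> q0 \<tau> rr (rev v)"
  have "parity_ok (\<lambda>i. pr (?st (pre \<pi> i)))" if \<pi>: "\<And>i. \<pi> i < N" for \<pi>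
  proof -
    let ?p = "\<lambda>i. (pre \<pi> i, ?st (pre \<pi> i))"
    have st: "?p (Suc i) \<in> \<sigma> (?p i)" if "?p i \<in> gwin \<tau>" for i
    proof -
      have "?st (pre \<pi> (Suc i)) = \<delta> (?st (pre \<pi> i)) (\<tau> (pre \<pi> i), rr (pre \<pi> i) (?st (pre \<pi> i)), \<pi> i)"
        by (simp add: pre_Suc)
      then show ?thesis using rr[OF that] \<pi>[of i] by (simp add: pre_Suc)
    qed
    have inW: "?p i \<in> gwin \<tau>" for i
    proof (induction i)
      case (Suc i)
      have "\<sigma> (?p i) \<subseteq> gwin \<tau>" using \<sigma>(1) Suc prM by blast
      then show ?case using st[OF Suc] by blast
    qed (use w in simp)
    have "\<exists>k. even k = True \<and> lsup (\<lambda>i. pr (snd (?p i))) k"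
      using \<sigma>(2)[rule_format, of ?p] inW[of 0] st[OF inW] prM by blast
    then show ?thesis unfolding parity_ok_def by simp
  qed
  then show ?thesis using rrR by (intro exI[of _ "\<lambda>v. rr v (?st v)"]) (simp add: tst_run)
qed

text \<open>Determinacy gives the pathfinder a positional strategy. Being positional, it is at each
  address a function from states and transitions to directions, thus a letter from a finite set that
  another automaton can guess. The conclusion speaks of one branch with a word
  \<open>\<beta>\<close> of transitions on it, so it is a property of words.\<close>

lemma not_gwin_rej:
  assumes \<tau>: "\<And>v. \<tau> v \<in> A" and w: "([], q0) \<notin> gwin \<tau>" and N: "0 < N"
  shows "\<exists>g. (\<forall>v q. \<forall>r\<in>R. g v q r < N) \<and> (\<forall>\<pi> \<beta>. (\<forall>i. \<beta> i \<in> R) \<longrightarrow>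
      (\<forall>i. \<pi> i = g (pre \<pi> i) (drun \<delta> q0 (\<lambda>i. (\<tau> (pre \<pi> i), \<beta> i, \<pi> i)) i) (\<beta> i)) \<longrightarrow>
      \<not> parity_ok (\<lambda>i. pr (drun \<delta> q0 (\<lambda>i. (\<tau> (pre \<pi> i), \<beta> i, \<pi> i)) i)))"
proof -
  define W where "W = win False (\<lambda>X. {p. \<exists>Y\<in>popt \<tau> p. Y \<subseteq> X}) (\<lambda>p. pr (snd p)) (Suc M) UNIV"
  have "win (\<not> True) (\<lambda>X. {p. \<exists>Y\<in>popt \<tau> p. Y \<subseteq> X}) (\<lambda>p. pr (snd p)) (Suc M) (- {}) = - gwin \<tau>"
    unfolding gwin_def by (rule win_dual) (rule opt_dual)
  then have W: "W = - gwin \<tau>" unfolding W_def by (simp only: simp_thms Compl_empty_eq)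
  obtain \<sigma> where \<sigma>: "\<forall>p\<in>W. pr (snd p) < Suc M \<longrightarrow> \<sigma> p \<in> popt \<tau> p \<and> \<sigma> p \<subseteq> W"
    "\<forall>\<pi>. \<pi> 0 \<in> W \<longrightarrow> (\<forall>i. pr (snd (\<pi> i)) < Suc M) \<longrightarrow> (\<forall>i. \<pi> (Suc i) \<in> \<sigma> (\<pi> i))
       \<longrightarrow> (\<exists>k. even k = False \<and> lsup (\<lambda>i. pr (snd (\<pi> i))) k)"
    using parity_strategy[of "\<lambda>X. {p. \<exists>Y\<in>popt \<tau> p. Y \<subseteq> X}" "popt \<tau>" False "\<lambda>p. pr (snd p)" "Suc M" "UNIV"]
    unfolding W_def by blast
  define ok where "ok v q h \<longleftrightarrow> (\<forall>r\<in>R. h r < N \<and> (v @ [h r], \<delta> q (\<tau> v, r, h r)) \<in> \<sigma> (v, q))" for v q h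
  define g where "g v q = (if (v, q) \<in> W then SOME h. ok v q h else (\<lambda>_. 0))" for v q
  have g: "ok v q (g v q)" if "(v, q) \<in> W" for v q
  proof -
    have "\<sigma> (v, q) \<in> popt \<tau> (v, q)" using \<sigma>(1) that prM by auto
    then have "\<exists>h. ok v q h" unfolding popt_def ok_def by fastforce
    from someI_ex[OF this] show ?thesis using that unfolding g_def by simp
  qed
  have gN: "g v q r < N" if "r \<in> R" for v q r
    using g[of v q] that N unfolding ok_def by (cases "(v, q) \<in> W") (auto simp: g_def)
  have "\<not> parity_ok (\<lambda>i. pr (drun \<delta> q0 (\<lambda>i. (\<tau> (pre \<pi> i), \<beta> i, \<pi> i)) i))"
    if \<beta>: "\<And>i. \<beta> i \<in> R" and \<pi>: "\<And>i. \<pi> i = g (pre \<pi> i) (drun \<delta> q0 (\<lambda>i. (\<tau> (pre \<pi> i), \<beta> i, \<pi> i)) i) (\<beta> i)" for \<pi> \<beta>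
  proof -
    let ?q = "drun \<delta> q0 (\<lambda>i. (\<tau> (pre \<pi> i), \<beta> i, \<pi> i))"
    let ?p = "\<lambda>i. (pre \<pi> i, ?q i)"
    have st: "?p (Suc i) \<in> \<sigma> (?p i)" if "?p i \<in> W" for i
    proof -
      have "(pre \<pi> i @ [g (pre \<pi> i) (?q i) (\<beta> i)],
          \<delta> (?q i) (\<tau> (pre \<pi> i), \<beta> i, g (pre \<pi> i) (?q i) (\<beta> i))) \<in> \<sigma> (?p i)"
        using g[OF that] \<beta>[of i] unfolding ok_def by blast
      then have "(pre \<pi> i @ [\<pi> i], \<delta> (?q i) (\<tau> (pre \<pi> i), \<beta> i, \<pi> i)) \<in> \<sigma> (?p i)"
        by (simp only: \<pi>[of i, symmetric])
      then show ?thesis by (simp add: pre_Suc)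
    qed
    have inW: "?p i \<in> W" for i
    proof (induction i)
      case (Suc i)
      have "\<sigma> (?p i) \<subseteq> W" using \<sigma>(1) Suc prM by blast
      then show ?case using st[OF Suc] by blast
    qed (use w W in simp)
    have "\<exists>k. even k = False \<and> lsup (\<lambda>i. pr (snd (?p i))) k"
      using \<sigma>(2)[rule_format, of ?p] inW[of 0] st[OF inW] prM by blast
    then obtain k where "odd k" "lsup (\<lambda>i. pr (?q i)) k" by auto
    then show ?thesis using lsup_unique[of "\<lambda>i. pr (?q i)"] unfolding parity_ok_def by blast
  qed
  then show ?thesis using gN by (intro exI[of _ g]) blast
qed

text \<open>The tracks describe a branch, the guessed strategy along it and a word of transitions.
  The state \<open>None\<close> is a sink of priority 1, entered when the direction taken is not the
  one the strategy prescribes.\<close>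

lemma drec_refute:
  "drec ((A \<times> ((Q \<times> R) \<rightarrow>\<^sub>E {..<N}) \<times> {..<N}) \<times> R) (\<lambda>w.
     (\<forall>i. fst (snd (fst (w i))) (drun \<delta> q0 (\<lambda>i. (fst (fst (w i)), snd (w i), snd (snd (fst (w i))))) i, snd (w i))
        = snd (snd (fst (w i)))) \<and>
     parity_ok (\<lambda>i. pr (drun \<delta> q0 (\<lambda>i. (fst (fst (w i)), snd (w i), snd (snd (fst (w i))))) i)))"
  (is "drec ?B ?L")
proof -
  define ltr :: "('l \<times> ('q \<times> 'r \<Rightarrow> nat) \<times> nat) \<times> 'r \<Rightarrow> 'l \<times> 'r \<times> nat"
    where "ltr x = (fst (fst x), snd x, snd (snd (fst x)))" for x
  define ok where "ok q x \<longleftrightarrow> fst (snd (fst x)) (q, snd x) = snd (snd (fst x))"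
    for q :: 'q and x :: "('l \<times> ('q \<times> 'r \<Rightarrow> nat) \<times> nat) \<times> 'r"
  define D where "D s x = (case s of None \<Rightarrow> None | Some q \<Rightarrow> if ok q x then Some (\<delta> q (ltr x)) else None)" for s x
  define pr' where "pr' s = (case s of None \<Rightarrow> 1 | Some q \<Rightarrow> pr q)" for s
  show ?thesis
  proof (rule drecI[where Q = "insert None (Some ` Q)" and ?q0.0 = "Some q0" and \<delta> = D and pr = pr'])
    show "D s x \<in> insert None (Some ` Q)" if "s \<in> insert None (Some ` Q)" "x \<in> ?B" for s x
      using that Q(3) unfolding D_def ltr_def by auto
    fix w :: "nat \<Rightarrow> ('l \<times> ('q \<times> 'r \<Rightarrow> nat) \<times> nat) \<times> 'r"
    define q where "q i = drun \<delta> q0 (\<lambda>i. ltr (w i)) i" for i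
    have q: "q 0 = q0" "\<And>i. q (Suc i) = \<delta> (q i) (ltr (w i))" unfolding q_def by simp_all
    have L: "?L w \<longleftrightarrow> (\<forall>i. ok (q i) (w i)) \<and> parity_ok (\<lambda>i. pr (q i))"
      unfolding q_def ok_def ltr_def ..
    show "?L w = parity_ok (\<lambda>i. pr' (drun D (Some q0) w i))"
    proof (cases "\<forall>i. ok (q i) (w i)")
      case True
      have "drun D (Some q0) w i = Some (q i)" for i
        by (induction i) (use True in \<open>simp_all add: q D_def\<close>)
      then show ?thesis unfolding L using True by (simp add: pr'_def)
    next
      case False
      have "\<exists>m. drun D (Some q0) w m = None"
      proof (rule ccontr)
        assume neg: "\<not> ?thesis"
        have run: "drun D (Some q0) w i = Some (q i)" for i
        proof (induction i)
          case (Suc i)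
          have "drun D (Some q0) w (Suc i) = D (Some (q i)) (w i)" by (simp add: Suc)
          also have "\<dots> = (if ok (q i) (w i) then Some (q (Suc i)) else None)" by (simp add: D_def q)
          finally show ?case using neg by metis
        qed (simp add: q)
        have "ok (q i) (w i)" for i
        proof (rule ccontr)
          assume "\<not> ok (q i) (w i)"
          then have "drun D (Some q0) w (Suc i) = None" by (simp add: run D_def)
          with neg show False by blast
        qed
        with False show False by blast
      qed
      then obtain m where m: "drun D (Some q0) w m = None" by blast
      have dead: "D None a = None" for a by (simp add: D_def)
      have "drun D (Some q0) w i = None" if "i \<ge> m" for i
        using that by (induction i rule: dec_induct) (simp_all add: m dead)
      then have "\<not> parity_ok (\<lambda>i. pr' (drun D (Some q0) w i))" by (intro parity_ok_stuck[of m]) (simp add: pr'_def)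
      then show ?thesis unfolding L using False by simp
    qed
  qed (use Q in simp_all)
qed

text \<open>The complement automaton guesses a pathfinder strategy and checks on every branch that
  no accepted word of transitions is consistent with the branch and the guess. If it accepts,
  playing any labelling \<open>\<rho>\<close> against the guess yields a branch on which
  \<open>\<rho>\<close> fails.\<close>

lemma tacc_compl:
  assumes N: "0 < N" and L: "\<And>w. (\<And>i. w i \<in> A \<times> R \<times> {..<N}) \<Longrightarrow> L w = parity_ok (\<lambda>i. pr (drun \<delta> q0 w i))"
    and \<tau>: "\<And>v. \<tau> v \<in> A"
  shows "\<not> tacc N R L \<tau> \<longleftrightarrow> tacc N ((Q \<times> R) \<rightarrow>\<^sub>E {..<N}) (\<lambda>w. \<not> (\<exists>\<beta>. (\<forall>i. \<beta> i \<in> R) \<and>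
      (\<forall>i. fst (snd (w i)) (drun \<delta> q0 (\<lambda>i. (fst (w i), \<beta> i, snd (snd (w i)))) i, \<beta> i) = snd (snd (w i))) \<and>
      parity_ok (\<lambda>i. pr (drun \<delta> q0 (\<lambda>i. (fst (w i), \<beta> i, snd (snd (w i)))) i)))) \<tau>"
    (is "_ \<longleftrightarrow> tacc N ?R' ?L' \<tau>")
proof
  assume "\<not> tacc N R L \<tau>"
  moreover have "tacc N R L \<tau>" if win: "([], q0) \<in> gwin \<tau>"
  proof -
    obtain \<rho> where \<rho>: "\<And>v. \<rho> v \<in> R" "\<And>\<pi>. (\<And>i. \<pi> i < N) \<Longrightarrow> parity_ok (\<lambda>i. pr (drun \<delta> q0 (tword \<tau> \<rho> \<pi>) i))"
      using gwin_acc[OF \<tau> win] by blast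
    have "L (tword \<tau> \<rho> \<pi>)" if "\<And>i. \<pi> i < N" for \<pi>
      using L[of "tword \<tau> \<rho> \<pi>"] \<rho>(2)[of \<pi>] that \<rho>(1) \<tau> by (simp add: tword_def)
    then show ?thesis unfolding tacc_def using \<rho>(1) by blast
  qed
  ultimately have "([], q0) \<notin> gwin \<tau>" by blast
  from not_gwin_rej[OF \<tau> this N] obtain g where g: "\<And>v q r. r \<in> R \<Longrightarrow> g v q r < N"
    "\<And>\<pi> \<beta>. (\<forall>i. \<beta> i \<in> R) \<Longrightarrow> (\<forall>i. \<pi> i = g (pre \<pi> i) (drun \<delta> q0 (\<lambda>i. (\<tau> (pre \<pi> i), \<beta> i, \<pi> i)) i) (\<beta> i)) \<Longrightarrow>
      \<not> parity_ok (\<lambda>i. pr (drun \<delta> q0 (\<lambda>i. (\<tau> (pre \<pi> i), \<beta> i, \<pi> i)) i))" by blast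
  define \<rho> where "\<rho> v = restrict (\<lambda>(q, r). g v q r) (Q \<times> R)" for v
  have "\<rho> v \<in> ?R'" for v unfolding \<rho>_def using g(1) by auto
  moreover have "?L' (tword \<tau> \<rho> \<pi>)" if \<pi>: "\<forall>i. \<pi> i < N" for \<pi>
  proof
    assume "\<exists>\<beta>. (\<forall>i. \<beta> i \<in> R) \<and>
      (\<forall>i. fst (snd (tword \<tau> \<rho> \<pi> i)) (drun \<delta> q0 (\<lambda>i. (fst (tword \<tau> \<rho> \<pi> i), \<beta> i, snd (snd (tword \<tau> \<rho> \<pi> i)))) i, \<beta> i) = snd (snd (tword \<tau> \<rho> \<pi> i))) \<and>
      parity_ok (\<lambda>i. pr (drun \<delta> q0 (\<lambda>i. (fst (tword \<tau> \<rho> \<pi> i), \<beta> i, snd (snd (tword \<tau> \<rho> \<pi> i)))) i))"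
    then obtain \<beta> where \<beta>: "\<forall>i. \<beta> i \<in> R"
      "\<forall>i. \<rho> (pre \<pi> i) (drun \<delta> q0 (\<lambda>i. (\<tau> (pre \<pi> i), \<beta> i, \<pi> i)) i, \<beta> i) = \<pi> i"
      "parity_ok (\<lambda>i. pr (drun \<delta> q0 (\<lambda>i. (\<tau> (pre \<pi> i), \<beta> i, \<pi> i)) i))" unfolding tword_def by auto
    have "drun \<delta> q0 (\<lambda>i. (\<tau> (pre \<pi> i), \<beta> i, \<pi> i)) i \<in> Q" for i
      by (rule drun_in[where A = "A \<times> R \<times> {..<N}"]) (use Q \<tau> \<beta>(1) \<pi> in auto)
    then have "\<forall>i. \<pi> i = g (pre \<pi> i) (drun \<delta> q0 (\<lambda>i. (\<tau> (pre \<pi> i), \<beta> i, \<pi> i)) i) (\<beta> i)"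
      using \<beta>(1,2) unfolding \<rho>_def by simp
    then show False using g(2)[OF \<beta>(1)] \<beta>(3) by blast
  qed
  ultimately show "tacc N ?R' ?L' \<tau>" unfolding tacc_def by blast
next
  assume "tacc N ?R' ?L' \<tau>"
  then obtain k where k: "\<And>v. k v \<in> ?R'" "\<And>\<pi>. \<forall>i. \<pi> i < N \<Longrightarrow> ?L' (tword \<tau> k \<pi>)" unfolding tacc_def by blast
  show "\<not> tacc N R L \<tau>"
  proof
    assume "tacc N R L \<tau>"
    then obtain \<rho> where \<rho>: "\<And>v. \<rho> v \<in> R" "\<And>\<pi>. \<forall>i. \<pi> i < N \<Longrightarrow> L (tword \<tau> \<rho> \<pi>)" unfolding tacc_def by blast
    \<comment> \<open>The play of \<open>\<rho>\<close> against the guessed strategy: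
      \<open>pos\<close> holds the current address and state, \<open>dir\<close> the direction
      prescribed there.\<close>
    define dir where "dir p = k (fst p) (snd p, \<rho> (fst p))" for p
    define pos where "pos = rec_nat ([], q0) (\<lambda>_ p. (fst p @ [dir p], \<delta> (snd p) (\<tau> (fst p), \<rho> (fst p), dir p)))"
    define \<pi> where "\<pi> i = dir (pos i)" for i
    have pos: "pos 0 = ([], q0)" "\<And>i. pos (Suc i) = (fst (pos i) @ [\<pi> i], \<delta> (snd (pos i)) (\<tau> (fst (pos i)), \<rho> (fst (pos i)), \<pi> i))"
      unfolding pos_def \<pi>_def by simp_all
    have pre: "fst (pos i) = pre \<pi> i" for i by (induction i) (simp_all add: pos pre_Suc)
    have st: "drun \<delta> q0 (\<lambda>i. (\<tau> (pre \<pi> i), \<rho> (pre \<pi> i), \<pi> i)) i = snd (pos i)" for i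
      by (induction i) (simp_all add: pos pre)
    have QN: "snd (pos i) \<in> Q \<and> \<pi> i < N" for i
    proof (induction i)
      case 0
      have "k [] (q0, \<rho> []) \<in> {..<N}" using PiE_mem[OF k(1)] Q(2) \<rho>(1) by blast
      then show ?case unfolding \<pi>_def dir_def using pos(1) Q(2) by simp
    next
      case (Suc i)
      have q: "snd (pos (Suc i)) \<in> Q" using Suc Q(3) \<tau> \<rho>(1) pos(2) by simp
      have "k (fst (pos (Suc i))) (snd (pos (Suc i)), \<rho> (fst (pos (Suc i)))) \<in> {..<N}"
        using PiE_mem[OF k(1)] q \<rho>(1) by blast
      then show ?case unfolding \<pi>_def dir_def using q by simp
    qed
    then have \<pi>N: "\<forall>i. \<pi> i < N" by blast
    have "L (tword \<tau> \<rho> \<pi>)" using \<rho>(2)[OF \<pi>N] .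
    then have "parity_ok (\<lambda>i. pr (drun \<delta> q0 (tword \<tau> \<rho> \<pi>) i))"
      using L[of "tword \<tau> \<rho> \<pi>"] \<tau> \<rho>(1) \<pi>N by (simp add: tword_def)
    moreover have "k (pre \<pi> i) (snd (pos i), \<rho> (pre \<pi> i)) = \<pi> i" for i
      by (simp add: \<pi>_def dir_def pre)
    ultimately have "\<not> ?L' (tword \<tau> k \<pi>)" using \<rho>(1)
      by (simp add: tword_def[abs_def] st) (rule exI[of _ "\<lambda>i. \<rho> (pre \<pi> i)"], simp add: st)
    then show False using k(2)[OF \<pi>N] by blast
  qed
qed

end

theorem trec_compl:
  assumes "trec N A P" "0 < N"
  shows "trec N A (\<lambda>\<tau>. \<not> P \<tau>)"
proof -
  obtain R :: "nat set" and L where R: "finite R" "R \<noteq> {}" and d: "drec (A \<times> R \<times> {..<N}) L"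
    and P: "\<And>\<tau>. (\<And>v. \<tau> v \<in> A) \<Longrightarrow> P \<tau> = tacc N R L \<tau>" using trecE[OF assms(1)] by metis
  obtain Q :: "nat set" and q0 \<delta> pr M where Q: "finite Q" "q0 \<in> Q" "\<And>q a. q \<in> Q \<Longrightarrow> a \<in> A \<times> R \<times> {..<N} \<Longrightarrow> \<delta> q a \<in> Q"
    "\<And>w. (\<And>i. w i \<in> A \<times> R \<times> {..<N}) \<Longrightarrow> L w = parity_ok (\<lambda>i. pr (drun \<delta> q0 w i))" "\<And>q. pr q \<le> (M::nat)"
    using drecE[OF d] by metis
  have Q3: "\<forall>q\<in>Q. \<forall>a\<in>A \<times> R \<times> {..<N}. \<delta> q a \<in> Q" and M: "\<forall>q. pr q \<le> M" using Q by blast+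
  show ?thesis
  proof (rule trecI)
    show "finite ((Q \<times> R) \<rightarrow>\<^sub>E {..<N})" using Q(1) R(1) by (simp add: finite_PiE)
    show "(Q \<times> R) \<rightarrow>\<^sub>E {..<N} \<noteq> {}" using assms(2) by (auto simp: PiE_eq_empty_iff)
    \<comment> \<open>Quantifying over \<open>\<beta>\<close> is a projection of words, so
      determinisation is used here; the negation is then a shift of priorities.\<close>
    show "drec (A \<times> ((Q \<times> R) \<rightarrow>\<^sub>E {..<N}) \<times> {..<N}) (\<lambda>w. \<not> (\<exists>\<beta>. (\<forall>i. \<beta> i \<in> R) \<and>
      (\<forall>i. fst (snd (w i)) (drun \<delta> q0 (\<lambda>i. (fst (w i), \<beta> i, snd (snd (w i)))) i, \<beta> i) = snd (snd (w i))) \<and>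
      parity_ok (\<lambda>i. pr (drun \<delta> q0 (\<lambda>i. (fst (w i), \<beta> i, snd (snd (w i)))) i))))"
      using drec_compl[OF drec_proj[OF drec_refute[OF Q(1,2) Q3 M R]]] by simp
    fix \<tau> :: "nat list \<Rightarrow> 'a" assume \<tau>: "\<And>v. \<tau> v \<in> A"
    show "(\<not> P \<tau>) = tacc N ((Q \<times> R) \<rightarrow>\<^sub>E {..<N}) (\<lambda>w. \<not> (\<exists>\<beta>. (\<forall>i. \<beta> i \<in> R) \<and>
      (\<forall>i. fst (snd (w i)) (drun \<delta> q0 (\<lambda>i. (fst (w i), \<beta> i, snd (snd (w i)))) i, \<beta> i) = snd (snd (w i))) \<and>
      parity_ok (\<lambda>i. pr (drun \<delta> q0 (\<lambda>i. (fst (w i), \<beta> i, snd (snd (w i)))) i)))) \<tau>"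
      unfolding P[OF \<tau>] by (rule tacc_compl[OF Q(1,2) Q3 M R assms(2)]) (use Q(4) \<tau> in auto)
  qed
qed

section \<open>From monadic second-order logic to tree automata\<close>

lemma trec_conj:
  assumes "trec N A P1" "trec N A P2" "0 < N"
  shows "trec N A (\<lambda>\<tau>. P1 \<tau> \<and> P2 \<tau>)"
  by (rule trec_cong[OF trec_compl[OF trec_disj[OF trec_compl[OF assms(1,3)] trec_compl[OF assms(2,3)]] assms(3)]]) simp

text \<open>Branches only use directions below \<open>N\<close>, while \<open>P\<close> is a
  predicate on functions defined at all addresses. This disposes of the junk at the other
  addresses.\<close>

lemma trec_local:
  assumes "trec N A P" "\<And>v. \<tau> v \<in> A" "\<And>v. \<tau>' v \<in> A" "\<And>v. v \<in> lists {..<N} \<Longrightarrow> \<tau> v = \<tau>' v"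
  shows "P \<tau> = P \<tau>'"
proof -
  obtain R :: "nat set" and L where R: "\<And>\<tau>. (\<And>v. \<tau> v \<in> A) \<Longrightarrow> P \<tau> = tacc N R L \<tau>"
    using trecE[OF assms(1)] by metis
  have "tword \<tau> \<rho> \<pi> = tword \<tau>' \<rho> \<pi>" if "\<forall>i. \<pi> i < N" for \<rho> :: "nat list \<Rightarrow> nat" and \<pi>
  proof
    fix i
    have "pre \<pi> i \<in> lists {..<N}" using that by (auto simp: pre_def)
    then show "tword \<tau> \<rho> \<pi> i = tword \<tau>' \<rho> \<pi> i" by (simp add: tword_def assms(4))
  qed
  then have "tacc N R L \<tau> = tacc N R L \<tau>'" unfolding tacc_def by (metis (no_types, lifting))
  then show ?thesis using R[OF assms(2)] R[OF assms(3)] by simp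
qed

lemma trec_all:
  assumes "finite A" "0 < N"
  shows "trec N A (\<lambda>\<tau>. \<forall>v\<in>lists {..<N}. E (\<tau> v))"
proof (rule trec_cong[OF trec_safe[OF assms, of E "\<lambda>_ _ b. E b"]])
  fix \<tau> :: "nat list \<Rightarrow> 'a"
  show "(E (\<tau> []) \<and> (\<forall>v\<in>lists {..<N}. \<forall>d<N. E (\<tau> (v @ [d])))) = (\<forall>v\<in>lists {..<N}. E (\<tau> v))"
  proof (intro iffI ballI; (elim conjE)?)
    fix v assume h: "E (\<tau> [])" "\<forall>v\<in>lists {..<N}. \<forall>d<N. E (\<tau> (v @ [d]))" and v: "v \<in> lists {..<N}"
    show "E (\<tau> v)"
    proof (cases v rule: rev_cases)
      case (snoc u d)
      then show ?thesis using h(2) v by (auto simp: in_lists_conv_set)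
    qed (use h in simp)
  qed auto
qed

text \<open>The choice labelling points to the subtree containing the marked node, \<open>None\<close> meaning that there is none.\<close>

lemma trec_at_most_one:
  assumes A: "finite A" and N: "0 < N"
  shows "trec N A (\<lambda>\<tau>. \<forall>u\<in>lists {..<N}. \<forall>v\<in>lists {..<N}. e (\<tau> u) \<longrightarrow> e (\<tau> v) \<longrightarrow> u = v)"
proof -
  let ?B = "insert None (Some ` {..<N})"
  define C0 where "C0 x \<longleftrightarrow> (snd x = None \<longrightarrow> \<not> e (fst x))" for x :: "'a \<times> nat option"
  define C where "C x d y \<longleftrightarrow> (snd y = None \<longrightarrow> \<not> e (fst y)) \<and> (snd x = None \<longrightarrow> snd y = None)
     \<and> (e (fst x) \<longrightarrow> snd y = None) \<and> (\<forall>g. snd x = Some g \<and> d \<noteq> g \<longrightarrow> snd y = None)" for x y :: "'a \<times> nat option" and d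
  have "trec N (A \<times> ?B) (\<lambda>\<tau>. C0 (\<tau> []) \<and> (\<forall>v\<in>lists {..<N}. \<forall>d<N. C (\<tau> v) d (\<tau> (v @ [d]))))"
    by (rule trec_safe) (use A N in simp_all)
  then have "trec N A (\<lambda>\<tau>. \<exists>\<sigma>. (\<forall>v. \<sigma> v \<in> ?B) \<and>
      (C0 (\<tau> [], \<sigma> []) \<and> (\<forall>v\<in>lists {..<N}. \<forall>d<N. C (\<tau> v, \<sigma> v) d (\<tau> (v @ [d]), \<sigma> (v @ [d])))))"
    by (rule trec_proj) simp_all
  then show ?thesis
  proof (rule trec_cong)
    fix \<tau> :: "nat list \<Rightarrow> 'a"
    show "(\<exists>\<sigma>. (\<forall>v. \<sigma> v \<in> ?B) \<and> (C0 (\<tau> [], \<sigma> []) \<and> (\<forall>v\<in>lists {..<N}. \<forall>d<N. C (\<tau> v, \<sigma> v) d (\<tau> (v @ [d]), \<sigma> (v @ [d])))))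
       = (\<forall>u\<in>lists {..<N}. \<forall>v\<in>lists {..<N}. e (\<tau> u) \<longrightarrow> e (\<tau> v) \<longrightarrow> u = v)"
    proof
      assume "\<exists>\<sigma>. (\<forall>v. \<sigma> v \<in> ?B) \<and> (C0 (\<tau> [], \<sigma> []) \<and> (\<forall>v\<in>lists {..<N}. \<forall>d<N. C (\<tau> v, \<sigma> v) d (\<tau> (v @ [d]), \<sigma> (v @ [d]))))"
      then obtain \<sigma> where s0: "C0 (\<tau> [], \<sigma> [])"
        and s: "\<And>v d. v \<in> lists {..<N} \<Longrightarrow> d < N \<Longrightarrow> C (\<tau> v, \<sigma> v) d (\<tau> (v @ [d]), \<sigma> (v @ [d]))" by blast
      have ne: "\<not> e (\<tau> v)" if "v \<in> lists {..<N}" "\<sigma> v = None" for v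
      proof (cases v rule: rev_cases)
        case Nil
        then show ?thesis using s0 that by (simp add: C0_def)
      next
        case (snoc u d)
        then have "u \<in> lists {..<N}" "d < N" using that(1) by (auto simp: in_lists_conv_set)
        then show ?thesis using s[of u d] that(2) snoc by (simp add: C_def)
      qed
      have below: "\<sigma> (p @ u) = None" if p: "p \<in> lists {..<N}" "\<sigma> p = None" and u: "u \<in> lists {..<N}" for p u
        using u
      proof (induction u rule: rev_induct)
        case (snoc d u)
        then have "d < N" "p @ u \<in> lists {..<N}" "\<sigma> (p @ u) = None" using p by (auto simp: in_lists_conv_set)
        then show ?case using s[of "p @ u" d] by (simp add: C_def)
      qed (use p in simp)
      have dead: "\<not> e (\<tau> (p @ d # u))" if "p \<in> lists {..<N}" "d < N" "u \<in> lists {..<N}" "\<sigma> (p @ [d]) = None" for p d u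
      proof -
        have "p @ [d] \<in> lists {..<N}" using that by auto
        then show ?thesis using below[of "p @ [d]" u] ne[of "(p @ [d]) @ u"] that by auto
      qed
      have main: "u = v" if "p \<in> lists {..<N}" "u \<in> lists {..<N}" "v \<in> lists {..<N}" "e (\<tau> (p @ u))" "e (\<tau> (p @ v))" for p u v
        using that
      proof (induction u arbitrary: p v)
        case Nil
        show ?case
        proof (cases v)
          case (Cons d v')
          then have d: "d < N" "v' \<in> lists {..<N}" using Nil by auto
          have "\<sigma> (p @ [d]) = None" using s[OF Nil(1) d(1)] Nil by (simp add: C_def)
          then show ?thesis using dead[OF Nil(1) d] Nil Cons by simp
        qed simp
      next
        case (Cons d u')
        then have d: "d < N" "u' \<in> lists {..<N}" by auto
        have nd: "\<sigma> (p @ [d]) \<noteq> None" using dead[OF Cons.prems(1) d] Cons.prems by blast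
        show ?case
        proof (cases v)
          case Nil
          then have "\<sigma> (p @ [d]) = None" using s[OF Cons.prems(1) d(1)] Cons.prems by (simp add: C_def)
          then show ?thesis using nd by simp
        next
          case v: (Cons d' v')
          then have d': "d' < N" "v' \<in> lists {..<N}" using Cons.prems by auto
          have nd': "\<sigma> (p @ [d']) \<noteq> None" using dead[OF Cons.prems(1) d'] Cons.prems v by blast
          have "d = d'" using s[OF Cons.prems(1) d(1)] s[OF Cons.prems(1) d'(1)] nd nd'
            by (cases "\<sigma> p") (auto simp: C_def)
          moreover have "p @ [d] \<in> lists {..<N}" using Cons.prems d by auto
          ultimately show ?thesis using Cons.IH[of "p @ [d]" v'] d d' Cons.prems v by simp
        qed
      qed
      then show "\<forall>u\<in>lists {..<N}. \<forall>v\<in>lists {..<N}. e (\<tau> u) \<longrightarrow> e (\<tau> v) \<longrightarrow> u = v" using main[of "[]"] by simp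
    next
      assume one: "\<forall>u\<in>lists {..<N}. \<forall>v\<in>lists {..<N}. e (\<tau> u) \<longrightarrow> e (\<tau> v) \<longrightarrow> u = v"
      show "\<exists>\<sigma>. (\<forall>v. \<sigma> v \<in> ?B) \<and> (C0 (\<tau> [], \<sigma> []) \<and> (\<forall>v\<in>lists {..<N}. \<forall>d<N. C (\<tau> v, \<sigma> v) d (\<tau> (v @ [d]), \<sigma> (v @ [d]))))"
      proof (cases "\<exists>v\<in>lists {..<N}. e (\<tau> v)")
        case False
        then have "C0 (\<tau> [], None)" "\<forall>v\<in>lists {..<N}. \<forall>d<N. C (\<tau> v, None) d (\<tau> (v @ [d]), None)"
          by (auto simp: C0_def C_def)
        then show ?thesis by (intro exI[of _ "\<lambda>_. None"]) simp
      next
        case True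
        then obtain w where w: "w \<in> lists {..<N}" "e (\<tau> w)" by blast
        have uw: "u = w" if "u \<in> lists {..<N}" "e (\<tau> u)" for u using one w that by blast
        \<comment> \<open>\<open>\<sigma>\<close> follows the path to \<open>w\<close>. At
          \<open>w\<close> itself the direction 0 is a default: \<open>C\<close> forbids marks below
          a marked node whatever the pointer is.\<close>
        define \<sigma> where "\<sigma> p = (if take (length p) w = p then Some (if length p < length w then w ! length p else 0) else None)" for p
        have mem: "\<sigma> v \<in> ?B" for v
        proof -
          have "w ! i < N" if "i < length w" for i using w(1) nth_mem[OF that] by (auto simp: in_lists_conv_set)
          then show ?thesis using N unfolding \<sigma>_def by auto
        qed
        have pw: "\<sigma> u \<noteq> None" if "u \<in> lists {..<N}" "e (\<tau> u)" for u using uw[OF that] by (simp add: \<sigma>_def)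
        have "C (\<tau> v, \<sigma> v) d (\<tau> (v @ [d]), \<sigma> (v @ [d]))" if v: "v \<in> lists {..<N}" "d < N" for v d
        proof -
          have child: "take (length v) w = v \<and> length v < length w \<and> w ! length v = d" if "\<sigma> (v @ [d]) \<noteq> None"
          proof -
            have t: "take (Suc (length v)) w = v @ [d]" using that by (simp add: \<sigma>_def split: if_splits)
            then have l: "length v < length w" by (metis length_append_singleton length_take min.absorb_iff2 min_def nat_less_le not_less_eq_eq le_refl)
            then show ?thesis using t by (simp add: take_Suc_conv_app_nth)
          qed
          have "v @ [d] \<in> lists {..<N}" using v by auto
          then show ?thesis using pw[of "v @ [d]"] child uw[OF v(1)] unfolding C_def by (auto simp: \<sigma>_def)
        qed
        moreover have "C0 (\<tau> [], \<sigma> [])" by (simp add: C0_def \<sigma>_def)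
        ultimately show ?thesis using mem by blast
      qed
    qed
  qed
qed

lemma trec_exactly_one:
  assumes "finite A" "0 < N"
  shows "trec N A (\<lambda>\<tau>. \<exists>v\<in>lists {..<N}. \<forall>u\<in>lists {..<N}. e (\<tau> u) \<longleftrightarrow> u = v)"
  by (rule trec_cong[OF trec_conj[OF trec_at_most_one[OF assms, of e] trec_compl[OF trec_all[OF assms, of "\<lambda>a. \<not> e a"] assms(2)] assms(2)]])
     (rule iffI, blast, metis)

section \<open>Valuations as labels and the translation of formulae\<close>

primrec vmax :: "'c mso \<Rightarrow> nat" where
  "vmax (MLeq x y) = Suc (max x y)"
| "vmax (MSucc i x y) = Suc (max x y)"
| "vmax (MLab c x) = Suc x"
| "vmax (MQ i x) = Suc x"
| "vmax (MRoot x) = Suc x"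
| "vmax (MEq x y) = Suc (max x y)"
| "vmax (MMem x X) = Suc (max x X)"
| "vmax (MNeg \<phi>) = vmax \<phi>"
| "vmax (MConj \<phi> \<psi>) = max (vmax \<phi>) (vmax \<psi>)"
| "vmax (MEx1 x \<phi>) = max (Suc x) (vmax \<phi>)"
| "vmax (MEx2 X \<phi>) = max (Suc X) (vmax \<phi>)"

definition labels :: "'c set \<Rightarrow> nat \<Rightarrow> ('c + nat) option set" where
  "labels \<Sigma> n = insert None (Some ` (Inl ` \<Sigma> \<union> Inr ` {..<n}))"

text \<open>Variables from \<open>K\<close> on are dropped to keep the alphabet finite;
  \<open>K\<close> will be \<open>vmax\<close> of the formula.\<close>

definition enc :: "nat \<Rightarrow> (nat list \<Rightarrow> ('c + nat) option) \<Rightarrow> (nat \<Rightarrow> nat list) \<Rightarrow> (nat \<Rightarrow> nat list set) \<Rightarrow>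
    nat list \<Rightarrow> ('c + nat) option \<times> nat set \<times> nat set" where
  "enc K t f F v = (t v, {x. x < K \<and> f x = v}, {X. X < K \<and> v \<in> F X})"

definition shape :: "nat \<Rightarrow> 'c set \<Rightarrow> nat \<Rightarrow> (nat list \<Rightarrow> ('c + nat) option) \<Rightarrow> bool" where
  "shape N \<Sigma> n t \<longleftrightarrow> (\<forall>v. t v \<in> labels \<Sigma> n) \<and> (\<forall>v. t v \<noteq> None \<longrightarrow> v \<in> lists {..<N})"

definition good :: "(nat list \<Rightarrow> ('c + nat) option) \<Rightarrow> (nat \<Rightarrow> nat list) \<Rightarrow> (nat \<Rightarrow> nat list set) \<Rightarrow> bool" where
  "good t f F \<longleftrightarrow> (\<forall>x. t (f x) \<noteq> None) \<and> (\<forall>X. F X \<subseteq> {v. t v \<noteq> None})"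

context
  fixes \<Sigma> :: "'c set" and n N K :: nat
  assumes \<Sigma>: "finite \<Sigma>" and N: "0 < N"
begin

abbreviation "Al \<equiv> labels \<Sigma> n \<times> Pow {..<K} \<times> Pow {..<K}"

lemma finite_Al: "finite Al"
  using \<Sigma> by (simp add: labels_def)

lemma enc_Al:
  assumes "shape N \<Sigma> n t"
  shows "enc K t f F v \<in> Al"
  using assms by (auto simp: enc_def shape_def)

text \<open>Correctness is required only on encodings of proper trees and valuations. That a
  first-order variable has exactly one value is therefore not checked by the automata of subformulae
  but at the quantifier, by \<open>trec_exactly_one\<close>.\<close>

definition expr :: "'c mso \<Rightarrow> ((nat list \<Rightarrow> ('c + nat) option \<times> nat set \<times> nat set) \<Rightarrow> bool) \<Rightarrow> bool" where
  "expr \<phi> P \<longleftrightarrow> trec N Al P \<and> (\<forall>t f F. shape N \<Sigma> n t \<longrightarrow> good t f F \<longrightarrow> sat t f F \<phi> = P (enc K t f F))"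

lemma good_lists: "shape N \<Sigma> n t \<Longrightarrow> good t f F \<Longrightarrow> f x \<in> lists {..<N}"
  unfolding shape_def good_def by blast

text \<open>As exactly one address carries the mark \<open>x\<close>, a statement about the value of
  \<open>x\<close> may be phrased for all addresses with the mark, which is a local
  condition.\<close>

lemma expr_point:
  assumes "x < K"
    and "\<And>t f F. shape N \<Sigma> n t \<Longrightarrow> good t f F \<Longrightarrow> sat t f F \<phi> = E (enc K t f F (f x))"
  shows "expr \<phi> (\<lambda>\<tau>. \<forall>v\<in>lists {..<N}. x \<in> fst (snd (\<tau> v)) \<longrightarrow> E (\<tau> v))"
  unfolding expr_def
proof (intro conjI allI impI)
  show "trec N Al (\<lambda>\<tau>. \<forall>v\<in>lists {..<N}. x \<in> fst (snd (\<tau> v)) \<longrightarrow> E (\<tau> v))"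
    using finite_Al N by (rule trec_all)
  fix t f F assume "shape N \<Sigma> n t" "good t f F"
  then show "sat t f F \<phi> = (\<forall>v\<in>lists {..<N}. x \<in> fst (snd (enc K t f F v)) \<longrightarrow> E (enc K t f F v))"
    using assms good_lists[of t f F x] by (auto simp: enc_def)
qed

lemma expr_atomic:
  assumes "x < K" "y < K"
  shows "\<exists>P. expr (MLab c x) P" "\<exists>P. expr (MQ i x) P" "\<exists>P. expr (MRoot x) P" "\<exists>P. expr (MEq x y) P" "\<exists>P. expr (MMem x y) P"
proof -
  show "\<exists>P. expr (MLab c x) P"
    by (rule exI, rule expr_point[where E = "\<lambda>a. fst a = Some (Inl c)", OF assms(1)]) (simp add: enc_def)
  show "\<exists>P. expr (MQ i x) P"
    by (rule exI, rule expr_point[where E = "\<lambda>a. fst a = Some (Inr i)", OF assms(1)]) (simp add: enc_def)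
  show "\<exists>P. expr (MEq x y) P"
    by (rule exI, rule expr_point[where E = "\<lambda>a. y \<in> fst (snd a)", OF assms(1)]) (use assms in \<open>auto simp: enc_def\<close>)
  show "\<exists>P. expr (MMem x y) P"
    by (rule exI, rule expr_point[where E = "\<lambda>a. y \<in> snd (snd a)", OF assms(1)]) (use assms in \<open>auto simp: enc_def\<close>)
  show "\<exists>P. expr (MRoot x) P"
  proof (rule exI)
    show "expr (MRoot x) (\<lambda>\<tau>. x \<in> fst (snd (\<tau> [])) \<and> (\<forall>v\<in>lists {..<N}. \<forall>d<N. True))"
      unfolding expr_def
    proof (intro conjI allI impI)
      show "trec N Al (\<lambda>\<tau>. x \<in> fst (snd (\<tau> [])) \<and> (\<forall>v\<in>lists {..<N}. \<forall>d<N. True))"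
        using trec_safe[OF finite_Al N, of "\<lambda>a. x \<in> fst (snd a)" "\<lambda>_ _ _. True"] .
    qed (use assms in \<open>auto simp: enc_def\<close>)
  qed
qed

lemma expr_succ:
  assumes "x < K" "y < K"
  shows "\<exists>P. expr (MSucc i x y) P"
proof (rule exI)
  \<comment> \<open>The first conjunct rejects successor indices beyond the branching degree, for
    which the universal condition would hold vacuously.\<close>
  let ?P = "\<lambda>\<tau>. i < N \<and> (\<forall>v\<in>lists {..<N}. \<forall>d<N. d = i \<longrightarrow> x \<in> fst (snd (\<tau> v)) \<longrightarrow> y \<in> fst (snd (\<tau> (v @ [d]))))"
  show "expr (MSucc i x y) ?P" unfolding expr_def
  proof (intro conjI allI impI)
    show "trec N Al ?P"
      using trec_safe[OF finite_Al N, of "\<lambda>_. i < N" "\<lambda>a d b. d = i \<longrightarrow> x \<in> fst (snd a) \<longrightarrow> y \<in> fst (snd b)"] .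
    fix t f F assume sh: "shape N \<Sigma> n t" and g: "good t f F"
    have lx: "f x \<in> lists {..<N}" "f y \<in> lists {..<N}" using good_lists[OF sh g] by blast+
    have "sat t f F (MSucc i x y) \<longleftrightarrow> i < N \<and> f y = f x @ [i]" using lx by auto
    also have "\<dots> \<longleftrightarrow> ?P (enc K t f F)" using assms lx by (auto simp: enc_def)
    finally show "sat t f F (MSucc i x y) \<longleftrightarrow> ?P (enc K t f F)" .
  qed
qed

text \<open>\<open>f y\<close> fails to lie below \<open>f x\<close> exactly if some set closed
  under children contains \<open>f x\<close> but not \<open>f y\<close>; a negated projection
  expresses the opposite.\<close>

lemma expr_leq:
  assumes "x < K" "y < K"
  shows "\<exists>P. expr (MLeq x y) P"
proof (rule exI)
  let ?c = "\<lambda>a. (x \<in> fst (snd (fst a)) \<longrightarrow> snd a) \<and> (y \<in> fst (snd (fst a)) \<longrightarrow> \<not> snd a)"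
  let ?Q = "\<lambda>\<tau> :: nat list \<Rightarrow> (('c + nat) option \<times> nat set \<times> nat set) \<times> bool.
     ?c (\<tau> []) \<and> (\<forall>v\<in>lists {..<N}. \<forall>d<N. (snd (\<tau> v) \<longrightarrow> snd (\<tau> (v @ [d]))) \<and> ?c (\<tau> (v @ [d])))"
  let ?P = "\<lambda>\<tau>. \<not> (\<exists>\<sigma>. (\<forall>v. \<sigma> v \<in> UNIV) \<and> ?Q (\<lambda>v. (\<tau> v, \<sigma> v)))"
  show "expr (MLeq x y) ?P" unfolding expr_def
  proof (intro conjI allI impI)
    have "trec N (Al \<times> UNIV) ?Q"
      using trec_safe[of "Al \<times> (UNIV :: bool set)" N ?c "\<lambda>a d b. (snd a \<longrightarrow> snd b) \<and> ?c b"] finite_Al N by simp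
    then show "trec N Al ?P" by (intro trec_compl[OF _ N] trec_proj) simp_all
    fix t f F assume sh: "shape N \<Sigma> n t" and g: "good t f F"
    have lx: "f x \<in> lists {..<N}" "f y \<in> lists {..<N}" using good_lists[OF sh g] by blast+
    have m: "x \<in> fst (snd (enc K t f F v)) \<longleftrightarrow> f x = v" "y \<in> fst (snd (enc K t f F v)) \<longleftrightarrow> f y = v" for v
      using assms by (auto simp: enc_def)
    show "sat t f F (MLeq x y) = ?P (enc K t f F)"
    proof
      assume "sat t f F (MLeq x y)"
      then obtain z where z: "f y = f x @ z" by auto
      show "?P (enc K t f F)"
      proof
        assume "\<exists>\<sigma>. (\<forall>v. \<sigma> v \<in> UNIV) \<and> ?Q (\<lambda>v. (enc K t f F v, \<sigma> v))"
        then obtain \<sigma> where s0: "?c (enc K t f F [], \<sigma> [])" and s: "\<And>v d. v \<in> lists {..<N} \<Longrightarrow> d < N \<Longrightarrow>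
           (\<sigma> v \<longrightarrow> \<sigma> (v @ [d])) \<and> ?c (enc K t f F (v @ [d]), \<sigma> (v @ [d]))" by auto
        have c: "?c (enc K t f F v, \<sigma> v)" if "v \<in> lists {..<N}" for v
        proof (cases v rule: rev_cases)
          case (snoc u d)
          then have "u \<in> lists {..<N}" "d < N" using that by auto
          then show ?thesis using s snoc by blast
        qed (use s0 in simp)
        have "\<sigma> (f x @ u)" if "u \<in> lists {..<N}" for u
          using that
        proof (induction u rule: rev_induct)
          case Nil
          then show ?case using c[OF lx(1)] m by simp
        next
          case (snoc d u)
          then have "\<sigma> (f x @ u)" "d < N" "f x @ u \<in> lists {..<N}" using lx by auto
          then show ?case using s[of "f x @ u" d] by simp
        qed
        moreover have "z \<in> lists {..<N}" using lx(2) z by simp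
        ultimately have "\<sigma> (f y)" using z by simp
        moreover have "\<not> \<sigma> (f y)" using c[OF lx(2)] m by simp
        ultimately show False by blast
      qed
    next
      assume P: "?P (enc K t f F)"
      show "sat t f F (MLeq x y)"
      proof (rule ccontr)
        assume "\<not> sat t f F (MLeq x y)"
        then have n: "f y \<noteq> f x @ z" for z by simp
        define \<sigma> where "\<sigma> v \<longleftrightarrow> (\<exists>z. v = f x @ z)" for v
        have c: "?c (enc K t f F v, \<sigma> v)" for v unfolding fst_conv snd_conv m \<sigma>_def using n by auto
        have ch: "\<sigma> v \<longrightarrow> \<sigma> (v @ [d])" for v d unfolding \<sigma>_def by auto
        have Q: "?Q (\<lambda>v. (enc K t f F v, \<sigma> v))" using c ch by simp
        have "\<exists>\<sigma>. (\<forall>v. \<sigma> v \<in> UNIV) \<and> ?Q (\<lambda>v. (enc K t f F v, \<sigma> v))"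
        proof (rule exI[of _ \<sigma>])
          show "(\<forall>v. \<sigma> v \<in> UNIV) \<and> ?Q (\<lambda>v. (enc K t f F v, \<sigma> v))" by (rule conjI[OF _ Q]) simp
        qed
        with P show False by (rule notE)
      qed
    qed
  qed
qed

lemma expr_neg: "expr \<phi> P \<Longrightarrow> expr (MNeg \<phi>) (\<lambda>\<tau>. \<not> P \<tau>)"
  unfolding expr_def using trec_compl[OF _ N] by auto

lemma expr_conj: "expr \<phi> P \<Longrightarrow> expr \<psi> P' \<Longrightarrow> expr (MConj \<phi> \<psi>) (\<lambda>\<tau>. P \<tau> \<and> P' \<tau>)"
  unfolding expr_def using trec_conj[OF _ _ N] by auto

text \<open>A new track marks the value of the quantified variable, and \<open>?u\<close> overwrites
  the mark \<open>x\<close> with it. Outside the addresses over \<open>{..<N}\<close> the track is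
  unconstrained, so the guessed encoding is compared with the true one through
  \<open>trec_local\<close>.\<close>

lemma expr_ex1:
  assumes P: "expr \<phi> P" and x: "x < K"
  shows "\<exists>P'. expr (MEx1 x \<phi>) P'"
proof (rule exI)
  let ?u = "\<lambda>a :: (('c + nat) option \<times> nat set \<times> nat set) \<times> bool.
     (fst (fst a), if snd a then insert x (fst (snd (fst a))) else fst (snd (fst a)) - {x}, snd (snd (fst a)))"
  let ?Q = "\<lambda>\<tau>. ((\<exists>v\<in>lists {..<N}. \<forall>u\<in>lists {..<N}. snd (\<tau> u) \<longleftrightarrow> u = v) \<and>
     (\<forall>v\<in>lists {..<N}. snd (\<tau> v) \<longrightarrow> fst (fst (\<tau> v)) \<noteq> None)) \<and> P (\<lambda>v. ?u (\<tau> v))"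
  let ?P = "\<lambda>\<tau>. \<exists>\<sigma>. (\<forall>v. \<sigma> v \<in> UNIV) \<and> ?Q (\<lambda>v. (\<tau> v, \<sigma> v))"
  have fin: "finite (Al \<times> (UNIV :: bool set))" using finite_Al by simp
  have tP: "trec N Al P" using P unfolding expr_def by blast
  have "trec N (Al \<times> UNIV) ?Q"
    by (intro trec_conj N trec_exactly_one[OF fin N, of snd] trec_all[OF fin N, of "\<lambda>a. snd a \<longrightarrow> fst (fst a) \<noteq> None"]
        trec_map[OF tP, of _ ?u]) (use x in \<open>auto split: if_splits\<close>)
  then have "trec N Al ?P" by (rule trec_proj) simp_all
  moreover have "sat t f F (MEx1 x \<phi>) = ?P (enc K t f F)" if sh: "shape N \<Sigma> n t" and g: "good t f F" for t f F
  proof -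
    have up: "enc K t (f(x := v)) F u = ?u (enc K t f F u, u = v)" for u v
      using x by (auto simp: enc_def)
    have dl: "v \<in> lists {..<N}" if "t v \<noteq> None" for v using sh that unfolding shape_def by blast
    have gv: "good t (f(x := v)) F" if "t v \<noteq> None" for v using g that unfolding good_def by simp
    show ?thesis
    proof
      assume "sat t f F (MEx1 x \<phi>)"
      then obtain v where v: "t v \<noteq> None" "sat t (f(x := v)) F \<phi>" by auto
      then have "P (enc K t (f(x := v)) F)" using P sh gv unfolding expr_def by blast
      moreover have "enc K t (f(x := v)) F = (\<lambda>u. ?u (enc K t f F u, u = v))" using up by (rule ext)
      ultimately have "P (\<lambda>u. ?u (enc K t f F u, u = v))" by (simp only:)
      moreover have "\<exists>w\<in>lists {..<N}. \<forall>u\<in>lists {..<N}. (u = v) = (u = w)" using dl[OF v(1)] by blast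
      moreover have "\<forall>u\<in>lists {..<N}. u = v \<longrightarrow> fst (enc K t f F u) \<noteq> None" using v(1) by (simp add: enc_def)
      ultimately show "?P (enc K t f F)" by (intro exI[of _ "\<lambda>u. u = v"]) simp
    next
      assume "?P (enc K t f F)"
      then obtain \<sigma> where "(\<forall>v. \<sigma> v \<in> UNIV) \<and> ?Q (\<lambda>v. (enc K t f F v, \<sigma> v))" ..
      note q = conjunct2[OF this]
      obtain v where v: "v \<in> lists {..<N}" "\<forall>u\<in>lists {..<N}. \<sigma> u \<longleftrightarrow> u = v"
        using conjunct1[OF conjunct1[OF q]] unfolding snd_conv by blast
      note s = v conjunct2[OF conjunct1[OF q], unfolded fst_conv snd_conv] conjunct2[OF q]
      then have tv: "t v \<noteq> None" by (auto simp: enc_def)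
      have "P (\<lambda>u. ?u (enc K t f F u, \<sigma> u)) = P (enc K t (f(x := v)) F)"
      proof (rule trec_local[OF tP])
        show "?u (enc K t f F u, \<sigma> u) \<in> Al" for u using enc_Al[OF sh, of f F u] x by (auto split: if_splits)
        show "enc K t (f(x := v)) F u \<in> Al" for u using enc_Al[OF sh] .
        show "?u (enc K t f F u, \<sigma> u) = enc K t (f(x := v)) F u" if "u \<in> lists {..<N}" for u
          unfolding up using s(2) that by simp
      qed
      then have "sat t (f(x := v)) F \<phi>" using s(4) P sh gv[OF tv] unfolding expr_def by blast
      then show "sat t f F (MEx1 x \<phi>)" using tv by auto
    qed
  qed
  ultimately show "expr (MEx1 x \<phi>) ?P" unfolding expr_def by blast
qed

lemma expr_ex2:
  assumes P: "expr \<phi> P" and x: "X < K"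
  shows "\<exists>P'. expr (MEx2 X \<phi>) P'"
proof (rule exI)
  let ?u = "\<lambda>a :: (('c + nat) option \<times> nat set \<times> nat set) \<times> bool.
     (fst (fst a), fst (snd (fst a)), if snd a then insert X (snd (snd (fst a))) else snd (snd (fst a)) - {X})"
  let ?Q = "\<lambda>\<tau>. (\<forall>v\<in>lists {..<N}. snd (\<tau> v) \<longrightarrow> fst (fst (\<tau> v)) \<noteq> None) \<and> P (\<lambda>v. ?u (\<tau> v))"
  let ?P = "\<lambda>\<tau>. \<exists>\<sigma>. (\<forall>v. \<sigma> v \<in> UNIV) \<and> ?Q (\<lambda>v. (\<tau> v, \<sigma> v))"
  have fin: "finite (Al \<times> (UNIV :: bool set))" using finite_Al by simp
  have tP: "trec N Al P" using P unfolding expr_def by blast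
  have "trec N (Al \<times> UNIV) ?Q"
    by (intro trec_conj N trec_all[OF fin N, of "\<lambda>a. snd a \<longrightarrow> fst (fst a) \<noteq> None"]
        trec_map[OF tP, of _ ?u]) (use x in \<open>auto split: if_splits\<close>)
  then have "trec N Al ?P" by (rule trec_proj) simp_all
  moreover have "sat t f F (MEx2 X \<phi>) = ?P (enc K t f F)" if sh: "shape N \<Sigma> n t" and g: "good t f F" for t f F
  proof -
    have up: "enc K t f (F(X := V)) u = ?u (enc K t f F u, u \<in> V)" for u V
      using x by (auto simp: enc_def)
    have dl: "v \<in> lists {..<N}" if "t v \<noteq> None" for v using sh that unfolding shape_def by blast
    have gv: "good t f (F(X := V))" if "V \<subseteq> {v. t v \<noteq> None}" for V using g that unfolding good_def by simp
    show ?thesis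
    proof
      assume "sat t f F (MEx2 X \<phi>)"
      then obtain V where v: "V \<subseteq> {v. t v \<noteq> None}" "sat t f (F(X := V)) \<phi>" by auto
      then have "P (enc K t f (F(X := V)))" using P sh gv unfolding expr_def by blast
      moreover have "enc K t f (F(X := V)) = (\<lambda>u. ?u (enc K t f F u, u \<in> V))" using up by (rule ext)
      ultimately have "P (\<lambda>u. ?u (enc K t f F u, u \<in> V))" by (simp only:)
      moreover have "\<forall>u\<in>lists {..<N}. u \<in> V \<longrightarrow> fst (enc K t f F u) \<noteq> None" using v(1) by (auto simp: enc_def)
      ultimately show "?P (enc K t f F)" by (intro exI[of _ "\<lambda>u. u \<in> V"]) simp
    next
      assume "?P (enc K t f F)"
      then obtain \<sigma> where s: "\<forall>u\<in>lists {..<N}. \<sigma> u \<longrightarrow> fst (enc K t f F u) \<noteq> None"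
        "P (\<lambda>u. ?u (enc K t f F u, \<sigma> u))" by auto
      define V where "V = {u \<in> lists {..<N}. \<sigma> u}"
      have V: "V \<subseteq> {v. t v \<noteq> None}" using s(1) unfolding V_def by (auto simp: enc_def)
      have "P (\<lambda>u. ?u (enc K t f F u, \<sigma> u)) = P (enc K t f (F(X := V)))"
      proof (rule trec_local[OF tP])
        show "?u (enc K t f F u, \<sigma> u) \<in> Al" for u using enc_Al[OF sh, of f F u] x by (auto split: if_splits)
        show "enc K t f (F(X := V)) u \<in> Al" for u using enc_Al[OF sh] .
        show "?u (enc K t f F u, \<sigma> u) = enc K t f (F(X := V)) u" if "u \<in> lists {..<N}" for u
          unfolding up using that by (simp add: V_def)
      qed
      then have "sat t f (F(X := V)) \<phi>" using s(2) P sh gv[OF V] unfolding expr_def by blast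
      then show "sat t f F (MEx2 X \<phi>)" using V by auto
    qed
  qed
  ultimately show "expr (MEx2 X \<phi>) ?P" unfolding expr_def by blast
qed

lemma expr_ex: "vmax \<phi> \<le> K \<Longrightarrow> \<exists>P. expr \<phi> P"
proof (induction \<phi>)
  case (MLeq x y) then show ?case by (intro expr_leq) auto
next
  case (MSucc i x y) then show ?case by (intro expr_succ) auto
next
  case (MLab c x) then show ?case by (intro expr_atomic(1)[of x x]) auto
next
  case (MQ i x) then show ?case by (intro expr_atomic(2)[of x x]) auto
next
  case (MRoot x) then show ?case by (intro expr_atomic(3)[of x x]) auto
next
  case (MEq x y) then show ?case by (intro expr_atomic) auto
next
  case (MMem x X) then show ?case by (intro expr_atomic) auto
next
  case (MNeg \<phi>) then show ?case using expr_neg by fastforce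
next
  case (MConj \<phi> \<psi>) then show ?case using expr_conj by fastforce
next
  case (MEx1 x \<phi>)
  then obtain P where "expr \<phi> P" by auto
  then show ?case using MEx1.prems by (intro expr_ex1) auto
next
  case (MEx2 X \<phi>)
  then obtain P where "expr \<phi> P" by auto
  then show ?case using MEx2.prems by (intro expr_ex2) auto
qed

end

text \<open>\<open>models\<close> fixes a valuation, with all first-order variables at the root and
  all set variables empty. Its marks are guessed and checked by a safety condition, which leaves an
  automaton over the tree labels alone.\<close>

theorem sentence_trec:
  fixes \<Sigma> :: "'c set"
  assumes \<Sigma>: "finite \<Sigma>" and N: "0 < N"
  shows "\<exists>P. trec N (labels \<Sigma> n) P \<and> (\<forall>t. shape N \<Sigma> n t \<longrightarrow> t [] \<noteq> None \<longrightarrow> sat t (\<lambda>_. []) (\<lambda>_. {}) \<phi> = P t)"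
proof -
  define K where "K = vmax \<phi>"
  let ?B = "Pow {..<K} \<times> Pow {..<K}"
  have finB: "finite ?B" by simp
  obtain P where P: "expr \<Sigma> n N K \<phi> P" using expr_ex[OF \<Sigma> N, of \<phi> K n] unfolding K_def by auto
  then have tP: "trec N (labels \<Sigma> n \<times> ?B) P" unfolding expr_def[OF \<Sigma> N] by blast
  let ?S = "\<lambda>\<tau> :: nat list \<Rightarrow> ('c + nat) option \<times> nat set \<times> nat set.
     snd (\<tau> []) = ({..<K}, {}) \<and> (\<forall>v\<in>lists {..<N}. \<forall>d<N. snd (\<tau> (v @ [d])) = ({}, {}))"
  let ?P = "\<lambda>\<tau>. \<exists>\<sigma>. (\<forall>v. \<sigma> v \<in> ?B) \<and> (?S (\<lambda>v. (\<tau> v, \<sigma> v)) \<and> P (\<lambda>v. (\<tau> v, \<sigma> v)))"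
  have "finite (labels \<Sigma> n \<times> ?B)" using finite_Al[OF \<Sigma> N] .
  from trec_safe[OF this N, of "\<lambda>a. snd a = ({..<K}, {})" "\<lambda>_ _ b. snd b = ({}, {})"]
  have tS: "trec N (labels \<Sigma> n \<times> ?B) ?S" .
  have "trec N (labels \<Sigma> n) ?P"
    by (rule trec_proj[OF trec_conj[OF tS tP N] finB]) auto
  moreover have "sat t (\<lambda>_. []) (\<lambda>_. {}) \<phi> = ?P t" if sh: "shape N \<Sigma> n t" and r: "t [] \<noteq> None" for t
  proof -
    define s :: "nat list \<Rightarrow> nat set \<times> nat set" where "s v = (if v = [] then ({..<K}, {}) else ({}, {}))" for v
    have e: "enc K t (\<lambda>_. []) (\<lambda>_. {}) = (\<lambda>v. (t v, s v))" by (auto simp: enc_def s_def)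
    have "good t (\<lambda>_. []) (\<lambda>_. {})" using r by (simp add: good_def)
    then have sat: "sat t (\<lambda>_. []) (\<lambda>_. {}) \<phi> = P (\<lambda>v. (t v, s v))"
      using P sh unfolding expr_def[OF \<Sigma> N] e[symmetric] by blast
    have sB: "s v \<in> ?B" for v by (simp add: s_def)
    have lab: "t v \<in> labels \<Sigma> n" for v using sh unfolding shape_def by blast
    show ?thesis
    proof
      assume "sat t (\<lambda>_. []) (\<lambda>_. {}) \<phi>"
      then show "?P t" using sat sB by (intro exI[of _ s]) (simp add: s_def)
    next
      assume "?P t"
      then obtain \<sigma> where \<sigma>: "\<And>v. \<sigma> v \<in> ?B" "\<sigma> [] = ({..<K}, {})" "\<forall>v\<in>lists {..<N}. \<forall>d<N. \<sigma> (v @ [d]) = ({}, {})"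
        "P (\<lambda>v. (t v, \<sigma> v))" by auto
      have "P (\<lambda>v. (t v, \<sigma> v)) = P (\<lambda>v. (t v, s v))"
      proof (rule trec_local[OF tP])
        show "(t v, \<sigma> v) = (t v, s v)" if "v \<in> lists {..<N}" for v
        proof (cases v rule: rev_cases)
          case (snoc u d)
          then show ?thesis using \<sigma>(3) that by (auto simp: s_def)
        qed (use \<sigma>(2) in \<open>simp add: s_def\<close>)
      qed (use lab \<sigma>(1) sB in \<open>auto simp del: Pow_iff\<close>)
      then show "sat t (\<lambda>_. []) (\<lambda>_. {}) \<phi>" using sat \<sigma>(4) by simp
    qed
  qed
  ultimately show ?thesis by blast
qed

section \<open>Flattening\<close>

lemma wf_prefix:
  assumes t: "wf_tree b ar A n t" and d: "snd t (p @ z) \<noteq> None"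
  shows "snd t p \<noteq> None" "z \<noteq> [] \<Longrightarrow> \<exists>a\<in>A. snd t p = Some (Inl a) \<and> hd z < ar a"
proof -
  have cl: "snd t (v @ [i]) \<noteq> None \<Longrightarrow> snd t v \<noteq> None" for v i using t unfolding wf_tree_def by blast
  have pc: "snd t (p @ z) \<noteq> None \<Longrightarrow> snd t p \<noteq> None" for p z
  proof (induction z rule: rev_induct)
    case (snoc i z)
    then show ?case using cl[of "p @ z" i] by simp
  qed simp
  then show "snd t p \<noteq> None" using d by blast
  assume z: "z \<noteq> []"
  then have "snd t (p @ [hd z]) \<noteq> None" using pc[of "p @ [hd z]" "tl z"] d by simp
  then show "\<exists>a\<in>A. snd t p = Some (Inl a) \<and> hd z < ar a"
    using t cl[of p "hd z"] unfolding wf_tree_def by (metis not_Some_eq sum.exhaust)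
qed

lemma wf_Inl: "wf_tree b ar A n t \<Longrightarrow> snd t v = Some (Inl a) \<Longrightarrow> a \<in> A \<and> (snd t (v @ [i]) \<noteq> None \<longleftrightarrow> i < ar a)"
  unfolding wf_tree_def by blast

lemma wf_Inr: "wf_tree b ar A n t \<Longrightarrow> snd t v = Some (Inr j) \<Longrightarrow> j < n \<and> snd t (v @ [i]) = None"
  unfolding wf_tree_def by blast

lemma wf_root: "wf_tree b ar A n t \<Longrightarrow> \<exists>a. snd t [] = Some (Inl a)"
  unfolding wf_tree_def by blast

lemma wf_None: "wf_tree b ar A n t \<Longrightarrow> snd t v = None \<Longrightarrow> snd t (v @ z) = None"
  using wf_prefix(1) by metis

text \<open>Linearity is dropped, so that the trees of trees of both monads are covered at
  once.\<close>

definition mmwf :: "('c \<Rightarrow> nat) \<Rightarrow> 'c set \<Rightarrow> nat \<Rightarrow> 'c tr tr \<Rightarrow> bool" where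
  "mmwf ar \<Sigma> n S \<longleftrightarrow> wf_tree False fst {t. wf_tree False ar \<Sigma> (fst t) t} n S"

lemma MMtrees_mmwf:
  assumes "S \<in> MMtrees TTimes ar \<Sigma> n"
  shows "mmwf ar \<Sigma> n S"
proof -
  have "wf_tree False fst (\<Union>k. Mtrees TTimes ar \<Sigma> k) n S"
    using assms unfolding MMtrees_def Mtrees_def by simp
  moreover have "(\<Union>k. Mtrees TTimes ar \<Sigma> k) = {t. wf_tree False ar \<Sigma> (fst t) t}"
    unfolding Mtrees_def wf_tree_def by auto
  ultimately show ?thesis unfolding mmwf_def by simp
qed

lemma mm_label:
  assumes "mmwf ar \<Sigma> n S" "snd S v = Some (Inl s)"
  shows "wf_tree False ar \<Sigma> (fst s) s"
  using wf_Inl[of False fst] assms unfolding mmwf_def by blast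

text \<open>Positions of a flattened tree: an outer vertex together with an address in its label, where
  a variable leaf is identified with the root of the tree substituted for it.\<close>

definition lstep :: "'c tr tr \<Rightarrow> nat list \<times> nat list \<Rightarrow> nat \<Rightarrow> nat list \<times> nat list" where
  "lstep S x i = (case snd S (fst x) of
     Some (Inl s) \<Rightarrow> (case snd s (snd x @ [i]) of
        Some (Inr j) \<Rightarrow> (case snd S (fst x @ [j]) of Some (Inl _) \<Rightarrow> (fst x @ [j], []) | _ \<Rightarrow> (fst x, snd x @ [i]))
      | _ \<Rightarrow> (fst x, snd x @ [i]))
   | _ \<Rightarrow> (fst x, snd x @ [i]))"

definition llab :: "'c tr tr \<Rightarrow> nat list \<times> nat list \<Rightarrow> ('c + nat) option" where
  "llab S x = (case snd S (fst x) of
     Some (Inl s) \<Rightarrow> (case snd s (snd x) of None \<Rightarrow> None | Some (Inl c) \<Rightarrow> Some (Inl c)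
       | Some (Inr j) \<Rightarrow> (case snd S (fst x @ [j]) of Some (Inr l) \<Rightarrow> Some (Inr l) | _ \<Rightarrow> None))
   | _ \<Rightarrow> None)"

definition loc :: "'c tr tr \<Rightarrow> nat list \<Rightarrow> nat list \<times> nat list" where
  "loc S w = foldl (lstep S) ([], []) w"

text \<open>Normal positions never rest on a variable leaf behind which a tree is substituted. A
  leaf whose variable becomes a variable of the whole tree stays where it is.\<close>

definition nrm :: "'c tr tr \<Rightarrow> nat list \<times> nat list \<Rightarrow> bool" where
  "nrm S x \<longleftrightarrow> (\<exists>s. snd S (fst x) = Some (Inl s) \<and>
     (\<forall>j s'. snd s (snd x) = Some (Inr j) \<longrightarrow> snd S (fst x @ [j]) \<noteq> Some (Inl s')))"

lemma loc_Nil [simp]: "loc S [] = ([], [])"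
  by (simp add: loc_def)

lemma loc_snoc: "loc S (w @ [i]) = lstep S (loc S w) i"
  by (simp add: loc_def)

context
  fixes ar :: "'c \<Rightarrow> nat" and \<Sigma> :: "'c set" and n :: nat and S :: "'c tr tr"
  assumes S: "mmwf ar \<Sigma> n S"
begin

lemma S_var:
  assumes "snd S v = Some (Inl s)" "snd s u = Some (Inr j)"
  shows "(\<exists>s'. snd S (v @ [j]) = Some (Inl s')) \<or> (\<exists>l<n. snd S (v @ [j]) = Some (Inr l))"
proof -
  have "j < fst s" using wf_Inr[OF mm_label[OF S assms(1)] assms(2)] by blast
  then have "snd S (v @ [j]) \<noteq> None" using wf_Inl[OF S[unfolded mmwf_def] assms(1), of j] by blast
  then obtain y where "snd S (v @ [j]) = Some y" by blast
  then show ?thesis using wf_Inr[OF S[unfolded mmwf_def]] by (cases y) auto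
qed

lemma lstep_nrm:
  assumes "nrm S x"
  shows "nrm S (lstep S x i)"
proof -
  obtain s where s: "snd S (fst x) = Some (Inl s)" using assms unfolding nrm_def by blast
  show ?thesis
  proof (cases "\<exists>j s'. snd s (snd x @ [i]) = Some (Inr j) \<and> snd S (fst x @ [j]) = Some (Inl s')")
    case True
    then obtain j s' where j: "snd s (snd x @ [i]) = Some (Inr j)" "snd S (fst x @ [j]) = Some (Inl s')" by blast
    then have "lstep S x i = (fst x @ [j], [])" using s by (simp add: lstep_def)
    \<comment> \<open>One jump suffices, because the root of a substituted tree carries a
      letter.\<close>
    then show ?thesis using j wf_root[OF mm_label[OF S j(2)]] by (auto simp: nrm_def)
  next
    case False
    then have "lstep S x i = (fst x, snd x @ [i])" using s
      by (auto simp: lstep_def split: option.splits sum.splits)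
    then show ?thesis using s False by (auto simp: nrm_def)
  qed
qed

lemma foldl_nrm: "nrm S x \<Longrightarrow> nrm S (foldl (lstep S) x w)"
  by (induction w arbitrary: x) (simp_all add: lstep_nrm)

lemma nrm_root: "nrm S ([], [])"
proof -
  obtain s where s: "snd S [] = Some (Inl s)" using wf_root[OF S[unfolded mmwf_def]] by blast
  then show ?thesis using wf_root[OF mm_label[OF S s]] by (auto simp: nrm_def)
qed

lemma loc_nrm: "nrm S (loc S w)"
  unfolding loc_def by (rule foldl_nrm[OF nrm_root])

lemma llab_None_fold:
  assumes s: "snd S v = Some (Inl s)" and "snd s u = None"
  shows "llab S (foldl (lstep S) (v, u) w) = None"
  using assms(2)
proof (induction w arbitrary: u)
  case Nil
  then show ?case using s by (simp add: llab_def)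
next
  case (Cons i w)
  have "snd s (u @ [i]) = None" using wf_None[OF mm_label[OF S s] Cons.prems] .
  then show ?case using Cons.IH s by (simp add: lstep_def)
qed

text \<open>Each letter of \<open>w\<close> costs at most two units of fuel, one for the step and
  one for a jump into a substituted tree, and one more unit reads the final label.\<close>

lemma flk_llab:
  assumes "nrm S (v, u)" "2 * length w + 1 \<le> f"
  shows "flk f S v u w = llab S (foldl (lstep S) (v, u) w)"
  using assms
proof (induction w arbitrary: v u f)
  case Nil
  obtain s where s: "snd S v = Some (Inl s)" and nr: "\<And>j s'. snd s u = Some (Inr j) \<Longrightarrow> snd S (v @ [j]) \<noteq> Some (Inl s')"
    using Nil(1) unfolding nrm_def by auto
  obtain g where f: "f = Suc g" using Nil(2) by (cases f) auto
  show ?case using s nr unfolding f by (auto simp: llab_def split: option.splits sum.splits)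
next
  case (Cons i w)
  obtain s where s: "snd S v = Some (Inl s)" and nr: "\<And>j s'. snd s u = Some (Inr j) \<Longrightarrow> snd S (v @ [j]) \<noteq> Some (Inl s')"
    using Cons(2) unfolding nrm_def by auto
  have ws: "wf_tree False ar \<Sigma> (fst s) s" by (rule mm_label[OF S s])
  obtain g where f: "f = Suc g" and g: "2 * length w + 2 \<le> g" using Cons(3) by (cases f) auto
  have n': "nrm S (lstep S (v, u) i)" by (rule lstep_nrm[OF Cons(2)])
  consider "snd s u = None" | j where "snd s u = Some (Inr j)" | c where "snd s u = Some (Inl c)"
    by (metis not_Some_eq sum.exhaust)
  then show ?case
  proof cases
    case 1
    then show ?thesis using llab_None_fold[OF s 1, of "i # w"] s unfolding f by simp
  next
    case 2
    have none: "snd s (u @ [i]) = None" using wf_Inr[OF ws 2] by blast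
    then have "foldl (lstep S) (v, u) (i # w) = foldl (lstep S) (v, u @ [i]) w" using s by (simp add: lstep_def)
    then have "llab S (foldl (lstep S) (v, u) (i # w)) = None" using llab_None_fold[OF s none] by simp
    moreover have "flk f S v u (i # w) = None" unfolding f using s 2 nr
      by (auto split: option.splits sum.splits)
    ultimately show ?thesis by simp
  next
    case 3
    have fl: "flk f S v u (i # w) = flk g S v (u @ [i]) w" unfolding f using s 3 by simp
    show ?thesis
    proof (cases "\<exists>j s'. snd s (u @ [i]) = Some (Inr j) \<and> snd S (v @ [j]) = Some (Inl s')")
      case True
      then obtain j s' where j: "snd s (u @ [i]) = Some (Inr j)" "snd S (v @ [j]) = Some (Inl s')" by blast
      then have st: "lstep S (v, u) i = (v @ [j], [])" using s by (simp add: lstep_def)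
      obtain h where h: "g = Suc h" using g by (cases g) auto
      have "flk g S v (u @ [i]) w = flk h S (v @ [j]) [] w" unfolding h using s j by simp
      also have "\<dots> = llab S (foldl (lstep S) (v @ [j], []) w)"
        by (rule Cons.IH) (use n' st g h in auto)
      finally show ?thesis unfolding fl using st by simp
    next
      case False
      then have st: "lstep S (v, u) i = (v, u @ [i])" using s
        by (auto simp: lstep_def split: option.splits sum.splits)
      have "flk g S v (u @ [i]) w = llab S (foldl (lstep S) (v, u @ [i]) w)"
        by (rule Cons.IH) (use n' st g in auto)
      then show ?thesis unfolding fl using st by simp
    qed
  qed
qed

lemma flat_lab: "snd (flat S) w = llab S (loc S w)"
  unfolding flat_def loc_def snd_conv by (rule flk_llab[OF nrm_root]) simp

lemma lstep_cases:
  assumes s: "snd S v = Some (Inl s)" and d: "snd s (u @ [i]) = Some (Inr j)" and s': "snd S (v @ [j]) = Some (Inl s')"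
  shows "lstep S (v, u) i = (v @ [j], [])"
  using assms by (simp add: lstep_def)

lemma lstep_stay:
  assumes s: "snd S v = Some (Inl s)" and d: "\<And>j s'. snd s (u @ [i]) = Some (Inr j) \<Longrightarrow> snd S (v @ [j]) \<noteq> Some (Inl s')"
  shows "lstep S (v, u) i = (v, u @ [i])"
  using assms by (auto simp: lstep_def split: option.splits sum.splits)

lemma llab_lstep:
  assumes s: "snd S v = Some (Inl s)"
  shows "llab S (lstep S (v, u) i) \<noteq> None \<longleftrightarrow> snd s (u @ [i]) \<noteq> None"
proof (cases "\<exists>j s'. snd s (u @ [i]) = Some (Inr j) \<and> snd S (v @ [j]) = Some (Inl s')")
  case True
  then obtain j s' where j: "snd s (u @ [i]) = Some (Inr j)" "snd S (v @ [j]) = Some (Inl s')" by blast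
  then show ?thesis using lstep_cases[OF s j] wf_root[OF mm_label[OF S j(2)]] by (auto simp: llab_def)
next
  case False
  then have "lstep S (v, u) i = (v, u @ [i])" using lstep_stay[OF s] by blast
  moreover have "\<exists>l<n. snd S (v @ [j]) = Some (Inr l)" if "snd s (u @ [i]) = Some (Inr j)" for j
    using S_var[OF s that] False that by blast
  ultimately show ?thesis using s by (fastforce simp: llab_def split: option.splits sum.splits)
qed

lemma loc_ex:
  obtains v u s where "loc S w = (v, u)" "snd S v = Some (Inl s)" "wf_tree False ar \<Sigma> (fst s) s"
proof -
  obtain v u where vu: "loc S w = (v, u)" by (cases "loc S w")
  then obtain s where "snd S v = Some (Inl s)" using loc_nrm[of w] unfolding nrm_def by auto
  then show thesis using that vu mm_label[OF S] by blast
qed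

lemma flat_Inl:
  assumes "loc S w = (v, u)" "snd S v = Some (Inl s)"
  shows "snd (flat S) w = Some (Inl c) \<longleftrightarrow> snd s u = Some (Inl c)"
  using assms unfolding flat_lab by (auto simp: llab_def split: option.splits sum.splits)

lemma flat_Inr:
  assumes "loc S w = (v, u)" "snd S v = Some (Inl s)"
  shows "snd (flat S) w = Some (Inr l) \<longleftrightarrow> (\<exists>j. snd s u = Some (Inr j) \<and> snd S (v @ [j]) = Some (Inr l))"
  using assms unfolding flat_lab by (auto simp: llab_def split: option.splits sum.splits)

lemma flat_child:
  assumes "loc S w = (v, u)" "snd S v = Some (Inl s)"
  shows "snd (flat S) (w @ [i]) \<noteq> None \<longleftrightarrow> snd s (u @ [i]) \<noteq> None"
  unfolding flat_lab loc_snoc assms(1) by (rule llab_lstep[OF assms(2)])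

lemma flat_wf: "wf_tree False ar \<Sigma> n (flat S)"
  unfolding wf_tree_def
proof (intro conjI allI impI)
  show "fst (flat S) = n" using S unfolding mmwf_def wf_tree_def flat_def by simp
  obtain s where s: "snd S [] = Some (Inl s)" using wf_root[OF S[unfolded mmwf_def]] by blast
  then show "\<exists>a. snd (flat S) [] = Some (Inl a)" using wf_root[OF mm_label[OF S s]] flat_Inl[OF loc_Nil s] by blast
next
  fix w i assume ne: "snd (flat S) (w @ [i]) \<noteq> None"
  show "snd (flat S) w \<noteq> None"
  proof (rule loc_ex[of w])
    fix v u s assume l: "loc S w = (v, u)" "snd S v = Some (Inl s)" and ws: "wf_tree False ar \<Sigma> (fst s) s"
    have "snd s (u @ [i]) \<noteq> None" using flat_child[OF l] ne by blast
    then obtain a where "snd s u = Some (Inl a)" using wf_prefix(2)[OF ws, of u "[i]"] by auto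
    then have "snd (flat S) w = Some (Inl a)" using flat_Inl[OF l] by blast
    then show ?thesis by simp
  qed
next
  fix w a i assume a: "snd (flat S) w = Some (Inl a)"
  {
    fix v u s assume l: "loc S w = (v, u)" "snd S v = Some (Inl s)" and ws: "wf_tree False ar \<Sigma> (fst s) s"
    have "snd s u = Some (Inl a)" using a flat_Inl[OF l] by simp
    then have "a \<in> \<Sigma> \<and> (snd (flat S) (w @ [i]) \<noteq> None \<longleftrightarrow> i < ar a)" using wf_Inl[OF ws] flat_child[OF l] by blast
  }
  then have "a \<in> \<Sigma> \<and> (snd (flat S) (w @ [i]) \<noteq> None \<longleftrightarrow> i < ar a)" using loc_ex[of w] by metis
  then show "a \<in> \<Sigma>" "(snd (flat S) (w @ [i]) \<noteq> None) = (i < ar a)" by blast+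
next
  fix w l i assume a: "snd (flat S) w = Some (Inr l)"
  {
    fix v u s assume lo: "loc S w = (v, u)" "snd S v = Some (Inl s)" and ws: "wf_tree False ar \<Sigma> (fst s) s"
    obtain j where j: "snd s u = Some (Inr j)" "snd S (v @ [j]) = Some (Inr l)" using a flat_Inr[OF lo] by blast
    have "l < n" using wf_Inr[OF S[unfolded mmwf_def] j(2)] by blast
    moreover have "snd (flat S) (w @ [i]) = None" using wf_Inr[OF ws j(1)] flat_child[OF lo] by blast
    ultimately have "l < n \<and> snd (flat S) (w @ [i]) = None" by blast
  }
  then have "l < n \<and> snd (flat S) (w @ [i]) = None" using loc_ex[of w] by metis
  then show "l < n" "snd (flat S) (w @ [i]) = None" by blast+
qed simp

text \<open>All proper prefixes of \<open>u\<close> carry letters of \<open>s\<close>, so the walk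
  from the root of a component stays inside it until the last step, where it may jump.\<close>

lemma loc_component:
  assumes w: "loc S w = (v, [])" and s: "snd S v = Some (Inl s)" and u: "snd s u \<noteq> None"
  shows "(\<forall>j s'. snd s u = Some (Inr j) \<longrightarrow> snd S (v @ [j]) \<noteq> Some (Inl s')) \<Longrightarrow> loc S (w @ u) = (v, u)"
    and "snd s u = Some (Inr j) \<Longrightarrow> snd S (v @ [j]) = Some (Inl s') \<Longrightarrow> loc S (w @ u) = (v @ [j], [])"
proof -
  have ws: "wf_tree False ar \<Sigma> (fst s) s" by (rule mm_label[OF S s])
  have inner: "loc S (w @ p) = (v, p)" if "snd s p = Some (Inl a)" for p a
    using that
  proof (induction p arbitrary: a rule: rev_induct)
    case (snoc i p)
    obtain b where "snd s p = Some (Inl b)" using wf_prefix(2)[OF ws, of p "[i]"] snoc.prems by auto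
    then have "loc S (w @ p) = (v, p)" using snoc.IH by blast
    moreover have "lstep S (v, p) i = (v, p @ [i])" by (rule lstep_stay[OF s]) (use snoc.prems in simp)
    ultimately show ?case using loc_snoc[of S "w @ p" i] by simp
  qed (simp add: w)
  have one: "loc S (w @ u) = (if u = [] then (v, []) else lstep S (v, butlast u) (last u))"
  proof (cases u rule: rev_cases)
    case (snoc p i)
    obtain b where "snd s p = Some (Inl b)" using wf_prefix(2)[OF ws, of p "[i]"] snoc u by auto
    then show ?thesis using inner[of p b] loc_snoc[of S "w @ p" i] snoc by simp
  qed (simp add: w)
  show "loc S (w @ u) = (v, u)" if "\<forall>j s'. snd s u = Some (Inr j) \<longrightarrow> snd S (v @ [j]) \<noteq> Some (Inl s')"
  proof (cases u rule: rev_cases)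
    case (snoc p i)
    then show ?thesis using one lstep_stay[OF s, of p i] that by simp
  qed (simp add: w)
  show "loc S (w @ u) = (v @ [j], [])" if "snd s u = Some (Inr j)" "snd S (v @ [j]) = Some (Inl s')"
  proof (cases u rule: rev_cases)
    case Nil
    then show ?thesis using wf_root[OF ws] that by simp
  next
    case (snoc p i)
    then show ?thesis using one lstep_cases[OF s, of p i j s'] that by simp
  qed
qed

lemma flat_component:
  assumes w: "loc S w = (v, [])" and s: "snd S v = Some (Inl s)"
  shows "snd s u = Some (Inl c) \<Longrightarrow> snd (flat S) (w @ u) = Some (Inl c)"
    and "snd s u \<noteq> None \<Longrightarrow> snd (flat S) (w @ u) \<noteq> None"
    and "snd s u = Some (Inr j) \<Longrightarrow> snd S (v @ [j]) = Some (Inr l) \<Longrightarrow> snd (flat S) (w @ u) = Some (Inr l)"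
proof -
  show k1: "snd (flat S) (w @ u) = Some (Inl c)" if "snd s u = Some (Inl c)" for c
    using flat_Inl[OF loc_component(1)[OF w s] s] that by simp
  show k2: "snd (flat S) (w @ u) = Some (Inr l)" if "snd s u = Some (Inr j)" "snd S (v @ [j]) = Some (Inr l)" for j l
    using flat_Inr[OF loc_component(1)[OF w s] s] that by simp
  show "snd (flat S) (w @ u) \<noteq> None" if "snd s u \<noteq> None"
  proof -
    consider c where "snd s u = Some (Inl c)" | j where "snd s u = Some (Inr j)" using \<open>snd s u \<noteq> None\<close>
      by (metis not_Some_eq sum.exhaust)
    then show ?thesis
    proof cases
      case 2
      then show ?thesis
      proof (cases "\<exists>s'. snd S (v @ [j]) = Some (Inl s')")
        case True
        then obtain s' where s': "snd S (v @ [j]) = Some (Inl s')" by blast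
        obtain a where "snd s' [] = Some (Inl a)" using wf_root[OF mm_label[OF S s']] by blast
        then show ?thesis using flat_Inl[OF loc_component(2)[OF w s _ 2 s'] s', of a] 2 by simp
      next
        case False
        then obtain l where "snd S (v @ [j]) = Some (Inr l)" using S_var[OF s 2] by blast
        then show ?thesis using k2[OF 2] by simp
      qed
    qed (use k1 in simp)
  qed
qed

end

section \<open>Partial runs\<close>

definition nst :: "('q \<Rightarrow> 'l \<times> 'r \<times> nat \<Rightarrow> 'q) \<Rightarrow> 'q \<Rightarrow> (nat list \<Rightarrow> 'l) \<Rightarrow> (nat list \<Rightarrow> 'r) \<Rightarrow> nat list \<Rightarrow> 'q" where
  "nst \<delta> q \<tau> \<rho> v = tst \<delta> q \<tau> (\<lambda>v _. \<rho> v) (rev v)"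

text \<open>The state at \<open>v\<close> itself is not counted: at a variable leaf it is the
  initial state of the next component and is counted there. The maximum of no priorities is
  0.\<close>

definition nmx :: "('q \<Rightarrow> 'l \<times> 'r \<times> nat \<Rightarrow> 'q) \<Rightarrow> ('q \<Rightarrow> nat) \<Rightarrow> 'q \<Rightarrow> (nat list \<Rightarrow> 'l) \<Rightarrow> (nat list \<Rightarrow> 'r) \<Rightarrow> nat list \<Rightarrow> nat" where
  "nmx \<delta> pr q \<tau> \<rho> v = foldl max 0 (map (\<lambda>i. pr (nst \<delta> q \<tau> \<rho> (take i v))) [0..<length v])"

lemma nst_Nil [simp]: "nst \<delta> q \<tau> \<rho> [] = q"
  by (simp add: nst_def)

lemma nst_snoc: "nst \<delta> q \<tau> \<rho> (v @ [d]) = \<delta> (nst \<delta> q \<tau> \<rho> v) (\<tau> v, \<rho> v, d)"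
  by (simp add: nst_def)

lemma nmx_Nil [simp]: "nmx \<delta> pr q \<tau> \<rho> [] = 0"
  by (simp add: nmx_def)

lemma nmx_snoc: "nmx \<delta> pr q \<tau> \<rho> (v @ [d]) = max (nmx \<delta> pr q \<tau> \<rho> v) (pr (nst \<delta> q \<tau> \<rho> v))"
proof -
  have "map (\<lambda>i. pr (nst \<delta> q \<tau> \<rho> (take i (v @ [d])))) [0..<length v] = map (\<lambda>i. pr (nst \<delta> q \<tau> \<rho> (take i v))) [0..<length v]"
    by (intro map_cong refl) auto
  moreover have "take (length v) (v @ [d]) = v" by simp
  ultimately show ?thesis unfolding nmx_def by (simp del: take_append map_eq_conv)
qed

lemma nst_run: "drun \<delta> q (tword \<tau> \<rho> \<pi>) i = nst \<delta> q \<tau> \<rho> (pre \<pi> i)"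
  using tst_run[of \<delta> q \<tau> "\<lambda>v _. \<rho> v" \<pi> i] by (simp add: nst_def)

text \<open>A state depends on labels at proper prefixes only. Hence it is the same whether
  \<open>v\<close> is a variable leaf of a component or, in the flattening, the root of what is
  substituted there.\<close>

lemma nst_cong:
  assumes "\<And>p z. v = p @ z \<Longrightarrow> z \<noteq> [] \<Longrightarrow> \<tau> p = \<tau>' p \<and> \<rho> p = \<rho>' p"
  shows "nst \<delta> q \<tau> \<rho> v = nst \<delta> q \<tau>' \<rho>' v"
  using assms
proof (induction v rule: rev_induct)
  case (snoc d v)
  have "nst \<delta> q \<tau> \<rho> v = nst \<delta> q \<tau>' \<rho>' v"
  proof (rule snoc.IH)
    fix p z assume "v = p @ z" "z \<noteq> []"
    then show "\<tau> p = \<tau>' p \<and> \<rho> p = \<rho>' p" using snoc.prems[of p "z @ [d]"] by simp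
  qed
  moreover have "\<tau> v = \<tau>' v \<and> \<rho> v = \<rho>' v" using snoc.prems[of v "[d]"] by simp
  ultimately show ?case by (simp add: nst_snoc)
qed simp

lemma nmx_cong:
  assumes "\<And>p z. v = p @ z \<Longrightarrow> z \<noteq> [] \<Longrightarrow> \<tau> p = \<tau>' p \<and> \<rho> p = \<rho>' p"
  shows "nmx \<delta> pr q \<tau> \<rho> v = nmx \<delta> pr q \<tau>' \<rho>' v"
  using assms
proof (induction v rule: rev_induct)
  case (snoc d v)
  have c: "\<tau> p = \<tau>' p \<and> \<rho> p = \<rho>' p" if "v = p @ z" "z \<noteq> []" for p z
    using snoc.prems[of p "z @ [d]"] that by simp
  have "nmx \<delta> pr q \<tau> \<rho> v = nmx \<delta> pr q \<tau>' \<rho>' v" by (rule snoc.IH[OF c])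
  moreover have "nst \<delta> q \<tau> \<rho> v = nst \<delta> q \<tau>' \<rho>' v" by (rule nst_cong[OF c])
  ultimately show ?case by (simp add: nmx_snoc)
qed simp

lemma nst_append: "nst \<delta> q \<tau> \<rho> (w @ v) = nst \<delta> (nst \<delta> q \<tau> \<rho> w) (\<lambda>u. \<tau> (w @ u)) (\<lambda>u. \<rho> (w @ u)) v"
proof (induction v rule: rev_induct)
  case (snoc d v)
  then show ?case using nst_snoc[of \<delta> q \<tau> \<rho> "w @ v" d] by (simp add: nst_snoc)
qed simp

lemma nmx_append: "nmx \<delta> pr q \<tau> \<rho> (w @ v)
   = max (nmx \<delta> pr q \<tau> \<rho> w) (nmx \<delta> pr (nst \<delta> q \<tau> \<rho> w) (\<lambda>u. \<tau> (w @ u)) (\<lambda>u. \<rho> (w @ u)) v)"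
proof (induction v rule: rev_induct)
  case (snoc d v)
  then show ?case using nmx_snoc[of \<delta> pr q \<tau> \<rho> "w @ v" d] by (simp add: nmx_snoc nst_append max.assoc)
qed simp

lemma nmx_le:
  assumes "\<And>q. pr q \<le> M"
  shows "nmx \<delta> pr q \<tau> \<rho> v \<le> M"
  by (induction v rule: rev_induct) (simp_all add: nmx_snoc assms)

lemma nmx_Max:
  "v \<noteq> [] \<Longrightarrow> nmx \<delta> pr q \<tau> \<rho> v = Max ((\<lambda>x. pr (nst \<delta> q \<tau> \<rho> (take x v))) ` {0..<length v})"
proof (induction v rule: rev_induct)
  case (snoc d v)
  let ?f = "\<lambda>x. pr (nst \<delta> q \<tau> \<rho> (take x v))"
  have im: "(\<lambda>x. pr (nst \<delta> q \<tau> \<rho> (take x (v @ [d])))) ` {0..<length (v @ [d])} = insert (pr (nst \<delta> q \<tau> \<rho> v)) (?f ` {0..<length v})"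
  proof -
    have "{0..<length (v @ [d])} = insert (length v) {0..<length v}" by auto
    moreover have "(\<lambda>x. pr (nst \<delta> q \<tau> \<rho> (take x (v @ [d])))) ` {0..<length v} = ?f ` {0..<length v}"
      by (intro image_cong refl) simp
    ultimately show ?thesis by (simp only: image_insert) simp
  qed
  show ?case
  proof (cases "v = []")
    case True
    then show ?thesis using im nmx_snoc[of \<delta> pr q \<tau> \<rho> "[]" d] by simp
  next
    case False
    have "finite (?f ` {0..<length v})" "?f ` {0..<length v} \<noteq> {}" using False by auto
    then have "Max (insert (pr (nst \<delta> q \<tau> \<rho> v)) (?f ` {0..<length v})) = max (pr (nst \<delta> q \<tau> \<rho> v)) (Max (?f ` {0..<length v}))"
      by (rule Max_insert)
    then show ?thesis unfolding im nmx_snoc using snoc.IH[OF False] by (simp add: max.commute)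
  qed
qed simp

lemma image_shift: "f ` {a..<a + n} = (\<lambda>y. f (a + y)) ` {0..<n :: nat}"
proof -
  have "{a..<a + n} = (+) a ` {0..<n}" by (simp add: add.commute)
  then show ?thesis by (simp only: image_image)
qed

lemma limit_branch:
  fixes A :: "nat \<Rightarrow> nat list"
  assumes A: "\<And>i. \<exists>z. z \<noteq> [] \<and> A (Suc i) = A i @ z"
  shows "\<exists>\<pi>. \<forall>i. pre \<pi> (length (A i)) = A i" "strict_mono (\<lambda>i. length (A i))"
proof -
  have "length (A i) < length (A (Suc i))" for i using A[of i] by auto
  then show m: "strict_mono (\<lambda>i. length (A i))" by (simp add: strict_mono_Suc_iff)
  have ext: "\<exists>z. A (i + k) = A i @ z" for i k
  proof (induction k)
    case (Suc k)
    then show ?case using A[of "i + k"] by auto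
  qed simp
  have nth: "A j ! x = A i ! x" if "x < length (A i)" "x < length (A j)" for i j x
  proof (cases "i \<le> j")
    case True
    then obtain z where "A j = A i @ z" using ext[of i "j - i"] by auto
    then show ?thesis using that by (simp add: nth_append)
  next
    case False
    then obtain z where "A i = A j @ z" using ext[of j "i - j"] by auto
    then show ?thesis using that by (simp add: nth_append)
  qed
  \<comment> \<open>\<open>A (Suc x)\<close> has more than \<open>x\<close> entries, since the
    lengths grow strictly.\<close>
  define \<pi> where "\<pi> x = A (Suc x) ! x" for x
  have len: "x < length (A (Suc x))" for x using strict_mono_imp_increasing[OF m, of "Suc x"] by simp
  have "pre \<pi> (length (A i)) = A i" for i
  proof (rule nth_equalityI)
    fix x assume "x < length (pre \<pi> (length (A i)))"
    then have x: "x < length (A i)" by simp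
    then have "pre \<pi> (length (A i)) ! x = \<pi> x" by (simp add: pre_def)
    also have "\<dots> = A i ! x" unfolding \<pi>_def by (rule nth[OF x len])
    finally show "pre \<pi> (length (A i)) ! x = A i ! x" .
  qed simp
  then show "\<exists>\<pi>. \<forall>i. pre \<pi> (length (A i)) = A i" by blast
qed

lemma pre_take: "x \<le> i \<Longrightarrow> take x (pre \<pi> i) = pre \<pi> x"
  by (simp add: pre_def take_map)

lemma pre_add: "pre \<pi> (k + y) = pre \<pi> k @ pre (\<lambda>z. \<pi> (k + z)) y"
  by (induction y) (simp_all add: pre_Suc)

text \<open>A partial run on \<open>t\<close>: the subtree behind every missing direction has to be accepted (\<open>E\<close>), and
  \<open>U\<close> bounds the triples of variable, state and maximal priority so far at the variable leaves.\<close>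

definition prun :: "('q \<Rightarrow> ('c + nat) option \<times> 'r \<times> nat \<Rightarrow> 'q) \<Rightarrow> ('q \<Rightarrow> nat) \<Rightarrow> nat \<Rightarrow> 'r set \<Rightarrow> 'q set \<Rightarrow>
    (nat list \<Rightarrow> ('c + nat) option) \<Rightarrow> 'q \<Rightarrow> (nat \<times> 'q \<times> nat) set \<Rightarrow> (nat list \<Rightarrow> 'r) \<Rightarrow> bool" where
  "prun \<delta> pr N R E t q U \<rho> \<longleftrightarrow> (\<forall>v. \<rho> v \<in> R)
     \<and> (\<forall>v j. t v = Some (Inr j) \<longrightarrow> (j, nst \<delta> q t \<rho> v, nmx \<delta> pr q t \<rho> v) \<in> U)
     \<and> (\<forall>v a d. t v = Some (Inl a) \<longrightarrow> d < N \<longrightarrow> t (v @ [d]) = None \<longrightarrow> \<delta> (nst \<delta> q t \<rho> v) (t v, \<rho> v, d) \<in> E)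
     \<and> (\<forall>\<pi>. (\<forall>i. t (pre \<pi> i) \<noteq> None) \<longrightarrow> parity_ok (\<lambda>i. pr (nst \<delta> q t \<rho> (pre \<pi> i))))"

context
  fixes \<delta> :: "'q \<Rightarrow> ('c + nat) option \<times> 'r \<times> nat \<Rightarrow> 'q" and pr :: "'q \<Rightarrow> nat" and N M :: nat and R :: "'r set"
    and E Q :: "'q set" and ar :: "'c \<Rightarrow> nat" and \<Sigma> :: "'c set"
  assumes Qcl: "\<forall>q\<in>Q. \<forall>a\<in>\<Sigma>. \<forall>r\<in>R. \<forall>d<N. \<delta> q (Some (Inl a), r, d) \<in> Q"
    and arN: "\<forall>a\<in>\<Sigma>. ar a \<le> N" and prM: "\<forall>q. pr q \<le> M"
begin

lemma nst_in:
  assumes t: "wf_tree b ar \<Sigma> m t" and q: "q \<in> Q" and r: "\<And>v. \<rho> v \<in> R"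
  shows "snd t v \<noteq> None \<Longrightarrow> nst \<delta> q (snd t) \<rho> v \<in> Q"
proof (induction v rule: rev_induct)
  case (snoc d v)
  obtain a where a: "a \<in> \<Sigma>" "snd t v = Some (Inl a)" "d < ar a"
    using wf_prefix(2)[OF t snoc.prems] by auto
  then have "d < N" "nst \<delta> q (snd t) \<rho> v \<in> Q" using arN snoc.IH by (auto simp: less_le_trans)
  then show ?case using Qcl a r by (simp add: nst_snoc)
qed (simp add: q)

section \<open>Transfer of a partial run from the flattening of S to that of T\<close>

context
  fixes S T :: "'c tr tr" and n :: nat and q0 :: 'q and U :: "(nat \<times> 'q \<times> nat) set" and \<rho> :: "nat list \<Rightarrow> 'r"
  assumes S: "mmwf ar \<Sigma> n S" and T: "mmwf ar \<Sigma> n T" and q0: "q0 \<in> Q"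
    and run: "prun \<delta> pr N R E (snd (flat S)) q0 U \<rho>"
    and sh: "\<forall>v. (\<forall>l. snd S v = Some (Inr l) \<longleftrightarrow> snd T v = Some (Inr l)) \<and>
        ((\<exists>s. snd S v = Some (Inl s)) \<longleftrightarrow> (\<exists>t. snd T v = Some (Inl t)))"
    and le: "\<forall>v s t. snd S v = Some (Inl s) \<longrightarrow> snd T v = Some (Inl t) \<longrightarrow>
       (\<forall>q\<in>Q. \<forall>U \<subseteq> {..<fst s} \<times> Q \<times> {..M}. (\<exists>\<rho>. prun \<delta> pr N R E (snd s) q U \<rho>) \<longrightarrow> (\<exists>\<rho>. prun \<delta> pr N R E (snd t) q U \<rho>))"
begin

abbreviation "fS \<equiv> snd (flat S)"
abbreviation "fT \<equiv> snd (flat T)"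
abbreviation "stS \<equiv> nst \<delta> q0 fS \<rho>"

definition labS :: "nat list \<Rightarrow> nat list \<Rightarrow> ('c + nat) option" where
  "labS v = (case snd S v of Some (Inl s) \<Rightarrow> snd s | _ \<Rightarrow> (\<lambda>_. None))"
definition labT :: "nat list \<Rightarrow> nat list \<Rightarrow> ('c + nat) option" where
  "labT v = (case snd T v of Some (Inl t) \<Rightarrow> snd t | _ \<Rightarrow> (\<lambda>_. None))"

abbreviation "cst w v \<equiv> nst \<delta> (stS w) (labS v) (\<lambda>u. \<rho> (w @ u))"
abbreviation "cmx w v \<equiv> nmx \<delta> pr (stS w) (labS v) (\<lambda>u. \<rho> (w @ u))"

text \<open>The exact set of triples at the leaves of the component rooted at \<open>w\<close>.
  Requiring this smallest bound of the run in \<open>T\<close> makes every leaf triple there occur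
  in \<open>S\<close> at a leaf with the same variable.\<close>

definition Uc where "Uc w v = {(j, cst w v u, cmx w v u) |j u. labS v u = Some (Inr j)}"

lemma comp_prefix:
  assumes w: "loc S w = (v, [])" and s: "snd S v = Some (Inl s)" and u: "snd s u \<noteq> None" "u = p @ z" "z \<noteq> []"
  shows "fS (w @ p) = snd s p"
proof -
  obtain a where a: "snd s p = Some (Inl a)"
    using wf_prefix(2)[OF mm_label[OF S s], of p z] u by auto
  then show ?thesis using flat_component(1)[OF S w s a] by simp
qed

lemma comp_state:
  assumes w: "loc S w = (v, [])" and s: "snd S v = Some (Inl s)" and u: "snd s u \<noteq> None"
  shows "stS (w @ u) = cst w v u"
    and "nmx \<delta> pr q0 fS \<rho> (w @ u) = max (nmx \<delta> pr q0 fS \<rho> w) (cmx w v u)"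
proof -
  have labS: "labS v = snd s" by (simp add: labS_def s)
  have c: "fS (w @ p) = labS v p \<and> \<rho> (w @ p) = \<rho> (w @ p)" if "u = p @ z" "z \<noteq> []" for p z
    using comp_prefix[OF w s u that] labS by simp
  show "stS (w @ u) = cst w v u" unfolding nst_append by (rule nst_cong[OF c])
  show "nmx \<delta> pr q0 fS \<rho> (w @ u) = max (nmx \<delta> pr q0 fS \<rho> w) (cmx w v u)"
    unfolding nmx_append by (rule arg_cong[where f = "max _"], rule nmx_cong[OF c])
qed

text \<open>The states inside the component are those of the large run, by
  \<open>comp_state\<close>, and an infinite branch inside the component is a tail of an infinite
  branch of the flattening.\<close>

lemma comp_run:
  assumes w: "loc S w = (v, [])" and s: "snd S v = Some (Inl s)"
  shows "prun \<delta> pr N R E (snd s) (stS w) (Uc w v) (\<lambda>u. \<rho> (w @ u))"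
  unfolding prun_def
proof (intro conjI allI impI)
  have labS: "labS v = snd s" by (simp add: labS_def s)
  show "\<rho> (w @ u) \<in> R" for u using run unfolding prun_def by blast
  show "(j, nst \<delta> (stS w) (snd s) (\<lambda>u. \<rho> (w @ u)) u, nmx \<delta> pr (stS w) (snd s) (\<lambda>u. \<rho> (w @ u)) u) \<in> Uc w v"
    if "snd s u = Some (Inr j)" for u j using that labS unfolding Uc_def by auto
  show "\<delta> (nst \<delta> (stS w) (snd s) (\<lambda>u. \<rho> (w @ u)) u) (snd s u, \<rho> (w @ u), d) \<in> E"
    if a: "snd s u = Some (Inl a)" and d: "d < N" "snd s (u @ [d]) = None" for u a d
  proof -
    have lo: "loc S (w @ u) = (v, u)" by (rule loc_component(1)[OF S w s]) (use a in simp_all)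
    have fa: "fS (w @ u) = Some (Inl a)" by (rule flat_component(1)[OF S w s a])
    have "fS ((w @ u) @ [d]) = None" using flat_child[OF S lo s] d(2) by blast
    then have "\<delta> (stS (w @ u)) (fS (w @ u), \<rho> (w @ u), d) \<in> E" using run fa d(1) unfolding prun_def by blast
    then show ?thesis using comp_state(1)[OF w s, of u] a fa labS by simp
  qed
  show "parity_ok (\<lambda>i. pr (nst \<delta> (stS w) (snd s) (\<lambda>u. \<rho> (w @ u)) (pre \<pi> i)))" if \<pi>: "\<forall>i. snd s (pre \<pi> i) \<noteq> None" for \<pi>
  proof -
    define \<pi>' where "\<pi>' i = (if i < length w then w ! i else \<pi> (i - length w))" for i
    have lw: "pre \<pi>' (length w) = w" unfolding \<pi>'_def by (rule pre_through)
    have ps: "pre \<pi>' (length w + i) = w @ pre \<pi> i" for i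
      unfolding pre_add lw by (simp add: \<pi>'_def)
    have "fS (pre \<pi>' i) \<noteq> None" for i
    proof -
      have "fS (w @ pre \<pi> i) \<noteq> None" using flat_component(2)[OF S w s] \<pi> by blast
      then have "fS (pre \<pi>' (i + length w)) \<noteq> None" using ps[of i] by (simp add: add.commute)
      moreover have "pre \<pi>' (i + length w) = pre \<pi>' i @ pre (\<lambda>z. \<pi>' (i + z)) (length w)" by (rule pre_add)
      ultimately show ?thesis using wf_prefix(1)[OF flat_wf[OF S]] by metis
    qed
    then have "parity_ok (\<lambda>i. pr (stS (pre \<pi>' i)))" using run unfolding prun_def by blast
    then have "parity_ok (\<lambda>i. pr (stS (pre \<pi>' (i + length w))))"
      using parity_ok_shift[of "\<lambda>i. pr (stS (pre \<pi>' i))" "length w"] by blast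
    moreover have "stS (pre \<pi>' (i + length w)) = nst \<delta> (stS w) (snd s) (\<lambda>u. \<rho> (w @ u)) (pre \<pi> i)" for i
      using ps[of i] comp_state(1)[OF w s, of "pre \<pi> i"] \<pi> labS by (simp add: add.commute)
    ultimately show ?thesis by simp
  qed
qed

text \<open>The run depends on \<open>w\<close> as well as on \<open>v\<close>: if variables are
  repeated, the same outer vertex is entered at several addresses, possibly in different states, and
  each copy gets a run of its own.\<close>

definition comp_run_T where "comp_run_T w v = (SOME \<rho>'. prun \<delta> pr N R E (labT v) (stS w) (Uc w v) \<rho>')"

lemma comp_run_T:
  assumes w: "loc S w = (v, [])" and s: "snd S v = Some (Inl s)"
  shows "prun \<delta> pr N R E (labT v) (stS w) (Uc w v) (comp_run_T w v)"
proof -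
  obtain t where t: "snd T v = Some (Inl t)" using sh s by blast
  have ws: "wf_tree False ar \<Sigma> (fst s) s" by (rule mm_label[OF S s])
  have r: "\<rho> x \<in> R" for x using run unfolding prun_def by blast
  obtain a where "snd s [] = Some (Inl a)" using wf_root[OF ws] by blast
  then have "fS (w @ []) = Some (Inl a)" by (rule flat_component(1)[OF S w s])
  then have q: "stS w \<in> Q" using nst_in[OF flat_wf[OF S] q0 r, of w] by simp
  have labS: "labS v = snd s" by (simp add: labS_def s)
  \<comment> \<open>The hypothesis on labels compares bounds from a finite range only, so this bound
    has to be seen to lie in it.\<close>
  have "Uc w v \<subseteq> {..<fst s} \<times> Q \<times> {..M}"
  proof
    fix x assume "x \<in> Uc w v"
    then obtain j u where x: "x = (j, cst w v u, cmx w v u)" "labS v u = Some (Inr j)" unfolding Uc_def by blast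
    have "cst w v u \<in> Q" unfolding labS by (rule nst_in[OF ws q]) (use r x(2) labS in simp_all)
    moreover have "j < fst s" using wf_Inr[OF ws, of u j] x(2) labS by simp
    moreover have "cmx w v u \<le> M" using prM by (intro nmx_le) simp
    ultimately show "x \<in> {..<fst s} \<times> Q \<times> {..M}" using x(1) by simp
  qed
  then have "\<exists>\<rho>. prun \<delta> pr N R E (snd t) (stS w) (Uc w v) \<rho>"
    using le s t q comp_run[OF w s] by blast
  moreover have "labT v = snd t" by (simp add: labT_def t)
  ultimately show ?thesis unfolding comp_run_T_def by (metis (no_types, lifting) someI_ex)
qed

abbreviation "dst w v \<equiv> nst \<delta> (stS w) (labT v) (comp_run_T w v)"
abbreviation "dmx w v \<equiv> nmx \<delta> pr (stS w) (labT v) (comp_run_T w v)"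

text \<open>Agreement on the variable leads to the same outer vertex, agreement on the state lets
  the run continue, and agreement on the maximum makes the crossed components count alike.\<close>

definition leaf_match where "leaf_match w v u' = (SOME u. \<exists>j. labT v u' = Some (Inr j) \<and> labS v u = Some (Inr j)
   \<and> cst w v u = dst w v u' \<and> cmx w v u = dmx w v u')"

lemma leaf_match:
  assumes w: "loc S w = (v, [])" and s: "snd S v = Some (Inl s)" and u': "labT v u' = Some (Inr j)"
  shows "labS v (leaf_match w v u') = Some (Inr j) \<and> cst w v (leaf_match w v u') = dst w v u' \<and> cmx w v (leaf_match w v u') = dmx w v u'"
proof -
  have "(j, dst w v u', dmx w v u') \<in> Uc w v" using comp_run_T[OF w s] u' unfolding prun_def by blast
  then obtain u where "labS v u = Some (Inr j)" "dst w v u' = cst w v u" "dmx w v u' = cmx w v u" unfolding Uc_def by blast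
  then have "\<exists>u. \<exists>j. labT v u' = Some (Inr j) \<and> labS v u = Some (Inr j) \<and> cst w v u = dst w v u' \<and> cmx w v u = dmx w v u'"
    using u' by (intro exI[of _ u] exI[of _ j]) simp
  from someI_ex[OF this] show ?thesis using u' unfolding leaf_match_def[symmetric] by auto
qed

text \<open>\<open>W w\<close> is the root, in the flattening of \<open>S\<close>, of the component that the component of \<open>w\<close>, in the
  flattening of \<open>T\<close>, is matched with. Both belong to the same outer vertex.\<close>

primrec Wr :: "nat list \<Rightarrow> nat list" where
  "Wr [] = []"
| "Wr (i # w) = (if snd (loc T (rev (i # w))) = [] then Wr w @ leaf_match (Wr w) (fst (loc T (rev w))) (snd (loc T (rev w)) @ [i]) else Wr w)"

definition W where "W w = Wr (rev w)"

lemma W_Nil [simp]: "W [] = []"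
  by (simp add: W_def)

lemma W_snoc: "W (w @ [i]) = (if snd (loc T (w @ [i])) = [] then W w @ leaf_match (W w) (fst (loc T w)) (snd (loc T w) @ [i]) else W w)"
  by (simp add: W_def)

text \<open>The test for \<open>R\<close> supplies a default at addresses outside the domain; inside
  the domain it succeeds.\<close>

definition rT :: "nat list \<Rightarrow> 'r" where
  "rT w = (if comp_run_T (W w) (fst (loc T w)) (snd (loc T w)) \<in> R then comp_run_T (W w) (fst (loc T w)) (snd (loc T w)) else \<rho> [])"

lemma loc_T_snoc:
  assumes l: "loc T w = (v, u)" and t: "snd T v = Some (Inl t)"
  shows "snd (loc T (w @ [i])) \<noteq> [] \<Longrightarrow> loc T (w @ [i]) = (v, u @ [i])"
    and "snd (loc T (w @ [i])) = [] \<Longrightarrow> \<exists>j t'. labT v (u @ [i]) = Some (Inr j) \<and> snd T (v @ [j]) = Some (Inl t') \<and> loc T (w @ [i]) = (v @ [j], [])"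
proof -
  have tl: "labT v = snd t" by (simp add: labT_def t)
  have ls: "loc T (w @ [i]) = lstep T (v, u) i" using l by (simp add: loc_snoc)
  have "(\<exists>j t'. labT v (u @ [i]) = Some (Inr j) \<and> snd T (v @ [j]) = Some (Inl t') \<and> lstep T (v, u) i = (v @ [j], []))
     \<or> lstep T (v, u) i = (v, u @ [i])"
  proof (cases "\<exists>j t'. snd t (u @ [i]) = Some (Inr j) \<and> snd T (v @ [j]) = Some (Inl t')")
    case True
    then show ?thesis using lstep_cases[OF T t] tl by auto
  next
    case False
    then show ?thesis using lstep_stay[OF T t] by blast
  qed
  then show "snd (loc T (w @ [i])) \<noteq> [] \<Longrightarrow> loc T (w @ [i]) = (v, u @ [i])"
    and "snd (loc T (w @ [i])) = [] \<Longrightarrow> \<exists>j t'. labT v (u @ [i]) = Some (Inr j) \<and> snd T (v @ [j]) = Some (Inl t') \<and> loc T (w @ [i]) = (v @ [j], [])"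
    unfolding ls by auto
qed

text \<open>The invariant of reading both flattenings in parallel: at \<open>w\<close> the new run
  stands at position \<open>u\<close> of the outer vertex \<open>v\<close>, and its state and
  maximal priority are what the old run up to \<open>W w\<close>, continued by the chosen run on the
  component, would give.\<close>

definition matched where
  "matched w v u \<longleftrightarrow> loc T w = (v, u) \<and> loc S (W w) = (v, []) \<and> (\<exists>s. snd S v = Some (Inl s)) \<and> (\<exists>t. snd T v = Some (Inl t))
     \<and> labT v u \<noteq> None \<and> nst \<delta> q0 fT rT w = dst (W w) v u
     \<and> nmx \<delta> pr q0 fT rT w = max (nmx \<delta> pr q0 fS \<rho> (W w)) (dmx (W w) v u)"

lemma matched_lab:
  assumes "matched w v u"
  shows "fT w = Some (Inl a) \<longleftrightarrow> labT v u = Some (Inl a)"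
    and "fT w = Some (Inr l) \<longleftrightarrow> (\<exists>j. labT v u = Some (Inr j) \<and> snd T (v @ [j]) = Some (Inr l))"
    and "fT (w @ [d]) \<noteq> None \<longleftrightarrow> labT v (u @ [d]) \<noteq> None"
    and "rT w = comp_run_T (W w) v u"
proof -
  obtain s t where l: "loc T w = (v, u)" "snd T v = Some (Inl t)" and s: "loc S (W w) = (v, [])" "snd S v = Some (Inl s)"
    using assms unfolding matched_def by blast
  have tl: "labT v = snd t" by (simp add: labT_def l(2))
  show "fT w = Some (Inl a) \<longleftrightarrow> labT v u = Some (Inl a)" unfolding tl by (rule flat_Inl[OF T l])
  show "fT w = Some (Inr l) \<longleftrightarrow> (\<exists>j. labT v u = Some (Inr j) \<and> snd T (v @ [j]) = Some (Inr l))" unfolding tl by (rule flat_Inr[OF T l])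
  show "fT (w @ [d]) \<noteq> None \<longleftrightarrow> labT v (u @ [d]) \<noteq> None" unfolding tl by (rule flat_child[OF T l])
  show "rT w = comp_run_T (W w) v u" using comp_run_T[OF s] l(1) unfolding rT_def prun_def by simp
qed

text \<open>Inside a component the address in \<open>S\<close> does not move. On a jump, the leaf of
  \<open>T\<close> is matched with a leaf of \<open>S\<close> having the same variable, state and
  maximal priority, so the same outer vertex is entered in the same state.\<close>

lemma matched_step:
  assumes i: "matched w v u" and ne: "fT (w @ [d]) \<noteq> None"
  shows "\<exists>v' u'. matched (w @ [d]) v' u'"
    and "snd (loc T (w @ [d])) \<noteq> [] \<Longrightarrow> W (w @ [d]) = W w \<and> loc T (w @ [d]) = (v, u @ [d])"
    and "snd (loc T (w @ [d])) = [] \<Longrightarrow> \<exists>z. W (w @ [d]) = W w @ z \<and> z \<noteq> [] \<and> labS v z \<noteq> None \<and> cmx (W w) v z = dmx (W w) v (u @ [d])"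
proof -
  obtain s t where l: "loc T w = (v, u)" "snd T v = Some (Inl t)" and s: "loc S (W w) = (v, [])" "snd S v = Some (Inl s)"
    using i unfolding matched_def by blast
  have tl: "labT v = snd t" and labS: "labS v = snd s" by (simp_all add: labT_def l(2) labS_def s(2))
  obtain a where a: "fT w = Some (Inl a)" using wf_prefix(2)[OF flat_wf[OF T] ne] by auto
  have ta: "labT v u = Some (Inl a)" using matched_lab(1)[OF i, of a] a by blast
  have st: "nst \<delta> q0 fT rT (w @ [d]) = dst (W w) v (u @ [d])"
    using i matched_lab(4)[OF i] a ta unfolding matched_def by (simp add: nst_snoc)
  have mx: "nmx \<delta> pr q0 fT rT (w @ [d]) = max (nmx \<delta> pr q0 fS \<rho> (W w)) (dmx (W w) v (u @ [d]))"
    using i unfolding matched_def by (simp add: nmx_snoc max.assoc)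
  have stay: "W (w @ [d]) = W w \<and> loc T (w @ [d]) = (v, u @ [d])" if "snd (loc T (w @ [d])) \<noteq> []"
    using that W_snoc[of w d] loc_T_snoc(1)[OF l that] by simp
  then show "snd (loc T (w @ [d])) \<noteq> [] \<Longrightarrow> W (w @ [d]) = W w \<and> loc T (w @ [d]) = (v, u @ [d])" .
  have jump: "\<exists>z. W (w @ [d]) = W w @ z \<and> z \<noteq> [] \<and> labS v z \<noteq> None \<and> cmx (W w) v z = dmx (W w) v (u @ [d]) \<and>
      (\<exists>v' u'. matched (w @ [d]) v' u')" if em: "snd (loc T (w @ [d])) = []"
  proof -
    obtain j t' where j: "labT v (u @ [d]) = Some (Inr j)" "snd T (v @ [j]) = Some (Inl t')" "loc T (w @ [d]) = (v @ [j], [])"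
      using loc_T_snoc(2)[OF l em] by blast
    define z where "z = leaf_match (W w) v (u @ [d])"
    have Wz: "W (w @ [d]) = W w @ z" using W_snoc[of w d] em l(1) by (simp add: z_def)
    have z: "snd s z = Some (Inr j)" "cst (W w) v z = dst (W w) v (u @ [d])" "cmx (W w) v z = dmx (W w) v (u @ [d])"
      using leaf_match[OF s j(1)] unfolding z_def labS by auto
    \<comment> \<open>The matched leaf is not the root, as the root carries a letter. So every jump
      lengthens the address in \<open>S\<close>, and infinitely many jumps yield an infinite branch
      there.\<close>
    have zne: "z \<noteq> []" using z(1) wf_root[OF mm_label[OF S s(2)]] by auto
    obtain s' where s': "snd S (v @ [j]) = Some (Inl s')" using sh j(2) by blast
    have lS: "loc S (W w @ z) = (v @ [j], [])" by (rule loc_component(2)[OF S s _ z(1) s']) (simp add: z(1))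
    have cs: "stS (W w @ z) = cst (W w) v z" "nmx \<delta> pr q0 fS \<rho> (W w @ z) = max (nmx \<delta> pr q0 fS \<rho> (W w)) (cmx (W w) v z)"
      using comp_state[OF s, of z] z(1) by simp_all
    have "matched (w @ [d]) (v @ [j]) []" unfolding matched_def Wz
      using j lS s' st mx cs z wf_root[OF mm_label[OF T j(2)]] by (auto simp: labT_def)
    then show ?thesis using Wz zne z labS by (intro exI[of _ z]) auto
  qed
  then show "snd (loc T (w @ [d])) = [] \<Longrightarrow> \<exists>z. W (w @ [d]) = W w @ z \<and> z \<noteq> [] \<and> labS v z \<noteq> None \<and> cmx (W w) v z = dmx (W w) v (u @ [d])"
    by blast
  show "\<exists>v' u'. matched (w @ [d]) v' u'"
  proof (cases "snd (loc T (w @ [d])) = []")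
    case False
    have "labT v (u @ [d]) \<noteq> None" using matched_lab(3)[OF i] ne by simp
    then have "matched (w @ [d]) v (u @ [d])" unfolding matched_def using stay[OF False] s l st mx by auto
    then show ?thesis by blast
  qed (use jump in blast)
qed

lemma matched_root: "matched [] [] []"
proof -
  obtain s t where "snd S [] = Some (Inl s)" and t: "snd T [] = Some (Inl t)"
    using wf_root[OF S[unfolded mmwf_def]] wf_root[OF T[unfolded mmwf_def]] by blast
  then show ?thesis using wf_root[OF mm_label[OF T t]] unfolding matched_def by (auto simp: labT_def)
qed

lemma matched_ex: "fT w \<noteq> None \<Longrightarrow> matched w (fst (loc T w)) (snd (loc T w))"
proof (induction w rule: rev_induct)
  case Nil
  then show ?case using matched_root by simp
next
  case (snoc d w)
  then have "fT w \<noteq> None" using wf_prefix(1)[OF flat_wf[OF T] snoc.prems] by blast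
  then have "matched w (fst (loc T w)) (snd (loc T w))" by (rule snoc.IH)
  from matched_step(1)[OF this snoc.prems] obtain v' u' where i: "matched (w @ [d]) v' u'" by blast
  then have "loc T (w @ [d]) = (v', u')" unfolding matched_def by blast
  then show ?case using i by simp
qed

section \<open>Infinite branches of the transferred run\<close>

context
  fixes \<pi> :: "nat \<Rightarrow> nat"
  assumes br: "\<forall>i. fT (pre \<pi> i) \<noteq> None"
begin

abbreviation "vv i \<equiv> fst (loc T (pre \<pi> i))"
abbreviation "uu i \<equiv> snd (loc T (pre \<pi> i))"
abbreviation "WW i \<equiv> W (pre \<pi> i)"

lemma br_matched: "matched (pre \<pi> i) (vv i) (uu i)"
  using matched_ex br by blast

lemma br_stay:
  assumes "uu k = []" "\<And>x. k < x \<Longrightarrow> x \<le> k + y \<Longrightarrow> uu x \<noteq> []"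
  shows "loc T (pre \<pi> (k + y)) = (vv k, pre (\<lambda>z. \<pi> (k + z)) y) \<and> WW (k + y) = WW k"
  using assms(2)
proof (induction y)
  case 0
  then show ?case using assms(1) by (metis add.right_neutral pre_0 prod.collapse)
next
  case (Suc y)
  have IH: "loc T (pre \<pi> (k + y)) = (vv k, pre (\<lambda>z. \<pi> (k + z)) y)" "WW (k + y) = WW k"
    using Suc by auto
  have "snd (loc T (pre \<pi> (k + y) @ [\<pi> (k + y)])) \<noteq> []" using Suc.prems[of "Suc (k + y)"] by (simp add: pre_Suc)
  moreover have "fT (pre \<pi> (k + y) @ [\<pi> (k + y)]) \<noteq> None" using br[rule_format, of "Suc (k + y)"] by (simp add: pre_Suc)
  ultimately have "W (pre \<pi> (k + y) @ [\<pi> (k + y)]) = W (pre \<pi> (k + y))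
     \<and> loc T (pre \<pi> (k + y) @ [\<pi> (k + y)]) = (vv (k + y), uu (k + y) @ [\<pi> (k + y)])"
    using matched_step(2)[OF br_matched[of "k + y"]] by blast
  then show ?case using IH by (simp add: pre_Suc)
qed

lemma br_state:
  assumes "uu k = []" "\<And>x. k < x \<Longrightarrow> x \<le> k + y \<Longrightarrow> uu x \<noteq> []"
  shows "nst \<delta> q0 fT rT (pre \<pi> (k + y)) = dst (WW k) (vv k) (pre (\<lambda>z. \<pi> (k + z)) y)"
  using br_matched[of "k + y"] br_stay[OF assms] unfolding matched_def by simp

text \<open>If finitely many components are entered, the branch ends up inside one of them, where
  the chosen run is accepting. Otherwise the matched component roots in \<open>S\<close> lie on an
  infinite branch, and corresponding blocks of the two branches have equal maxima.\<close>

lemma br_parity: "parity_ok (\<lambda>i. pr (nst \<delta> q0 fT rT (pre \<pi> i)))"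
proof (cases "finite {i. uu i = []}")
  case True
  define k where "k = Max {i. uu i = []}"
  have "0 \<in> {i. uu i = []}" by simp
  then have k: "uu k = []" using Max_in[OF True] unfolding k_def by blast
  have gr: "uu x \<noteq> []" if "k < x" for x using Max_ge[OF True, of x] that unfolding k_def by auto
  let ?\<pi> = "\<lambda>z. \<pi> (k + z)"
  have lo: "labT (vv k) (pre ?\<pi> y) \<noteq> None" for y
    using br_matched[of "k + y"] br_stay[OF k gr, of y] unfolding matched_def by simp
  have "prun \<delta> pr N R E (labT (vv k)) (stS (WW k)) (Uc (WW k) (vv k)) (comp_run_T (WW k) (vv k))"
    using br_matched[of k] comp_run_T unfolding matched_def by blast
  then have "parity_ok (\<lambda>y. pr (dst (WW k) (vv k) (pre ?\<pi> y)))" using lo unfolding prun_def by blast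
  moreover have "pr (dst (WW k) (vv k) (pre ?\<pi> y)) = pr (nst \<delta> q0 fT rT (pre \<pi> (y + k)))" for y
    using br_state[OF k gr, of y] by (simp add: add.commute)
  ultimately have "parity_ok (\<lambda>y. pr (nst \<delta> q0 fT rT (pre \<pi> (y + k))))" by simp
  then show ?thesis using parity_ok_shift[of "\<lambda>i. pr (nst \<delta> q0 fT rT (pre \<pi> i))" k] by blast
next
  case inf: False
  define k where "k = enumerate {i. uu i = []}"
  have km: "strict_mono k" unfolding k_def by (rule strict_mono_enumerate[OF inf])
  have ku: "uu (k i) = []" for i using enumerate_in_set[OF inf, of i] unfolding k_def by simp
  have k0: "k 0 = 0" unfolding k_def enumerate_0 by (rule Least_equality) simp_all
  have gap: "uu x \<noteq> []" if "k i < x" "x < k (Suc i)" for x i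
    using not_less_Least[of x "\<lambda>s. s \<in> {i. uu i = []} \<and> k i < s"] that enumerate_Suc''[OF inf, of i]
    unfolding k_def by auto
  \<comment> \<open>\<open>y i\<close> steps stay inside the component entered at
    \<open>k i\<close>; the next one jumps.\<close>
  define y where "y i = k (Suc i) - k i - 1" for i
  have ky: "k (Suc i) = Suc (k i + y i)" for i
  proof -
    have "k i < k (Suc i)" using km by (simp add: strict_mono_Suc_iff)
    then show ?thesis unfolding y_def by linarith
  qed
  let ?A = "\<lambda>i. WW (k i)"
  let ?\<pi> = "\<lambda>i z. \<pi> (k i + z)"
  have stay: "loc T (pre \<pi> (k i + x)) = (vv (k i), pre (?\<pi> i) x) \<and> WW (k i + x) = ?A i" if "x \<le> y i" for i x
    by (rule br_stay[OF ku]) (use gap ky that in auto)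
  have state: "nst \<delta> q0 fT rT (pre \<pi> (k i + x)) = dst (?A i) (vv (k i)) (pre (?\<pi> i) x)" if "x \<le> y i" for i x
    by (rule br_state[OF ku]) (use gap ky that in auto)
  have jump: "\<exists>z. ?A (Suc i) = ?A i @ z \<and> z \<noteq> [] \<and> labS (vv (k i)) z \<noteq> None
      \<and> cmx (?A i) (vv (k i)) z = dmx (?A i) (vv (k i)) (pre (?\<pi> i) (Suc (y i)))" for i
  proof -
    let ?w = "pre \<pi> (k i + y i)" and ?d = "\<pi> (k i + y i)"
    have w: "pre \<pi> (k (Suc i)) = ?w @ [?d]" unfolding ky by (simp add: pre_Suc)
    have "fT (?w @ [?d]) \<noteq> None" "snd (loc T (?w @ [?d])) = []" using br ku[of "Suc i"] unfolding w[symmetric] by simp_all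
    from matched_step(3)[OF br_matched this] obtain z where "W (?w @ [?d]) = W ?w @ z" "z \<noteq> []" "labS (vv (k i + y i)) z \<noteq> None"
      "cmx (W ?w) (vv (k i + y i)) z = dmx (W ?w) (vv (k i + y i)) (uu (k i + y i) @ [?d])" by blast
    then show ?thesis unfolding w using stay[of "y i" i] by (intro exI[of _ z]) (simp add: pre_Suc)
  qed
  then obtain z where z: "\<And>i. ?A (Suc i) = ?A i @ z i" "\<And>i. z i \<noteq> []" "\<And>i. labS (vv (k i)) (z i) \<noteq> None"
    "\<And>i. cmx (?A i) (vv (k i)) (z i) = dmx (?A i) (vv (k i)) (pre (?\<pi> i) (Suc (y i)))" by metis
  have Aext: "\<exists>z. z \<noteq> [] \<and> ?A (Suc i) = ?A i @ z" for i using z(1,2) by blast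
  \<comment> \<open>The branch of the flattening of \<open>S\<close> through all matched component
    roots; the old run accepts it.\<close>
  obtain \<pi>0 where \<pi>0: "\<And>i. pre \<pi>0 (length (?A i)) = ?A i" using limit_branch(1)[of ?A, OF Aext] by blast
  have cm: "strict_mono (\<lambda>i. length (?A i))" by (rule limit_branch(2)[of ?A, OF Aext])
  have A0: "length (?A 0) = 0" using k0 by simp
  have lS: "loc S (?A i) = (vv (k i), []) \<and> (\<exists>s. snd S (vv (k i)) = Some (Inl s))" for i
    using br_matched[of "k i"] unfolding matched_def by blast
  have pre0: "pre \<pi>0 (length (?A i) + x) = ?A i @ take x (z i)" if "x \<le> length (z i)" for i x
  proof -
    have l: "length (?A (Suc i)) = length (?A i) + length (z i)" using z(1)[of i] by simp
    have "pre \<pi>0 (length (?A i) + x) = take (length (?A i) + x) (pre \<pi>0 (length (?A (Suc i))))"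
      by (rule pre_take[symmetric]) (use l that in simp)
    also have "\<dots> = take (length (?A i) + x) (?A i @ z i)" unfolding \<pi>0 by (simp only: z(1))
    finally show ?thesis by simp
  qed
  have stS: "stS (pre \<pi>0 (length (?A i) + x)) = cst (?A i) (vv (k i)) (take x (z i)) \<and> fS (pre \<pi>0 (length (?A i) + x)) \<noteq> None"
    if x: "x \<le> length (z i)" for i x
  proof -
    obtain s where s: "loc S (?A i) = (vv (k i), [])" "snd S (vv (k i)) = Some (Inl s)" using lS[of i] by blast
    have labS: "labS (vv (k i)) = snd s" by (simp add: labS_def s(2))
    have "snd s (take x (z i)) \<noteq> None"
      using wf_prefix(1)[OF mm_label[OF S s(2)], of "take x (z i)" "drop x (z i)"] z(3)[of i] labS by simp
    then show ?thesis unfolding pre0[OF x] using comp_state(1)[OF s] flat_component(2)[OF S s] by blast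
  qed
  have "fS (pre \<pi>0 i) \<noteq> None" for i
  proof -
    obtain b where b: "length (?A b) \<le> i" "i < length (?A (Suc b))" using strict_mono_block[OF cm] A0 by (metis zero_le)
    have "length (?A (Suc b)) = length (?A b) + length (z b)" using z(1)[of b] by simp
    then show ?thesis using stS[of "i - length (?A b)" b] b by simp
  qed
  then have pS: "parity_ok (\<lambda>i. pr (stS (pre \<pi>0 i)))" using run unfolding prun_def by blast
  let ?f = "\<lambda>i. pr (stS (pre \<pi>0 i))" and ?g = "\<lambda>i. pr (nst \<delta> q0 fT rT (pre \<pi> i))"
  \<comment> \<open>Both maxima are the values that \<open>leaf_match\<close> made equal. The two
    blocks may have different lengths.\<close>
  have "Max (?f ` {length (?A i)..<length (?A (Suc i))}) = Max (?g ` {k i..<k (Suc i)})" for i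
  proof -
    have l: "length (?A (Suc i)) = length (?A i) + length (z i)" using z(1)[of i] by simp
    have "?f ` {length (?A i)..<length (?A (Suc i))} = (\<lambda>x. pr (cst (?A i) (vv (k i)) (take x (z i)))) ` {0..<length (z i)}"
      unfolding l image_shift by (intro image_cong refl) (simp add: stS)
    then have 1: "Max (?f ` {length (?A i)..<length (?A (Suc i))}) = cmx (?A i) (vv (k i)) (z i)"
      by (simp only: nmx_Max[OF z(2)])
    let ?u = "pre (?\<pi> i) (Suc (y i))"
    have une: "?u \<noteq> []" by (simp add: pre_Suc)
    have k1: "k (Suc i) = k i + length ?u" using ky by simp
    have "?g ` {k i..<k (Suc i)} = (\<lambda>x. pr (dst (?A i) (vv (k i)) (take x ?u))) ` {0..<length ?u}"
      unfolding k1 image_shift by (intro image_cong refl) (simp add: state pre_take)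
    then have 2: "Max (?g ` {k i..<k (Suc i)}) = dmx (?A i) (vv (k i)) ?u"
      by (simp only: nmx_Max[OF une])
    show ?thesis unfolding 1 2 by (rule z(4))
  qed
  then show ?thesis using pS parity_ok_blocks[OF cm, of ?f] parity_ok_blocks[OF km, of ?g] by simp
qed

end

text \<open>A variable leaf of the flattening of \<open>T\<close> is matched inside its component
  with a leaf of \<open>S\<close> behind which the outer tree has the same variable, so its triple
  already lies in \<open>U\<close>. Missing directions are those of the component.\<close>

theorem prun_flat: "\<exists>\<rho>'. prun \<delta> pr N R E fT q0 U \<rho>'"
proof (rule exI[of _ rT])
  show "prun \<delta> pr N R E fT q0 U rT" unfolding prun_def
  proof (intro conjI allI impI)
    have "\<rho> [] \<in> R" using run unfolding prun_def by blast
    then show "rT w \<in> R" for w by (simp add: rT_def)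
    show "parity_ok (\<lambda>i. pr (nst \<delta> q0 fT rT (pre \<pi> i)))" if "\<forall>i. fT (pre \<pi> i) \<noteq> None" for \<pi>
      by (rule br_parity[OF that])
    show "\<delta> (nst \<delta> q0 fT rT w) (fT w, rT w, d) \<in> E" if a: "fT w = Some (Inl a)" and d: "d < N" "fT (w @ [d]) = None" for w a d
    proof -
      define v u where "v = fst (loc T w)" and "u = snd (loc T w)"
      have i: "matched w v u" unfolding v_def u_def using matched_ex a by simp
      have "prun \<delta> pr N R E (labT v) (stS (W w)) (Uc (W w) v) (comp_run_T (W w) v)" using i comp_run_T unfolding matched_def by blast
      moreover have ta: "labT v u = Some (Inl a)" using matched_lab(1)[OF i, of a] a by blast
      moreover have "labT v (u @ [d]) = None" using matched_lab(3)[OF i, of d] d(2) by simp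
      ultimately have "\<delta> (dst (W w) v u) (labT v u, comp_run_T (W w) v u, d) \<in> E" using d(1) unfolding prun_def by blast
      then show ?thesis using i matched_lab(4)[OF i] a ta unfolding matched_def by simp
    qed
    show "(l, nst \<delta> q0 fT rT w, nmx \<delta> pr q0 fT rT w) \<in> U" if a: "fT w = Some (Inr l)" for w l
    proof -
      define v u where "v = fst (loc T w)" and "u = snd (loc T w)"
      have i: "matched w v u" unfolding v_def u_def using matched_ex a by simp
      obtain s where s: "loc S (W w) = (v, [])" "snd S v = Some (Inl s)" using i unfolding matched_def by blast
      have labS: "labS v = snd s" by (simp add: labS_def s(2))
      obtain j where j: "labT v u = Some (Inr j)" "snd T (v @ [j]) = Some (Inr l)" using matched_lab(2)[OF i] a by blast
      define z where "z = leaf_match (W w) v u"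
      have z: "snd s z = Some (Inr j)" "cst (W w) v z = dst (W w) v u" "cmx (W w) v z = dmx (W w) v u"
        using leaf_match[OF s j(1)] unfolding z_def labS by auto
      have "snd S (v @ [j]) = Some (Inr l)" using sh j(2) by blast
      then have "fS (W w @ z) = Some (Inr l)" by (rule flat_component(3)[OF S s z(1)])
      then have "(l, stS (W w @ z), nmx \<delta> pr q0 fS \<rho> (W w @ z)) \<in> U" using run unfolding prun_def by blast
      then show ?thesis using comp_state[OF s, of z] z i unfolding matched_def by simp
    qed
  qed
qed

end

end

section \<open>Acceptance as existence of a partial run\<close>

definition accq :: "('q \<Rightarrow> 'l \<times> 'r \<times> nat \<Rightarrow> 'q) \<Rightarrow> ('q \<Rightarrow> nat) \<Rightarrow> nat \<Rightarrow> 'r set \<Rightarrow> 'q \<Rightarrow> (nat list \<Rightarrow> 'l) \<Rightarrow> bool" where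
  "accq \<delta> pr N R q \<tau> \<longleftrightarrow> (\<exists>\<rho>. (\<forall>v. \<rho> v \<in> R) \<and>
     (\<forall>\<pi>. (\<forall>i. \<pi> i < N) \<longrightarrow> parity_ok (\<lambda>i. pr (nst \<delta> q \<tau> \<rho> (pre \<pi> i)))))"

abbreviation stub :: "('c + nat) option \<Rightarrow> nat list \<Rightarrow> ('c + nat) option" where
  "stub x \<equiv> (\<lambda>u. if u = [] then x else None)"

lemma accq_sub:
  assumes \<rho>: "\<And>v. \<rho> v \<in> R" and acc: "\<And>\<pi>. (\<And>i. \<pi> i < N) \<Longrightarrow> parity_ok (\<lambda>i. pr (nst \<delta> q \<tau> \<rho> (pre \<pi> i)))"
    and v: "v \<in> lists {..<N}"
  shows "accq \<delta> pr N R (nst \<delta> q \<tau> \<rho> v) (\<lambda>u. \<tau> (v @ u))"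
proof -
  have "parity_ok (\<lambda>i. pr (nst \<delta> (nst \<delta> q \<tau> \<rho> v) (\<lambda>u. \<tau> (v @ u)) (\<lambda>u. \<rho> (v @ u)) (pre \<pi> i)))"
    if \<pi>: "\<And>i. \<pi> i < N" for \<pi>
  proof -
    define \<pi>' where "\<pi>' i = (if i < length v then v ! i else \<pi> (i - length v))" for i
    have lw: "pre \<pi>' (length v) = v" unfolding \<pi>'_def by (rule pre_through)
    have ps: "pre \<pi>' (i + length v) = v @ pre \<pi> i" for i
      unfolding add.commute[of i] pre_add lw by (simp add: \<pi>'_def)
    have "\<pi>' i < N" for i using v \<pi> nth_mem[of i v] unfolding \<pi>'_def by (auto simp: in_lists_conv_set)
    then have "parity_ok (\<lambda>i. pr (nst \<delta> q \<tau> \<rho> (pre \<pi>' i)))" by (rule acc)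
    then have "parity_ok (\<lambda>i. pr (nst \<delta> q \<tau> \<rho> (pre \<pi>' (i + length v))))"
      using parity_ok_shift[of "\<lambda>i. pr (nst \<delta> q \<tau> \<rho> (pre \<pi>' i))" "length v"] by blast
    then show ?thesis unfolding ps nst_append .
  qed
  then show ?thesis unfolding accq_def using \<rho> by (intro exI[of _ "\<lambda>u. \<rho> (v @ u)"]) simp
qed

text \<open>Behind a missing direction every address of the full \<open>N\<close>-ary tree is
  labelled \<open>None\<close>; these are the states that accept such a subtree.\<close>

definition dead_states :: "('q \<Rightarrow> ('c + nat) option \<times> 'r \<times> nat \<Rightarrow> 'q) \<Rightarrow> ('q \<Rightarrow> nat) \<Rightarrow> nat \<Rightarrow> 'r set \<Rightarrow> 'q set" where
  "dead_states \<delta> pr N R = {q. accq \<delta> pr N R q (stub None)}"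

text \<open>The bound that the sentence itself imposes at variables. Maximal priorities are
  restricted only by \<open>M\<close>, as what happens on a finite path does not influence
  acceptance.\<close>

definition leaf_bound :: "('q \<Rightarrow> ('c + nat) option \<times> 'r \<times> nat \<Rightarrow> 'q) \<Rightarrow> ('q \<Rightarrow> nat) \<Rightarrow> nat \<Rightarrow> nat \<Rightarrow> nat \<Rightarrow> 'r set \<Rightarrow> 'q set \<Rightarrow> (nat \<times> 'q \<times> nat) set" where
  "leaf_bound \<delta> pr N M n0 R Q = {(j, q, p). j < n0 \<and> q \<in> Q \<and> p \<le> M \<and> accq \<delta> pr N R q (stub (Some (Inr j)))}"

context
  fixes \<delta> :: "'q \<Rightarrow> ('c + nat) option \<times> 'r \<times> nat \<Rightarrow> 'q" and pr :: "'q \<Rightarrow> nat" and N M n0 :: nat and R :: "'r set"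
    and Q :: "'q set" and ar :: "'c \<Rightarrow> nat" and \<Sigma> :: "'c set" and q0 :: 'q and t :: "'c tr"
  assumes Qcl: "\<forall>q\<in>Q. \<forall>a\<in>\<Sigma>. \<forall>r\<in>R. \<forall>d<N. \<delta> q (Some (Inl a), r, d) \<in> Q"
    and arN: "\<forall>a\<in>\<Sigma>. ar a \<le> N" and prM: "\<forall>q. pr q \<le> M" and q0: "q0 \<in> Q" and R: "R \<noteq> {}"
    and t: "wf_tree False ar \<Sigma> n0 t"
begin

lemma wf_lists: "snd t v \<noteq> None \<Longrightarrow> v \<in> lists {..<N}"
proof (induction v rule: rev_induct)
  case (snoc d v)
  obtain a where "a \<in> \<Sigma>" "d < ar a" using wf_prefix(2)[OF t snoc.prems] by auto
  then have "d < N" using arN by (auto simp: less_le_trans)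
  moreover have "v \<in> lists {..<N}" using snoc.IH wf_prefix(1)[OF t snoc.prems] by blast
  ultimately show ?case by simp
qed simp

lemma exit_stub:
  assumes "\<nexists>a. snd t w = Some (Inl a)"
  shows "(\<lambda>u. snd t (w @ u)) = stub (snd t w)"
proof
  fix u
  show "snd t (w @ u) = stub (snd t w) u"
    using assms wf_prefix(2)[OF t, of w u] by (cases "snd t (w @ u)") auto
qed

lemma accq_imp_prun:
  assumes "accq \<delta> pr N R q0 (snd t)"
  shows "\<exists>\<rho>. prun \<delta> pr N R (dead_states \<delta> pr N R) (snd t) q0 (leaf_bound \<delta> pr N M n0 R Q) \<rho>"
proof -
  obtain \<rho> where \<rho>: "\<And>v. \<rho> v \<in> R" "\<And>\<pi>. (\<And>i. \<pi> i < N) \<Longrightarrow> parity_ok (\<lambda>i. pr (nst \<delta> q0 (snd t) \<rho> (pre \<pi> i)))"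
    using assms unfolding accq_def by blast
  have "prun \<delta> pr N R (dead_states \<delta> pr N R) (snd t) q0 (leaf_bound \<delta> pr N M n0 R Q) \<rho>" unfolding prun_def
  proof (intro conjI allI impI)
    show "\<rho> v \<in> R" for v by (rule \<rho>(1))
    show "(j, nst \<delta> q0 (snd t) \<rho> v, nmx \<delta> pr q0 (snd t) \<rho> v) \<in> (leaf_bound \<delta> pr N M n0 R Q)" if v: "snd t v = Some (Inr j)" for v j
    proof -
      have "accq \<delta> pr N R (nst \<delta> q0 (snd t) \<rho> v) (\<lambda>u. snd t (v @ u))"
        by (rule accq_sub[OF \<rho>]) (use wf_lists v in auto)
      moreover have ni: "\<nexists>a. snd t v = Some (Inl a)" by (simp add: v)
      ultimately have "accq \<delta> pr N R (nst \<delta> q0 (snd t) \<rho> v) (stub (Some (Inr j)))"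
        by (simp only: exit_stub[OF ni] v)
      moreover have "nst \<delta> q0 (snd t) \<rho> v \<in> Q" using nst_in[OF Qcl arN prM t q0 \<rho>(1)] v by simp
      moreover have "nmx \<delta> pr q0 (snd t) \<rho> v \<le> M" using prM by (intro nmx_le) simp
      moreover have "j < n0" using wf_Inr[OF t v] by blast
      ultimately show ?thesis unfolding leaf_bound_def by simp
    qed
    show "\<delta> (nst \<delta> q0 (snd t) \<rho> v) (snd t v, \<rho> v, d) \<in> (dead_states \<delta> pr N R)" if v: "snd t v = Some (Inl a)" "d < N" "snd t (v @ [d]) = None" for v a d
    proof -
      have "accq \<delta> pr N R (nst \<delta> q0 (snd t) \<rho> (v @ [d])) (\<lambda>u. snd t ((v @ [d]) @ u))"
        by (rule accq_sub[OF \<rho>]) (use wf_lists[of v] v in auto)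
      moreover have ni: "\<nexists>a. snd t (v @ [d]) = Some (Inl a)" by (simp add: v)
      ultimately show ?thesis unfolding dead_states_def by (simp only: exit_stub[OF ni] v nst_snoc mem_Collect_eq)
    qed
    show "parity_ok (\<lambda>i. pr (nst \<delta> q0 (snd t) \<rho> (pre \<pi> i)))" if \<pi>: "\<forall>i. snd t (pre \<pi> i) \<noteq> None" for \<pi>
    proof (rule \<rho>(2))
      fix i
      have "snd t (pre \<pi> (Suc i)) \<noteq> None" using \<pi> by blast
      then have "pre \<pi> i @ [\<pi> i] \<in> lists {..<N}" unfolding pre_Suc by (rule wf_lists)
      then show "\<pi> i < N" by simp
    qed
  qed
  then show ?thesis by blast
qed

text \<open>The labelling follows \<open>\<rho>\<close> as long as letters are read and switches, at
  the first address without a letter, to an accepting labelling of the subtree found there. Every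
  branch either belongs to the partial run or has a tail accepted by such a labelling.\<close>

lemma prun_imp_accq:
  assumes run: "prun \<delta> pr N R (dead_states \<delta> pr N R) (snd t) q0 (leaf_bound \<delta> pr N M n0 R Q) \<rho>"
  shows "accq \<delta> pr N R q0 (snd t)"
proof -
  let ?I = "\<lambda>v. \<exists>a. snd t v = Some (Inl a)"
  define A where "A w \<chi> \<longleftrightarrow> (\<forall>v. \<chi> v \<in> R) \<and> (\<forall>\<pi>. (\<forall>i. \<pi> i < N) \<longrightarrow>
     parity_ok (\<lambda>i. pr (nst \<delta> (nst \<delta> q0 (snd t) \<rho> w) (stub (snd t w)) \<chi> (pre \<pi> i))))" for w \<chi>
  obtain r0 where r0: "r0 \<in> R" using R by blast
  define \<chi> where "\<chi> w = (if \<exists>\<chi>. A w \<chi> then SOME \<chi>. A w \<chi> else (\<lambda>_. r0))" for w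
  have \<chi>A: "A w (\<chi> w)" if "\<exists>\<chi>. A w \<chi>" for w
    using someI_ex[OF that] that unfolding \<chi>_def by simp
  have \<chi>: "A w (\<chi> w)" if "accq \<delta> pr N R (nst \<delta> q0 (snd t) \<rho> w) (stub (snd t w))" for w
    by (rule \<chi>A) (use that in \<open>unfold accq_def A_def\<close>)
  have \<chi>R: "\<chi> w v \<in> R" for w v
  proof (cases "\<exists>\<chi>. A w \<chi>")
    case True
    then show ?thesis using \<chi>A unfolding A_def by blast
  next
    case False
    then have "\<chi> w = (\<lambda>_. r0)" unfolding \<chi>_def by (rule if_not_P)
    then show ?thesis using r0 by simp
  qed
  \<comment> \<open>The length of the shortest prefix of \<open>v\<close> without a letter, that is,
    the place where the partial run is left.\<close>
  define kk where "kk v = (LEAST k. \<not> ?I (take k v))" for v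
  define \<rho>' where "\<rho>' v = (if ?I v then \<rho> v else \<chi> (take (kk v) v) (drop (kk v) v))" for v
  have \<rho>R: "\<rho>' v \<in> R" for v using run \<chi>R unfolding \<rho>'_def prun_def by simp
  have same: "nst \<delta> q0 (snd t) \<rho>' v = nst \<delta> q0 (snd t) \<rho> v" if "\<And>p z. v = p @ z \<Longrightarrow> z \<noteq> [] \<Longrightarrow> ?I p" for v
  proof (rule nst_cong)
    fix p z assume "v = p @ z" "z \<noteq> []"
    then have "?I p" by (rule that)
    then show "snd t p = snd t p \<and> \<rho>' p = \<rho> p" by (simp add: \<rho>'_def)
  qed
  have "parity_ok (\<lambda>i. pr (nst \<delta> q0 (snd t) \<rho>' (pre \<pi> i)))" if \<pi>: "\<And>i. \<pi> i < N" for \<pi>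
  proof (cases "\<forall>i. ?I (pre \<pi> i)")
    case True
    have "nst \<delta> q0 (snd t) \<rho>' (pre \<pi> i) = nst \<delta> q0 (snd t) \<rho> (pre \<pi> i)" for i
    proof (rule same)
      fix p z assume "pre \<pi> i = p @ z" "z \<noteq> []"
      then have "take (length p) (pre \<pi> i) = p" "length p \<le> i" by (simp, metis length_append length_pre le_add1)
      then have "p = pre \<pi> (length p)" using pre_take by metis
      then show "?I p" using True by metis
    qed
    moreover have "\<forall>i. snd t (pre \<pi> i) \<noteq> None" using True by fastforce
    ultimately show ?thesis using run unfolding prun_def by simp
  next
    case False
    define K where "K = (LEAST i. \<not> ?I (pre \<pi> i))"
    have K: "\<not> ?I (pre \<pi> K)" unfolding K_def using False LeastI_ex[of "\<lambda>i. \<not> ?I (pre \<pi> i)"] by blast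
    have low: "?I (pre \<pi> i)" if "i < K" for i using not_less_Least[of i "\<lambda>i. \<not> ?I (pre \<pi> i)"] that unfolding K_def by blast
    have "?I (pre \<pi> 0)" using wf_root[OF t] by simp
    then obtain K' where K': "K = Suc K'" using K by (cases K) auto
    let ?w = "pre \<pi> K"
    obtain a where a: "snd t (pre \<pi> K') = Some (Inl a)" using low[of K'] K' by auto
    have w: "?w = pre \<pi> K' @ [\<pi> K']" unfolding K' by (rule pre_Suc)
    have stub: "(\<lambda>u. snd t (?w @ u)) = stub (snd t ?w)" by (rule exit_stub) (use K in blast)
    have "accq \<delta> pr N R (nst \<delta> q0 (snd t) \<rho> ?w) (stub (snd t ?w))"
    proof (cases "snd t ?w")
      case None
      then have "\<delta> (nst \<delta> q0 (snd t) \<rho> (pre \<pi> K')) (snd t (pre \<pi> K'), \<rho> (pre \<pi> K'), \<pi> K') \<in> (dead_states \<delta> pr N R)"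
        using run a \<pi>[of K'] unfolding prun_def w by blast
      then have "nst \<delta> q0 (snd t) \<rho> ?w \<in> (dead_states \<delta> pr N R)" unfolding w nst_snoc .
      then show ?thesis unfolding dead_states_def None by simp
    next
      case (Some x)
      then obtain j where j: "snd t ?w = Some (Inr j)" using K by (cases x) auto
      then have "(j, nst \<delta> q0 (snd t) \<rho> ?w, nmx \<delta> pr q0 (snd t) \<rho> ?w) \<in> (leaf_bound \<delta> pr N M n0 R Q)" using run unfolding prun_def by blast
      then show ?thesis unfolding leaf_bound_def j by simp
    qed
    note comp_run_T = \<chi>[OF this, unfolded A_def]
    have nw: "nst \<delta> q0 (snd t) \<rho>' ?w = nst \<delta> q0 (snd t) \<rho> ?w"
    proof (rule same)
      fix p z assume pz: "?w = p @ z" "z \<noteq> []"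
      then have l: "length p < K" by (metis length_append length_pre length_greater_0_conv less_add_same_cancel1)
      have "p = take (length p) ?w" using pz by simp
      also have "\<dots> = pre \<pi> (length p)" by (rule pre_take) (use l in simp)
      finally show "?I p" using low[OF l] by metis
    qed
    let ?\<pi> = "\<lambda>z. \<pi> (K + z)"
    have shift: "\<rho>' (?w @ pre ?\<pi> i) = \<chi> ?w (pre ?\<pi> i)" for i
    proof -
      have e: "?w @ pre ?\<pi> i = pre \<pi> (K + i)" by (rule pre_add[symmetric])
      have "kk (pre \<pi> (K + i)) = K" unfolding kk_def
      proof (rule Least_equality)
        show "\<not> ?I (take K (pre \<pi> (K + i)))" using K by (simp add: pre_take)
        fix k assume k: "\<not> ?I (take k (pre \<pi> (K + i)))"
        show "K \<le> k"
        proof (rule ccontr)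
          assume "\<not> K \<le> k"
          then have "k < K" by simp
          then have "take k (pre \<pi> (K + i)) = pre \<pi> k" by (simp add: pre_take)
          then show False using k low[OF \<open>k < K\<close>] by simp
        qed
      qed
      moreover have "\<not> ?I (pre \<pi> (K + i))"
      proof -
        have "snd t (?w @ pre ?\<pi> i) = stub (snd t ?w) (pre ?\<pi> i)" using fun_cong[OF stub, of "pre ?\<pi> i"] .
        then show ?thesis using K unfolding e[symmetric] by (auto split: if_splits)
      qed
      ultimately have "\<rho>' (pre \<pi> (K + i)) = \<chi> (take K (pre \<pi> (K + i))) (drop K (pre \<pi> (K + i)))"
        unfolding \<rho>'_def by simp
      then show ?thesis unfolding e[symmetric] by simp
    qed
    have step: "nst \<delta> q0 (snd t) \<rho>' (pre \<pi> (i + K)) = nst \<delta> (nst \<delta> q0 (snd t) \<rho> ?w) (stub (snd t ?w)) (\<chi> ?w) (pre ?\<pi> i)" for i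
    proof -
      have "nst \<delta> q0 (snd t) \<rho>' (pre \<pi> (i + K)) = nst \<delta> (nst \<delta> q0 (snd t) \<rho>' ?w) (\<lambda>u. snd t (?w @ u)) (\<lambda>u. \<rho>' (?w @ u)) (pre ?\<pi> i)"
        unfolding add.commute[of i K] pre_add by (rule nst_append)
      also have "\<dots> = nst \<delta> (nst \<delta> q0 (snd t) \<rho> ?w) (stub (snd t ?w)) (\<chi> ?w) (pre ?\<pi> i)"
        unfolding nw stub
      proof (rule nst_cong)
        fix p z assume pz: "pre ?\<pi> i = p @ z"
        then have "p = take (length p) (pre ?\<pi> i)" by simp
        also have "\<dots> = pre ?\<pi> (length p)" by (rule pre_take) (metis pz length_append length_pre le_add1)
        finally have "p = pre ?\<pi> (length p)" .
        then show "stub (snd t ?w) p = stub (snd t ?w) p \<and> \<rho>' (?w @ p) = \<chi> ?w p" using shift[of "length p"] by metis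
      qed
      finally show ?thesis .
    qed
    have "parity_ok (\<lambda>i. pr (nst \<delta> (nst \<delta> q0 (snd t) \<rho> ?w) (stub (snd t ?w)) (\<chi> ?w) (pre ?\<pi> i)))"
      by (rule conjunct2[OF comp_run_T, rule_format]) (rule \<pi>)
    then have "parity_ok (\<lambda>i. pr (nst \<delta> q0 (snd t) \<rho>' (pre \<pi> (i + K))))" unfolding step .
    then show ?thesis using parity_ok_shift[of "\<lambda>i. pr (nst \<delta> q0 (snd t) \<rho>' (pre \<pi> i))" K] by blast
  qed
  then show ?thesis unfolding accq_def using \<rho>R by blast
qed

end

lemma wf_shape:
  assumes "wf_tree False ar \<Sigma> n t" "\<forall>a\<in>\<Sigma>. ar a \<le> N"
  shows "shape N \<Sigma> n (snd t)"
proof -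
  have "snd t v \<in> labels \<Sigma> n" for v
  proof (cases "snd t v")
    case (Some x)
    then show ?thesis using wf_Inl[OF assms(1), of v] wf_Inr[OF assms(1), of v]
      by (cases x) (auto simp: labels_def)
  qed (simp add: labels_def)
  moreover have "v \<in> lists {..<N}" if "snd t v \<noteq> None" for v
    using that
  proof (induction v rule: rev_induct)
    case (snoc d v)
    obtain a where "a \<in> \<Sigma>" "d < ar a" using wf_prefix(2)[OF assms(1) snoc.prems] by auto
    then have "d < N" using assms(2) by (auto simp: less_le_trans)
    moreover have "v \<in> lists {..<N}" using snoc.IH wf_prefix(1)[OF assms(1) snoc.prems] by blast
    ultimately show ?case by simp
  qed simp
  ultimately show ?thesis unfolding shape_def by blast
qed

text \<open>The closure of \<open>Q\<close> is stated for letters only, so the automaton can be run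
  on labels of any sort although the sentence is evaluated at sort \<open>n0\<close>.\<close>

theorem sentence_prun:
  fixes \<Sigma> :: "'c set" and \<phi> :: "'c mso"
  assumes \<Sigma>: "finite \<Sigma>" and N: "0 < N" and arN: "\<forall>a\<in>\<Sigma>. ar a \<le> N"
  obtains \<delta> :: "nat \<Rightarrow> ('c + nat) option \<times> nat \<times> nat \<Rightarrow> nat" and pr :: "nat \<Rightarrow> nat" and M and R Q E :: "nat set" and q0 and U
  where "finite Q" "finite R" "R \<noteq> {}" "q0 \<in> Q" "\<forall>q\<in>Q. \<forall>a\<in>\<Sigma>. \<forall>r\<in>R. \<forall>d<N. \<delta> q (Some (Inl a), r, d) \<in> Q" "\<forall>q. pr q \<le> M"
    "U \<subseteq> {..<n0} \<times> Q \<times> {..M}"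
    "\<forall>t. wf_tree False ar \<Sigma> n0 t \<longrightarrow> models t \<phi> = (\<exists>\<rho>. prun \<delta> pr N R E (snd t) q0 U \<rho>)"
proof -
  obtain P where tP: "trec N (labels \<Sigma> n0) P"
    and P: "\<forall>t. shape N \<Sigma> n0 t \<longrightarrow> t [] \<noteq> None \<longrightarrow> sat t (\<lambda>_. []) (\<lambda>_. {}) \<phi> = P t"
    using sentence_trec[OF \<Sigma> N] by blast
  obtain R :: "nat set" and L where R: "finite R" "R \<noteq> {}" and d: "drec (labels \<Sigma> n0 \<times> R \<times> {..<N}) L"
    and PL: "\<And>\<tau>. (\<And>v. \<tau> v \<in> labels \<Sigma> n0) \<Longrightarrow> P \<tau> = tacc N R L \<tau>" using trecE[OF tP] by metis
  obtain Q :: "nat set" and q0 \<delta> pr M where Q: "finite Q" "q0 \<in> Q" "\<And>q a. q \<in> Q \<Longrightarrow> a \<in> labels \<Sigma> n0 \<times> R \<times> {..<N} \<Longrightarrow> \<delta> q a \<in> Q"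
    "\<And>w. (\<And>i. w i \<in> labels \<Sigma> n0 \<times> R \<times> {..<N}) \<Longrightarrow> L w = parity_ok (\<lambda>i. pr (drun \<delta> q0 w i))" "\<And>q. pr q \<le> (M::nat)"
    using drecE[OF d] by metis
  have Qcl: "\<forall>q\<in>Q. \<forall>a\<in>\<Sigma>. \<forall>r\<in>R. \<forall>d<N. \<delta> q (Some (Inl a), r, d) \<in> Q"
    using Q(3) by (auto simp: labels_def)
  have prM: "\<forall>q. pr q \<le> M" using Q(5) by blast
  have eq: "models t \<phi> = (\<exists>\<rho>. prun \<delta> pr N R (dead_states \<delta> pr N R) (snd t) q0 (leaf_bound \<delta> pr N M n0 R Q) \<rho>)"
    if t: "wf_tree False ar \<Sigma> n0 t" for t
  proof -
    have sh: "shape N \<Sigma> n0 (snd t)" by (rule wf_shape[OF t arN])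
    then have lab: "snd t v \<in> labels \<Sigma> n0" for v unfolding shape_def by blast
    have "snd t [] \<noteq> None" using wf_root[OF t] by auto
    then have "models t \<phi> = P (snd t)" unfolding models_def using P sh by blast
    also have "\<dots> = tacc N R L (snd t)" by (rule PL[OF lab])
    also have "\<dots> = accq \<delta> pr N R q0 (snd t)"
    proof -
      have L: "L (tword (snd t) \<rho> \<pi>) = parity_ok (\<lambda>i. pr (nst \<delta> q0 (snd t) \<rho> (pre \<pi> i)))"
        if "\<forall>v. \<rho> v \<in> R" "\<forall>i. \<pi> i < N" for \<rho> \<pi>
        using Q(4)[of "tword (snd t) \<rho> \<pi>"] that lab by (simp add: tword_def nst_run[symmetric])
      show ?thesis unfolding tacc_def accq_def
      proof (rule ex_cong1, rule conj_cong[OF refl])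
        fix \<rho> :: "nat list \<Rightarrow> nat" assume "\<forall>v. \<rho> v \<in> R"
        then show "(\<forall>\<pi>. (\<forall>i. \<pi> i < N) \<longrightarrow> L (tword (snd t) \<rho> \<pi>))
            = (\<forall>\<pi>. (\<forall>i. \<pi> i < N) \<longrightarrow> parity_ok (\<lambda>i. pr (nst \<delta> q0 (snd t) \<rho> (pre \<pi> i))))"
          using L by simp
      qed
    qed
    also have "\<dots> = (\<exists>\<rho>. prun \<delta> pr N R (dead_states \<delta> pr N R) (snd t) q0 (leaf_bound \<delta> pr N M n0 R Q) \<rho>)"
    proof
      show "\<exists>\<rho>. prun \<delta> pr N R (dead_states \<delta> pr N R) (snd t) q0 (leaf_bound \<delta> pr N M n0 R Q) \<rho>" if "accq \<delta> pr N R q0 (snd t)"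
        by (rule accq_imp_prun[OF Qcl arN prM Q(2) R(2) t that])
      show "accq \<delta> pr N R q0 (snd t)" if "\<exists>\<rho>. prun \<delta> pr N R (dead_states \<delta> pr N R) (snd t) q0 (leaf_bound \<delta> pr N M n0 R Q) \<rho>"
        using that by (elim exE) (rule prun_imp_accq[OF Qcl arN prM Q(2) R(2) t])
    qed
    finally show ?thesis .
  qed
  have sub: "leaf_bound \<delta> pr N M n0 R Q \<subseteq> {..<n0} \<times> Q \<times> {..M}"
    unfolding leaf_bound_def by auto
  show thesis by (rule that[OF Q(1) R Q(2) Qcl prM sub]) (use eq in blast)
qed

section \<open>From partial runs to monadic second-order logic\<close>

definition mall1 :: "nat \<Rightarrow> 'c mso \<Rightarrow> 'c mso" where "mall1 x \<phi> = MNeg (MEx1 x (MNeg \<phi>))"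
definition mall2 :: "nat \<Rightarrow> 'c mso \<Rightarrow> 'c mso" where "mall2 X \<phi> = MNeg (MEx2 X (MNeg \<phi>))"
definition mimp :: "'c mso \<Rightarrow> 'c mso \<Rightarrow> 'c mso" where "mimp \<phi> \<psi> = MNeg (MConj \<phi> (MNeg \<psi>))"
text \<open>The unit is a valid sentence without free variables, so that empty conjunctions remain
  closed.\<close>

definition mconjs :: "'c mso list \<Rightarrow> 'c mso" where "mconjs xs = foldr MConj xs (mall1 0 (MEq 0 0))"
definition mdisjs :: "'c mso list \<Rightarrow> 'c mso" where "mdisjs xs = MNeg (mconjs (map MNeg xs))"

primrec mexs :: "nat \<Rightarrow> 'c mso \<Rightarrow> 'c mso" where
  "mexs 0 \<phi> = \<phi>"
| "mexs (Suc k) \<phi> = MEx2 k (mexs k \<phi>)"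

lemma sat_mall1 [simp]: "sat t f F (mall1 x \<phi>) \<longleftrightarrow> (\<forall>v. t v \<noteq> None \<longrightarrow> sat t (f(x := v)) F \<phi>)"
  unfolding mall1_def sat.simps by blast
lemma sat_mall2 [simp]: "sat t f F (mall2 X \<phi>) \<longleftrightarrow> (\<forall>V. V \<subseteq> {v. t v \<noteq> None} \<longrightarrow> sat t f (F(X := V)) \<phi>)"
  unfolding mall2_def sat.simps by blast
lemma sat_mimp [simp]: "sat t f F (mimp \<phi> \<psi>) \<longleftrightarrow> (sat t f F \<phi> \<longrightarrow> sat t f F \<psi>)"
  by (simp add: mimp_def)
lemma sat_mconjs [simp]: "sat t f F (mconjs xs) \<longleftrightarrow> (\<forall>\<phi>\<in>set xs. sat t f F \<phi>)"
  by (induction xs) (simp_all add: mconjs_def)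
lemma sat_mdisjs [simp]: "sat t f F (mdisjs xs) \<longleftrightarrow> (\<exists>\<phi>\<in>set xs. sat t f F \<phi>)"
  by (simp add: mdisjs_def)

lemma sat_mexs: "sat t f F (mexs k \<phi>) \<longleftrightarrow>
   (\<exists>G. (\<forall>i<k. G i \<subseteq> {v. t v \<noteq> None}) \<and> sat t f (\<lambda>i. if i < k then G i else F i) \<phi>)"
proof (induction k arbitrary: F)
  case (Suc k)
  have e: "(\<lambda>i. if i < k then G i else (F(k := V)) i) = (\<lambda>i. if i < Suc k then (G(k := V)) i else F i)" for G V
    by (auto simp: fun_eq_iff less_Suc_eq)
  show ?case
  proof
    assume "sat t f F (mexs (Suc k) \<phi>)"
    then obtain V G where V: "V \<subseteq> {v. t v \<noteq> None}" "\<forall>i<k. G i \<subseteq> {v. t v \<noteq> None}"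
      "sat t f (\<lambda>i. if i < k then G i else (F(k := V)) i) \<phi>" by (auto simp: Suc)
    have "\<forall>i<Suc k. (G(k := V)) i \<subseteq> {v. t v \<noteq> None}" using V(1,2) by (simp add: less_Suc_eq)
    then show "\<exists>G. (\<forall>i<Suc k. G i \<subseteq> {v. t v \<noteq> None}) \<and> sat t f (\<lambda>i. if i < Suc k then G i else F i) \<phi>"
      using V(3) unfolding e by (intro exI[of _ "G(k := V)"]) (rule conjI)
  next
    assume "\<exists>G. (\<forall>i<Suc k. G i \<subseteq> {v. t v \<noteq> None}) \<and> sat t f (\<lambda>i. if i < Suc k then G i else F i) \<phi>"
    then obtain G where G: "\<forall>i<Suc k. G i \<subseteq> {v. t v \<noteq> None}" "sat t f (\<lambda>i. if i < Suc k then G i else F i) \<phi>" by blast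
    have "sat t f (\<lambda>i. if i < k then G i else (F(k := G k)) i) \<phi>" unfolding e using G(2) by (simp only: fun_upd_triv)
    then have "sat t f (F(k := G k)) (mexs k \<phi>)" unfolding Suc using G(1) by (intro exI[of _ G]) simp
    then show "sat t f F (mexs (Suc k) \<phi>)" using G(1) by (simp only: mexs.simps sat.simps) (rule exI[of _ "G k"], simp)
  qed
qed simp

lemma fv_simps [simp]:
  "fv1 (mall1 x \<phi>) = fv1 \<phi> - {x}" "fv2 (mall1 x \<phi>) = fv2 \<phi>" "mso_wf \<Sigma> n (mall1 x \<phi>) = mso_wf \<Sigma> n \<phi>"
  "fv1 (mall2 X \<phi>) = fv1 \<phi>" "fv2 (mall2 X \<phi>) = fv2 \<phi> - {X}" "mso_wf \<Sigma> n (mall2 X \<phi>) = mso_wf \<Sigma> n \<phi>"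
  "fv1 (mimp \<phi> \<psi>) = fv1 \<phi> \<union> fv1 \<psi>" "fv2 (mimp \<phi> \<psi>) = fv2 \<phi> \<union> fv2 \<psi>" "mso_wf \<Sigma> n (mimp \<phi> \<psi>) = (mso_wf \<Sigma> n \<phi> \<and> mso_wf \<Sigma> n \<psi>)"
  by (auto simp: mall1_def mall2_def mimp_def)

lemma fv_mconjs [simp]: "fv1 (mconjs xs) = \<Union> (fv1 ` set xs)" "fv2 (mconjs xs) = \<Union> (fv2 ` set xs)"
  "mso_wf \<Sigma> n (mconjs xs) = (\<forall>\<phi>\<in>set xs. mso_wf \<Sigma> n \<phi>)"
  by (induction xs) (auto simp: mconjs_def)

lemma fv_mdisjs [simp]: "fv1 (mdisjs xs) = \<Union> (fv1 ` set xs)" "fv2 (mdisjs xs) = \<Union> (fv2 ` set xs)"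
  "mso_wf \<Sigma> n (mdisjs xs) = (\<forall>\<phi>\<in>set xs. mso_wf \<Sigma> n \<phi>)"
  by (auto simp: mdisjs_def)

lemma fv_mexs [simp]: "fv1 (mexs k \<phi>) = fv1 \<phi>" "fv2 (mexs k \<phi>) = fv2 \<phi> - {..<k}" "mso_wf \<Sigma> n (mexs k \<phi>) = mso_wf \<Sigma> n \<phi>"
  by (induction k) auto

text \<open>A labelling \<open>\<kappa>\<close> with values in the list \<open>Ls\<close> is encoded by the sets \<open>F i = {v. \<kappa> v = Ls ! i}\<close>.\<close>

definition mlab :: "'a list \<Rightarrow> ('a \<Rightarrow> bool) \<Rightarrow> nat \<Rightarrow> 'c mso" where
  "mlab Ls P x = mdisjs (map (\<lambda>i. MMem x i) (filter (\<lambda>i. P (Ls ! i)) [0..<length Ls]))"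

definition lrep :: "(nat list \<Rightarrow> ('c + nat) option) \<Rightarrow> (nat \<Rightarrow> nat list set) \<Rightarrow> 'a list \<Rightarrow> (nat list \<Rightarrow> 'a) \<Rightarrow> bool" where
  "lrep t F Ls \<kappa> \<longleftrightarrow> (\<forall>v. t v \<noteq> None \<longrightarrow> \<kappa> v \<in> set Ls \<and> (\<forall>P. (\<exists>i<length Ls. P (Ls ! i) \<and> v \<in> F i) = P (\<kappa> v)))"

lemma sat_mlab:
  assumes "lrep t F Ls \<kappa>" "t (f x) \<noteq> None"
  shows "sat t f F (mlab Ls P x) \<longleftrightarrow> P (\<kappa> (f x))"
  using assms unfolding lrep_def mlab_def by fastforce

lemma fv_mlab: "y \<in> fv1 (mlab Ls P x) \<Longrightarrow> y = x" "i \<in> fv2 (mlab Ls P x) \<Longrightarrow> i < length Ls"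
  by (auto simp: mlab_def split: if_splits)

lemma wf_mlab [simp]: "mso_wf \<Sigma> n (mlab Ls P x)"
  by (auto simp: mlab_def)

definition mfun :: "'a list \<Rightarrow> 'c mso" where
  "mfun Ls = MConj (mall1 0 (mlab Ls (\<lambda>_. True) 0))
     (mconjs (map (\<lambda>(i, j). mall1 0 (MNeg (MConj (MMem 0 i) (MMem 0 j))))
        (filter (\<lambda>(i, j). i \<noteq> j) (List.product [0..<length Ls] [0..<length Ls]))))"

lemma mfun_lrep:
  assumes "sat t f F (mfun Ls)"
  shows "\<exists>\<kappa>. lrep t F Ls \<kappa>"
proof -
  have ex: "\<exists>i<length Ls. v \<in> F i" if "t v \<noteq> None" for v
  proof -
    have "sat t f F (mall1 0 (mlab Ls (\<lambda>_. True) 0))" using assms unfolding mfun_def sat.simps by (rule conjunct1)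
    then have "sat t (f(0 := v)) F (mlab Ls (\<lambda>_. True) 0)" using that unfolding sat_mall1 by blast
    then show ?thesis by (auto simp: mlab_def)
  qed
  have un: "i = j" if "t v \<noteq> None" "i < length Ls" "j < length Ls" "v \<in> F i" "v \<in> F j" for v i j
  proof (rule ccontr)
    assume "i \<noteq> j"
    then have "(i, j) \<in> set (filter (\<lambda>(i, j). i \<noteq> j) (List.product [0..<length Ls] [0..<length Ls]))" using that by simp
    then have "sat t f F (mall1 0 (MNeg (MConj (MMem 0 i) (MMem 0 j))))" using assms unfolding mfun_def by force
    then show False using that by simp
  qed
  define \<kappa> where "\<kappa> v = Ls ! (SOME i. i < length Ls \<and> v \<in> F i)" for v
  have "lrep t F Ls \<kappa>" unfolding lrep_def
  proof (intro allI impI conjI)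
    fix v assume v: "t v \<noteq> None"
    obtain i where i: "i < length Ls" "v \<in> F i" using ex[OF v] by blast
    have l: "\<kappa> v = Ls ! i" unfolding \<kappa>_def
      by (rule arg_cong[where f = "(!) Ls"], rule some_equality) (use i un[OF v] in blast)+
    show "\<kappa> v \<in> set Ls" using l i(1) by simp
    show "(\<exists>i<length Ls. P (Ls ! i) \<and> v \<in> F i) = P (\<kappa> v)" for P using l i un[OF v] by metis
  qed
  then show ?thesis by blast
qed

lemma lrep_mfun:
  fixes \<kappa> :: "nat list \<Rightarrow> 'a" and t :: "nat list \<Rightarrow> ('b + nat) option"
  assumes "\<And>v. t v \<noteq> None \<Longrightarrow> \<kappa> v \<in> set Ls" "distinct Ls"
  defines "G \<equiv> \<lambda>i. {v. t v \<noteq> None \<and> i < length Ls \<and> Ls ! i = \<kappa> v}"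
  shows "lrep t (\<lambda>i. if i < length Ls then G i else F i) Ls \<kappa>" "sat t f (\<lambda>i. if i < length Ls then G i else F i) (mfun Ls)"
proof -
  show r: "lrep t (\<lambda>i. if i < length Ls then G i else F i) Ls \<kappa>" unfolding lrep_def
  proof (intro allI impI conjI)
    fix v assume v: "t v \<noteq> None"
    show l: "\<kappa> v \<in> set Ls" by (rule assms(1)[OF v])
    show "(\<exists>i<length Ls. P (Ls ! i) \<and> v \<in> (if i < length Ls then G i else F i)) = P (\<kappa> v)" for P
    proof -
      obtain k where k: "k < length Ls" "Ls ! k = \<kappa> v" using l unfolding in_set_conv_nth by blast
      have "(i < length Ls \<and> P (Ls ! i) \<and> v \<in> (if i < length Ls then G i else F i)) \<longleftrightarrow> (i < length Ls \<and> Ls ! i = \<kappa> v \<and> P (\<kappa> v))" for i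
        using v unfolding G_def by auto
      then show ?thesis using k by blast
    qed
  qed
  show "sat t f (\<lambda>i. if i < length Ls then G i else F i) (mfun Ls)"
    unfolding mfun_def sat.simps sat_mall1 sat_mconjs
  proof (intro conjI allI impI ballI)
    fix v assume "t v \<noteq> None"
    then show "sat t (f(0 := v)) (\<lambda>i. if i < length Ls then G i else F i) (mlab Ls (\<lambda>_. True) 0)"
      using sat_mlab[OF r, of "f(0 := v)" 0 "\<lambda>_. True"] by simp
  next
    fix \<phi> :: "'b mso" assume "\<phi> \<in> set (map (\<lambda>(i, j). mall1 0 (MNeg (MConj (MMem 0 i) (MMem 0 j))))
        (filter (\<lambda>(i, j). i \<noteq> j) (List.product [0..<length Ls] [0..<length Ls])))"
    then obtain i j where ij: "\<phi> = mall1 0 (MNeg (MConj (MMem 0 i) (MMem 0 j)))" "i < length Ls" "j < length Ls" "i \<noteq> j"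
      by auto
    have "\<not> (v \<in> G i \<and> v \<in> G j)" for v
    proof
      assume "v \<in> G i \<and> v \<in> G j"
      then have "Ls ! i = Ls ! j" unfolding G_def by simp
      then show False using nth_eq_iff_index_eq[OF assms(2) ij(2,3)] ij(4) by blast
    qed
    then show "sat t f (\<lambda>i. if i < length Ls then G i else F i) \<phi>" using ij by simp
  qed
qed

section \<open>Branches and the parity condition as formulae\<close>

text \<open>Infinite branches are the nonempty prefix-closed chains without a last element; the last
  conjunct excludes finite paths, to which the parity condition does not apply.\<close>

definition mbranch :: "nat \<Rightarrow> 'c mso" where
  "mbranch Y = mconjs [mall1 0 (mimp (MRoot 0) (MMem 0 Y)),
     mall1 0 (mall1 1 (mimp (MConj (MMem 0 Y) (MMem 1 Y)) (mdisjs [MLeq 0 1, MLeq 1 0]))),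
     mall1 0 (mall1 1 (mimp (MConj (MMem 1 Y) (MLeq 0 1)) (MMem 0 Y))),
     mall1 0 (mimp (MMem 0 Y) (MEx1 1 (MConj (MMem 1 Y) (MConj (MLeq 0 1) (MNeg (MEq 0 1))))))]"

text \<open>A prefix-closed chain without a last element has exactly one member of each length, and
  the members of lengths \<open>i\<close> and \<open>Suc i\<close> differ by one direction.\<close>

lemma branch_set:
  assumes root: "[] \<in> V" and comp_run_T: "\<And>u v. u \<in> V \<Longrightarrow> v \<in> V \<Longrightarrow> (\<exists>z. v = u @ z) \<or> (\<exists>z. u = v @ z)"
    and cl: "\<And>u z. u @ z \<in> V \<Longrightarrow> u \<in> V" and ex: "\<And>u. u \<in> V \<Longrightarrow> \<exists>z. u @ z \<in> V \<and> z \<noteq> []"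
  shows "\<exists>\<pi>. V = range (pre \<pi>)"
proof -
  have "\<exists>v\<in>V. length v = i" for i
  proof (induction i)
    case (Suc i)
    then obtain v where v: "v \<in> V" "length v = i" by blast
    obtain z where z: "v @ z \<in> V" "z \<noteq> []" using ex[OF v(1)] by blast
    have "(v @ [hd z]) @ tl z \<in> V" using z by simp
    then have "v @ [hd z] \<in> V" by (rule cl)
    then show ?case using v(2) by (intro bexI[of _ "v @ [hd z]"]) simp_all
  qed (use root in auto)
  then obtain h where h: "\<And>i. h i \<in> V" "\<And>i. length (h i) = i" by metis
  have un: "u = v" if "u \<in> V" "v \<in> V" "length u = length v" for u v using comp_run_T[OF that(1,2)] that(3) by auto
  define \<pi> where "\<pi> i = h (Suc i) ! i" for i
  have step: "h (Suc i) = h i @ [\<pi> i]" for i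
  proof -
    have "take i (h (Suc i)) @ drop i (h (Suc i)) \<in> V" using h(1) by simp
    then have "take i (h (Suc i)) \<in> V" by (rule cl)
    then have "take i (h (Suc i)) = h i" using un h by simp
    moreover have "h (Suc i) = take i (h (Suc i)) @ [h (Suc i) ! i]"
      using take_Suc_conv_app_nth[of i "h (Suc i)"] h(2)[of "Suc i"] by simp
    ultimately show ?thesis unfolding \<pi>_def by metis
  qed
  have hp: "h i = pre \<pi> i" for i
  proof (induction i)
    case 0
    then show ?case using h(2)[of 0] by simp
  next
    case (Suc i)
    then show ?case using step by (simp add: pre_Suc)
  qed
  have "v = pre \<pi> (length v)" if "v \<in> V" for v using un[OF that h(1)[of "length v"]] h(2) hp by simp
  then have "V = range (pre \<pi>)" using h(1) hp by (auto simp: image_iff)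
  then show ?thesis by blast
qed

lemma pre_prefix: "(\<exists>z. pre \<pi> j = pre \<pi> i @ z) \<longleftrightarrow> i \<le> j"
proof
  assume "\<exists>z. pre \<pi> j = pre \<pi> i @ z"
  then obtain z where "pre \<pi> j = pre \<pi> i @ z" by blast
  then have "length (pre \<pi> j) = length (pre \<pi> i) + length z" by simp
  then show "i \<le> j" by simp
next
  assume "i \<le> j"
  then show "\<exists>z. pre \<pi> j = pre \<pi> i @ z" using pre_add[of \<pi> i "j - i"] by (intro exI[of _ "pre (\<lambda>z. \<pi> (i + z)) (j - i)"]) simp
qed

lemma sat_mbranch:
  assumes t: "wf_tree b ar \<Sigma> n t" and V: "F Y \<subseteq> {v. snd t v \<noteq> None}"
  shows "sat (snd t) f F (mbranch Y) \<longleftrightarrow> (\<exists>\<pi>. F Y = range (pre \<pi>))"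
proof -
  let ?V = "F Y"
  have root: "snd t [] \<noteq> None" using wf_root[OF t] by auto
  have "sat (snd t) f F (mbranch Y) \<longleftrightarrow> [] \<in> ?V \<and> (\<forall>u\<in>?V. \<forall>v\<in>?V. (\<exists>z. v = u @ z) \<or> (\<exists>z. u = v @ z))
     \<and> (\<forall>u. \<forall>v\<in>?V. snd t u \<noteq> None \<longrightarrow> (\<exists>z. v = u @ z) \<longrightarrow> u \<in> ?V) \<and> (\<forall>u\<in>?V. \<exists>v\<in>?V. (\<exists>z. v = u @ z) \<and> u \<noteq> v)" (is "_ \<longleftrightarrow> ?c1 \<and> ?c2 \<and> ?c3 \<and> ?c4")
  proof -
    have 1: "sat (snd t) f F (mall1 0 (mimp (MRoot 0) (MMem 0 Y))) \<longleftrightarrow> ?c1" using root by auto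
    have 2: "sat (snd t) f F (mall1 0 (mall1 1 (mimp (MConj (MMem 0 Y) (MMem 1 Y)) (mdisjs [MLeq 0 1, MLeq 1 0])))) \<longleftrightarrow>
      (\<forall>u. snd t u \<noteq> None \<longrightarrow> (\<forall>v. snd t v \<noteq> None \<longrightarrow> u \<in> ?V \<and> v \<in> ?V \<longrightarrow> (\<exists>z. v = u @ z) \<or> (\<exists>z. u = v @ z)))"
      by (simp del: not_None_eq)
    have 2: "sat (snd t) f F (mall1 0 (mall1 1 (mimp (MConj (MMem 0 Y) (MMem 1 Y)) (mdisjs [MLeq 0 1, MLeq 1 0])))) \<longleftrightarrow> ?c2"
      unfolding 2 using V by blast
    have 3: "sat (snd t) f F (mall1 0 (mall1 1 (mimp (MConj (MMem 1 Y) (MLeq 0 1)) (MMem 0 Y)))) \<longleftrightarrow>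
      (\<forall>u. snd t u \<noteq> None \<longrightarrow> (\<forall>v. snd t v \<noteq> None \<longrightarrow> v \<in> ?V \<and> (\<exists>z. v = u @ z) \<longrightarrow> u \<in> ?V))"
      by (simp del: not_None_eq)
    have 3: "sat (snd t) f F (mall1 0 (mall1 1 (mimp (MConj (MMem 1 Y) (MLeq 0 1)) (MMem 0 Y)))) \<longleftrightarrow> ?c3"
      unfolding 3 using V by blast
    have 4: "sat (snd t) f F (mall1 0 (mimp (MMem 0 Y) (MEx1 1 (MConj (MMem 1 Y) (MConj (MLeq 0 1) (MNeg (MEq 0 1))))))) \<longleftrightarrow>
      (\<forall>u. snd t u \<noteq> None \<longrightarrow> u \<in> ?V \<longrightarrow> (\<exists>v. snd t v \<noteq> None \<and> v \<in> ?V \<and> (\<exists>z. v = u @ z) \<and> u \<noteq> v))"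
      by (simp del: not_None_eq)
    have 4: "sat (snd t) f F (mall1 0 (mimp (MMem 0 Y) (MEx1 1 (MConj (MMem 1 Y) (MConj (MLeq 0 1) (MNeg (MEq 0 1))))))) \<longleftrightarrow> ?c4"
    proof -
      have "(\<forall>u. D u \<longrightarrow> u \<in> X \<longrightarrow> (\<exists>v. D v \<and> v \<in> X \<and> C u v)) \<longleftrightarrow> (\<forall>u\<in>X. \<exists>v\<in>X. C u v)"
        if "X \<subseteq> {v. D v}" for D X and C :: "nat list \<Rightarrow> nat list \<Rightarrow> bool" using that by blast
      from this[of ?V "\<lambda>v. snd t v \<noteq> None" "\<lambda>u v. (\<exists>z. v = u @ z) \<and> u \<noteq> v", OF V]
      show ?thesis unfolding 4 .
    qed
    show ?thesis unfolding mbranch_def by (simp only: sat_mconjs list.set ball_simps 1 2 3 4 simp_thms)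
  qed
  also have "\<dots> \<longleftrightarrow> (\<exists>\<pi>. ?V = range (pre \<pi>))"
  proof
    assume c: "?c1 \<and> ?c2 \<and> ?c3 \<and> ?c4"
    note c1 = conjunct1[OF c] and c2 = conjunct1[OF conjunct2[OF c]]
      and c3 = conjunct1[OF conjunct2[OF conjunct2[OF c]]] and c4 = conjunct2[OF conjunct2[OF conjunct2[OF c]]]
    show "\<exists>\<pi>. ?V = range (pre \<pi>)"
    proof (rule branch_set)
      show "[] \<in> ?V" by (rule c1)
      show "(\<exists>z. v = u @ z) \<or> (\<exists>z. u = v @ z)" if "u \<in> ?V" "v \<in> ?V" for u v using c2 that by blast
      show "u \<in> ?V" if uz: "u @ z \<in> ?V" for u z
      proof -
        have "snd t (u @ z) \<noteq> None" using uz V by blast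
        then have "snd t u \<noteq> None" by (rule wf_prefix(1)[OF t])
        then show ?thesis using c3 uz by blast
      qed
      show "\<exists>z. u @ z \<in> ?V \<and> z \<noteq> []" if uV: "u \<in> ?V" for u
      proof -
        obtain v z where v: "v \<in> ?V" "v = u @ z" "u \<noteq> v" using bspec[OF c4 uV] by blast
        have "z \<noteq> []" using v(2,3) by simp
        then show ?thesis using v(1,2) by blast
      qed
    qed
  next
    assume "\<exists>\<pi>. ?V = range (pre \<pi>)"
    then obtain \<pi> where \<pi>: "?V = range (pre \<pi>)" by blast
    have c1: ?c1 unfolding \<pi> by (rule range_eqI[of _ _ 0]) simp
    have c2: ?c2 unfolding \<pi> by (auto simp: pre_prefix)
    have c4: ?c4 unfolding \<pi>
    proof
      fix u assume "u \<in> range (pre \<pi>)"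
      then obtain i where i: "u = pre \<pi> i" by blast
      have e: "pre \<pi> (Suc i) = u @ [\<pi> i]" unfolding i by (rule pre_Suc)
      show "\<exists>v\<in>range (pre \<pi>). (\<exists>z. v = u @ z) \<and> u \<noteq> v"
      proof (rule bexI[OF _ rangeI[of "pre \<pi>" "Suc i"]])
        show "(\<exists>z. pre \<pi> (Suc i) = u @ z) \<and> u \<noteq> pre \<pi> (Suc i)" unfolding e by simp
      qed
    qed
    have c3: ?c3
    proof (intro allI ballI impI)
      fix u v assume "v \<in> ?V" "\<exists>z. v = u @ z"
      then obtain i z where iz: "pre \<pi> i = u @ z" unfolding \<pi> by auto
      then have l: "length u \<le> i" by (metis length_append length_pre le_add1)
      have "u = take (length u) (pre \<pi> i)" using iz by simp
      also have "\<dots> = pre \<pi> (length u)" by (rule pre_take[OF l])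
      finally show "u \<in> ?V" unfolding \<pi> by (rule range_eqI)
    qed
    show "?c1 \<and> ?c2 \<and> ?c3 \<and> ?c4" using c1 c2 c3 c4 by blast
  qed
  finally show ?thesis .
qed

text \<open>The two halves of \<open>lsup\<close> for each even \<open>k\<close> up to
  \<open>M\<close>, with nodes of the branch \<open>Y\<close> in place of indices.\<close>

definition mparity :: "'a list \<Rightarrow> ('a \<Rightarrow> nat) \<Rightarrow> nat \<Rightarrow> nat \<Rightarrow> 'c mso" where
  "mparity Ls pr M Y = mdisjs (map (\<lambda>k. MConj
      (mall1 0 (mimp (MMem 0 Y) (MEx1 1 (MConj (MMem 1 Y) (MConj (MLeq 0 1) (mlab Ls (\<lambda>l. pr l = k) 1))))))
      (MEx1 0 (MConj (MMem 0 Y) (mall1 1 (mimp (MConj (MMem 1 Y) (MLeq 0 1)) (mlab Ls (\<lambda>l. pr l \<le> k) 1))))))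
    (filter even [0..<Suc M]))"

lemma sat_mparity:
  assumes l: "lrep t F Ls \<kappa>" and Y: "F Y = range (pre \<pi>)" and d: "\<And>i. t (pre \<pi> i) \<noteq> None" and M: "\<And>l. pr l \<le> M"
  shows "sat t f F (mparity Ls pr M Y) \<longleftrightarrow> parity_ok (\<lambda>i. pr (\<kappa> (pre \<pi> i)))"
proof -
  let ?x = "\<lambda>i. pr (\<kappa> (pre \<pi> i))"
  have one: "sat t f F (mall1 0 (mimp (MMem 0 Y) (MEx1 1 (MConj (MMem 1 Y) (MConj (MLeq 0 1) (mlab Ls (\<lambda>l. pr l = k) 1))))))
     \<longleftrightarrow> (\<forall>m. \<exists>i\<ge>m. ?x i = k)" for k
  proof -
    have "sat t f F (mall1 0 (mimp (MMem 0 Y) (MEx1 1 (MConj (MMem 1 Y) (MConj (MLeq 0 1) (mlab Ls (\<lambda>l. pr l = k) 1))))))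
      \<longleftrightarrow> (\<forall>v. t v \<noteq> None \<longrightarrow> v \<in> F Y \<longrightarrow> (\<exists>u. t u \<noteq> None \<and> u \<in> F Y \<and> (\<exists>z. u = v @ z) \<and> pr (\<kappa> u) = k))"
      using sat_mlab[OF l] by (simp cong: conj_cong)
    also have "\<dots> \<longleftrightarrow> (\<forall>m. \<exists>i. (\<exists>z. pre \<pi> i = pre \<pi> m @ z) \<and> ?x i = k)" unfolding Y using d by blast
    finally show ?thesis unfolding pre_prefix by simp
  qed
  have two: "sat t f F (MEx1 0 (MConj (MMem 0 Y) (mall1 1 (mimp (MConj (MMem 1 Y) (MLeq 0 1)) (mlab Ls (\<lambda>l. pr l \<le> k) 1)))))
     \<longleftrightarrow> (\<exists>m. \<forall>i\<ge>m. ?x i \<le> k)" for k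
  proof -
    have "sat t f F (MEx1 0 (MConj (MMem 0 Y) (mall1 1 (mimp (MConj (MMem 1 Y) (MLeq 0 1)) (mlab Ls (\<lambda>l. pr l \<le> k) 1)))))
      \<longleftrightarrow> (\<exists>v. t v \<noteq> None \<and> v \<in> F Y \<and> (\<forall>u. t u \<noteq> None \<longrightarrow> u \<in> F Y \<and> (\<exists>z. u = v @ z) \<longrightarrow> pr (\<kappa> u) \<le> k))"
      using sat_mlab[OF l] by (simp cong: imp_cong)
    also have "\<dots> \<longleftrightarrow> (\<exists>m. \<forall>i. (\<exists>z. pre \<pi> i = pre \<pi> m @ z) \<longrightarrow> ?x i \<le> k)" unfolding Y using d by blast
    finally show ?thesis unfolding pre_prefix by simp
  qed
  have "sat t f F (mparity Ls pr M Y) \<longleftrightarrow> (\<exists>k\<in>set (filter even [0..<Suc M]). (\<forall>m. \<exists>i\<ge>m. ?x i = k) \<and> (\<exists>m. \<forall>i\<ge>m. ?x i \<le> k))"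
    unfolding mparity_def sat_mdisjs set_map bex_simps sat.simps(9) one two ..
  also have "\<dots> \<longleftrightarrow> parity_ok ?x"
  proof -
    have "k \<in> set (filter even [0..<Suc M]) \<longleftrightarrow> even k \<and> k \<le> M" for k
      by (auto simp: less_Suc_eq_le simp del: upt_Suc)
    moreover have "k \<le> M" if "\<forall>m. \<exists>i\<ge>m. ?x i = k" for k using M that by blast
    ultimately show ?thesis unfolding parity_ok_def lsup_def by blast
  qed
  finally show ?thesis .
qed

lemma fv_mparity: "fv1 (mparity Ls pr M Y) = {}" "fv2 (mparity Ls pr M Y) \<subseteq> insert Y {..<length Ls}" "mso_wf \<Sigma> n (mparity Ls pr M Y)"
  by (auto simp: mparity_def dest: fv_mlab)

lemma fv_mbranch: "fv1 (mbranch Y) = {}" "fv2 (mbranch Y) = {Y}" "mso_wf \<Sigma> n (mbranch Y)"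
  by (auto simp: mbranch_def)

lemma fv_mfun: "fv1 (mfun Ls) = {}" "fv2 (mfun Ls) \<subseteq> {..<length Ls}" "mso_wf \<Sigma> n (mfun Ls)"
  by (auto simp: mfun_def dest: fv_mlab)

section \<open>Compositionality\<close>

text \<open>Set variables below \<open>length Ls\<close> carry a labelling by transition, state and
  maximal priority so far; the variable \<open>length Ls\<close> ranges over branches. State and
  maximum are part of the labelling so that their computation becomes a check from each address to
  its successors. Missing directions are those from \<open>ar a\<close> on.\<close>

definition runbody :: "('q \<Rightarrow> ('c + nat) option \<times> 'r \<times> nat \<Rightarrow> 'q) \<Rightarrow> ('q \<Rightarrow> nat) \<Rightarrow> nat \<Rightarrow> nat \<Rightarrow> 'q set \<Rightarrow> ('c \<Rightarrow> nat) \<Rightarrow>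
    ('r \<times> 'q \<times> nat) list \<Rightarrow> 'c list \<Rightarrow> nat \<Rightarrow> 'q \<Rightarrow> (nat \<times> 'q \<times> nat) set \<Rightarrow> 'c mso" where
  "runbody \<delta> pr N M E ar Ls as m q U = mconjs ([mfun Ls,
      mall1 0 (mimp (MRoot 0) (mlab Ls (\<lambda>l. fst (snd l) = q \<and> snd (snd l) = 0) 0)),
      mall2 (length Ls) (mimp (mbranch (length Ls)) (mparity Ls (\<lambda>l. pr (fst (snd l))) M (length Ls)))]
    @ map (\<lambda>(a, d, l). mall1 0 (mall1 1 (mimp (MConj (MLab a 0) (MConj (MSucc d 0 1) (mlab Ls (\<lambda>x. x = l) 0)))
        (mlab Ls (\<lambda>x. fst (snd x) = \<delta> (fst (snd l)) (Some (Inl a), fst l, d)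
           \<and> snd (snd x) = max (snd (snd l)) (pr (fst (snd l)))) 1)))) (List.product as (List.product [0..<N] Ls))
    @ map (\<lambda>j. mall1 0 (mimp (MQ j 0) (mlab Ls (\<lambda>l. (j, snd l) \<in> U) 0))) [0..<m]
    @ map (\<lambda>a. mall1 0 (mimp (MLab a 0) (mlab Ls (\<lambda>l. \<forall>d. ar a \<le> d \<longrightarrow> d < N \<longrightarrow> \<delta> (fst (snd l)) (Some (Inl a), fst l, d) \<in> E) 0))) as)"

definition runform :: "('q \<Rightarrow> ('c + nat) option \<times> 'r \<times> nat \<Rightarrow> 'q) \<Rightarrow> ('q \<Rightarrow> nat) \<Rightarrow> nat \<Rightarrow> nat \<Rightarrow> 'q set \<Rightarrow> ('c \<Rightarrow> nat) \<Rightarrow>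
    ('r \<times> 'q \<times> nat) list \<Rightarrow> 'c list \<Rightarrow> nat \<Rightarrow> 'q \<Rightarrow> (nat \<times> 'q \<times> nat) set \<Rightarrow> 'c mso" where
  "runform \<delta> pr N M E ar Ls as m q U = mexs (length Ls) (runbody \<delta> pr N M E ar Ls as m q U)"

lemma runform_MSO:
  assumes "set as \<subseteq> \<Sigma>"
  shows "(m, runform \<delta> pr N M E ar Ls as m q U) \<in> MSO \<Sigma>"
proof -
  have "fv1 (runform \<delta> pr N M E ar Ls as m q U) = {}"
    unfolding runform_def runbody_def by (auto simp: fv_mfun fv_mbranch fv_mparity dest: fv_mlab)
  moreover have "fv2 (runform \<delta> pr N M E ar Ls as m q U) = {}"
    using fv_mfun(2)[of Ls] fv_mparity(2)[of Ls "\<lambda>l. pr (fst (snd l))" M "length Ls"]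
    unfolding runform_def runbody_def by (auto simp: fv_mbranch dest: fv_mlab)
  moreover have "mso_wf \<Sigma> m (runform \<delta> pr N M E ar Ls as m q U)"
    using assms unfolding runform_def runbody_def by (auto simp: fv_mfun fv_mbranch fv_mparity)
  ultimately show ?thesis unfolding MSO_def by simp
qed

lemma lrep_upd:
  assumes "lrep t F Ls \<kappa>"
  shows "lrep t (F(length Ls := V)) Ls \<kappa>"
proof -
  have "(\<exists>i<length Ls. P (Ls ! i) \<and> v \<in> (F(length Ls := V)) i) = (\<exists>i<length Ls. P (Ls ! i) \<and> v \<in> F i)" for P v
    by (intro ex_cong1) auto
  then show ?thesis using assms unfolding lrep_def by simp
qed

context
  fixes \<delta> :: "'q \<Rightarrow> ('c + nat) option \<times> 'r \<times> nat \<Rightarrow> 'q" and pr :: "'q \<Rightarrow> nat" and N M m :: nat and R :: "'r set"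
    and E Q :: "'q set" and ar :: "'c \<Rightarrow> nat" and \<Sigma> :: "'c set" and t :: "'c tr"
    and Ls :: "('r \<times> 'q \<times> nat) list" and as :: "'c list" and q :: 'q and U :: "(nat \<times> 'q \<times> nat) set"
  assumes Qcl: "\<forall>q\<in>Q. \<forall>a\<in>\<Sigma>. \<forall>r\<in>R. \<forall>d<N. \<delta> q (Some (Inl a), r, d) \<in> Q"
    and arN: "\<forall>a\<in>\<Sigma>. ar a \<le> N" and prM: "\<forall>q. pr q \<le> M" and q: "q \<in> Q" and R: "R \<noteq> {}"
    and t: "wf_tree False ar \<Sigma> m t" and Ls: "set Ls = R \<times> Q \<times> {..M}" "distinct Ls" and as: "set as = \<Sigma>"
begin

abbreviation "tlab \<equiv> snd t"

definition grun :: "(nat list \<Rightarrow> 'r \<times> 'q \<times> nat) \<Rightarrow> bool" where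
  "grun \<kappa> \<longleftrightarrow> (fst (snd (\<kappa> [])) = q \<and> snd (snd (\<kappa> [])) = 0)
    \<and> (\<forall>\<pi>. (\<forall>i. tlab (pre \<pi> i) \<noteq> None) \<longrightarrow> parity_ok (\<lambda>i. pr (fst (snd (\<kappa> (pre \<pi> i))))))
    \<and> (\<forall>v a d. tlab v = Some (Inl a) \<longrightarrow> d < N \<longrightarrow> tlab (v @ [d]) \<noteq> None \<longrightarrow>
         fst (snd (\<kappa> (v @ [d]))) = \<delta> (fst (snd (\<kappa> v))) (Some (Inl a), fst (\<kappa> v), d)
         \<and> snd (snd (\<kappa> (v @ [d]))) = max (snd (snd (\<kappa> v))) (pr (fst (snd (\<kappa> v)))))
    \<and> (\<forall>v j. tlab v = Some (Inr j) \<longrightarrow> (j, snd (\<kappa> v)) \<in> U)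
    \<and> (\<forall>v a. tlab v = Some (Inl a) \<longrightarrow> (\<forall>d. ar a \<le> d \<longrightarrow> d < N \<longrightarrow> \<delta> (fst (snd (\<kappa> v))) (Some (Inl a), fst (\<kappa> v), d) \<in> E))"

lemma sat_parts:
  assumes l: "lrep tlab F Ls \<kappa>"
  shows "sat tlab f F (mall1 0 (mimp (MRoot 0) (mlab Ls P 0))) \<longleftrightarrow> P (\<kappa> [])"
    and "sat tlab f F (mall2 (length Ls) (mimp (mbranch (length Ls)) (mparity Ls (\<lambda>l. pr (fst (snd l))) M (length Ls))))
       \<longleftrightarrow> (\<forall>\<pi>. (\<forall>i. tlab (pre \<pi> i) \<noteq> None) \<longrightarrow> parity_ok (\<lambda>i. pr (fst (snd (\<kappa> (pre \<pi> i))))))"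
    and "sat tlab f F (mall1 0 (mall1 1 (mimp (MConj (MLab a 0) (MConj (MSucc d 0 1) (mlab Ls (\<lambda>x. x = l) 0))) (mlab Ls P 1))))
       \<longleftrightarrow> (\<forall>v. tlab v = Some (Inl a) \<longrightarrow> tlab (v @ [d]) \<noteq> None \<longrightarrow> \<kappa> v = l \<longrightarrow> P (\<kappa> (v @ [d])))"
    and "sat tlab f F (mall1 0 (mimp (MQ j 0) (mlab Ls P 0))) \<longleftrightarrow> (\<forall>v. tlab v = Some (Inr j) \<longrightarrow> P (\<kappa> v))"
    and "sat tlab f F (mall1 0 (mimp (MLab a 0) (mlab Ls P 0))) \<longleftrightarrow> (\<forall>v. tlab v = Some (Inl a) \<longrightarrow> P (\<kappa> v))"
proof -
  have ml0: "sat tlab (f(0 := v)) F (mlab Ls P 0) \<longleftrightarrow> P (\<kappa> v)" if "tlab v \<noteq> None" for f v P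
    using sat_mlab[OF l, of "f(0 := v)" 0 P] that by simp
  have ml1: "sat tlab (f(0 := u, 1 := v)) F (mlab Ls P 1) \<longleftrightarrow> P (\<kappa> v)" if "tlab v \<noteq> None" for f u v P
    using sat_mlab[OF l, of "f(0 := u, 1 := v)" 1 P] that by simp
  have ml2: "sat tlab (f(0 := u, 1 := v)) F (mlab Ls P 0) \<longleftrightarrow> P (\<kappa> u)" if "tlab u \<noteq> None" for f u v P
    using sat_mlab[OF l, of "f(0 := u, 1 := v)" 0 P] that by simp
  have root: "tlab [] \<noteq> None" using wf_root[OF t] by auto
  show "sat tlab f F (mall1 0 (mimp (MRoot 0) (mlab Ls P 0))) \<longleftrightarrow> P (\<kappa> [])"
  proof -
    have "sat tlab f F (mall1 0 (mimp (MRoot 0) (mlab Ls P 0))) \<longleftrightarrow> (\<forall>v. tlab v \<noteq> None \<longrightarrow> v = [] \<longrightarrow> P (\<kappa> v))"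
      unfolding sat_mall1 sat_mimp using ml0 by (simp del: not_None_eq cong: imp_cong)
    then show ?thesis using root by blast
  qed
  show "sat tlab f F (mall1 0 (mimp (MQ j 0) (mlab Ls P 0))) \<longleftrightarrow> (\<forall>v. tlab v = Some (Inr j) \<longrightarrow> P (\<kappa> v))"
  proof -
    have "sat tlab f F (mall1 0 (mimp (MQ j 0) (mlab Ls P 0))) \<longleftrightarrow> (\<forall>v. tlab v \<noteq> None \<longrightarrow> tlab v = Some (Inr j) \<longrightarrow> P (\<kappa> v))"
      unfolding sat_mall1 sat_mimp using ml0 by (simp del: not_None_eq cong: imp_cong)
    then show ?thesis by auto
  qed
  show "sat tlab f F (mall1 0 (mimp (MLab a 0) (mlab Ls P 0))) \<longleftrightarrow> (\<forall>v. tlab v = Some (Inl a) \<longrightarrow> P (\<kappa> v))"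
  proof -
    have "sat tlab f F (mall1 0 (mimp (MLab a 0) (mlab Ls P 0))) \<longleftrightarrow> (\<forall>v. tlab v \<noteq> None \<longrightarrow> tlab v = Some (Inl a) \<longrightarrow> P (\<kappa> v))"
      unfolding sat_mall1 sat_mimp using ml0 by (simp del: not_None_eq cong: imp_cong)
    then show ?thesis by auto
  qed
  show "sat tlab f F (mall1 0 (mall1 1 (mimp (MConj (MLab a 0) (MConj (MSucc d 0 1) (mlab Ls (\<lambda>x. x = l) 0))) (mlab Ls P 1))))
       \<longleftrightarrow> (\<forall>v. tlab v = Some (Inl a) \<longrightarrow> tlab (v @ [d]) \<noteq> None \<longrightarrow> \<kappa> v = l \<longrightarrow> P (\<kappa> (v @ [d])))"
  proof -
    have "sat tlab (f(0 := u, 1 := v)) F (mimp (MConj (MLab a 0) (MConj (MSucc d 0 1) (mlab Ls (\<lambda>x. x = l) 0))) (mlab Ls P 1))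
        \<longleftrightarrow> (tlab u = Some (Inl a) \<and> v = u @ [d] \<and> \<kappa> u = l \<longrightarrow> P (\<kappa> v))" if "tlab u \<noteq> None" "tlab v \<noteq> None" for u v
      unfolding sat_mimp sat.simps ml1[OF that(2)] ml2[OF that(1)] by simp
    then have "sat tlab f F (mall1 0 (mall1 1 (mimp (MConj (MLab a 0) (MConj (MSucc d 0 1) (mlab Ls (\<lambda>x. x = l) 0))) (mlab Ls P 1))))
       \<longleftrightarrow> (\<forall>u. tlab u \<noteq> None \<longrightarrow> (\<forall>v. tlab v \<noteq> None \<longrightarrow> tlab u = Some (Inl a) \<and> v = u @ [d] \<and> \<kappa> u = l \<longrightarrow> P (\<kappa> v)))"
      unfolding sat_mall1 by blast
    then show ?thesis by auto
  qed
  show "sat tlab f F (mall2 (length Ls) (mimp (mbranch (length Ls)) (mparity Ls (\<lambda>l. pr (fst (snd l))) M (length Ls))))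
       \<longleftrightarrow> (\<forall>\<pi>. (\<forall>i. tlab (pre \<pi> i) \<noteq> None) \<longrightarrow> parity_ok (\<lambda>i. pr (fst (snd (\<kappa> (pre \<pi> i))))))" (is "?lhs \<longleftrightarrow> ?rhs")
  proof -
    let ?F = "\<lambda>V. F(length Ls := V)"
    have lr: "lrep tlab (?F V) Ls \<kappa>" for V by (rule lrep_upd[OF l])
    have br: "sat tlab f (?F V) (mbranch (length Ls)) \<longleftrightarrow> (\<exists>\<pi>. V = range (pre \<pi>))" if "V \<subseteq> {v. tlab v \<noteq> None}" for V
      using sat_mbranch[OF t, of "?F V" "length Ls" f] that by simp
    have pa: "sat tlab f (?F (range (pre \<pi>))) (mparity Ls (\<lambda>l. pr (fst (snd l))) M (length Ls))
        \<longleftrightarrow> parity_ok (\<lambda>i. pr (fst (snd (\<kappa> (pre \<pi> i)))))" if "\<forall>i. tlab (pre \<pi> i) \<noteq> None" for \<pi>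
      using sat_mparity[OF lr, of "range (pre \<pi>)" "length Ls" \<pi> "\<lambda>l. pr (fst (snd l))" M f] that prM by simp
    show ?thesis
    proof
      assume L: ?lhs
      show ?rhs
      proof (intro allI impI)
        fix \<pi> assume d: "\<forall>i. tlab (pre \<pi> i) \<noteq> None"
        then have "range (pre \<pi>) \<subseteq> {v. tlab v \<noteq> None}" by blast
        then show "parity_ok (\<lambda>i. pr (fst (snd (\<kappa> (pre \<pi> i)))))"
          using L br pa[OF d] unfolding sat_mall2 sat_mimp by blast
      qed
    next
      assume Rr: ?rhs
      show ?lhs unfolding sat_mall2 sat_mimp
      proof (intro allI impI)
        fix V assume V: "V \<subseteq> {v. tlab v \<noteq> None}" "sat tlab f (?F V) (mbranch (length Ls))"
        then obtain \<pi> where \<pi>: "V = range (pre \<pi>)" using br by blast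
        then have d: "\<forall>i. tlab (pre \<pi> i) \<noteq> None" using V(1) by blast
        show "sat tlab f (?F V) (mparity Ls (\<lambda>l. pr (fst (snd l))) M (length Ls))"
          unfolding \<pi> pa[OF d] using Rr d by blast
      qed
    qed
  qed
qed

lemma sat_body:
  assumes l: "lrep tlab F Ls \<kappa>" and f: "sat tlab f F (mfun Ls)"
  shows "sat tlab f F (runbody \<delta> pr N M E ar Ls as m q U) \<longleftrightarrow> grun \<kappa>"
proof -
  have lm: "\<kappa> v \<in> set Ls" if "tlab v \<noteq> None" for v using l that unfolding lrep_def by blast
  have c2: "(\<forall>x\<in>set (List.product as (List.product [0..<N] Ls)). sat tlab f F ((\<lambda>(a, d, l). mall1 0 (mall1 1 (mimp (MConj (MLab a 0) (MConj (MSucc d 0 1) (mlab Ls (\<lambda>x. x = l) 0)))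
        (mlab Ls (\<lambda>x. fst (snd x) = \<delta> (fst (snd l)) (Some (Inl a), fst l, d)
           \<and> snd (snd x) = max (snd (snd l)) (pr (fst (snd l)))) 1)))) x))
     \<longleftrightarrow> (\<forall>v a d. tlab v = Some (Inl a) \<longrightarrow> d < N \<longrightarrow> tlab (v @ [d]) \<noteq> None \<longrightarrow>
         fst (snd (\<kappa> (v @ [d]))) = \<delta> (fst (snd (\<kappa> v))) (Some (Inl a), fst (\<kappa> v), d)
         \<and> snd (snd (\<kappa> (v @ [d]))) = max (snd (snd (\<kappa> v))) (pr (fst (snd (\<kappa> v)))))" (is "?l \<longleftrightarrow> ?r")
  proof
    assume L: ?l
    show ?r
    proof (intro allI impI)
      fix v a d assume v: "tlab v = Some (Inl a)" "d < N" "tlab (v @ [d]) \<noteq> None"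
      have "a \<in> \<Sigma>" using wf_Inl[OF t v(1)] by blast
      then have "(a, d, \<kappa> v) \<in> set (List.product as (List.product [0..<N] Ls))" using v lm[of v] as by simp
      from bspec[OF L this] show "fst (snd (\<kappa> (v @ [d]))) = \<delta> (fst (snd (\<kappa> v))) (Some (Inl a), fst (\<kappa> v), d)
         \<and> snd (snd (\<kappa> (v @ [d]))) = max (snd (snd (\<kappa> v))) (pr (fst (snd (\<kappa> v))))"
        unfolding split_conv sat_parts(3)[OF l] using v by blast
    qed
  next
    assume Rr: ?r
    show ?l
    proof
      fix x assume "x \<in> set (List.product as (List.product [0..<N] Ls))"
      then obtain a d l' where x: "x = (a, d, l')" "d < N" by auto
      show "sat tlab f F ((\<lambda>(a, d, l). mall1 0 (mall1 1 (mimp (MConj (MLab a 0) (MConj (MSucc d 0 1) (mlab Ls (\<lambda>x. x = l) 0)))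
        (mlab Ls (\<lambda>x. fst (snd x) = \<delta> (fst (snd l)) (Some (Inl a), fst l, d)
           \<and> snd (snd x) = max (snd (snd l)) (pr (fst (snd l)))) 1)))) x)"
        unfolding x(1) split_conv sat_parts(3)[OF l] using Rr x(2) by blast
    qed
  qed
  have c3: "(\<forall>j\<in>set [0..<m]. sat tlab f F (mall1 0 (mimp (MQ j 0) (mlab Ls (\<lambda>l. (j, snd l) \<in> U) 0))))
     \<longleftrightarrow> (\<forall>v j. tlab v = Some (Inr j) \<longrightarrow> (j, snd (\<kappa> v)) \<in> U)"
  proof -
    have "j \<in> set [0..<m]" if "tlab v = Some (Inr j)" for v j using wf_Inr[OF t that] by simp
    then show ?thesis unfolding sat_parts(4)[OF l] by blast
  qed
  have c4: "(\<forall>a\<in>set as. sat tlab f F (mall1 0 (mimp (MLab a 0) (mlab Ls (\<lambda>l. \<forall>d. ar a \<le> d \<longrightarrow> d < N \<longrightarrow> \<delta> (fst (snd l)) (Some (Inl a), fst l, d) \<in> E) 0))))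
     \<longleftrightarrow> (\<forall>v a. tlab v = Some (Inl a) \<longrightarrow> (\<forall>d. ar a \<le> d \<longrightarrow> d < N \<longrightarrow> \<delta> (fst (snd (\<kappa> v))) (Some (Inl a), fst (\<kappa> v), d) \<in> E))"
  proof -
    have "a \<in> set as" if "tlab v = Some (Inl a)" for v a using wf_Inl[OF t that] as by blast
    then show ?thesis unfolding sat_parts(5)[OF l] by blast
  qed
  show ?thesis unfolding grun_def c2[symmetric] c3[symmetric] c4[symmetric] sat_parts(2)[OF l, of f, symmetric]
      sat_parts(1)[OF l, of f "\<lambda>l. fst (snd l) = q \<and> snd (snd l) = 0", symmetric]
    unfolding runbody_def sat_mconjs set_append set_map list.set ball_Un ball_simps using f by blast
qed

lemma runform_grun: "models t (runform \<delta> pr N M E ar Ls as m q U) \<longleftrightarrow> (\<exists>\<kappa>. (\<forall>v. tlab v \<noteq> None \<longrightarrow> \<kappa> v \<in> set Ls) \<and> grun \<kappa>)"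
proof
  assume "models t (runform \<delta> pr N M E ar Ls as m q U)"
  from this[unfolded models_def runform_def sat_mexs] obtain G where
    G: "sat tlab (\<lambda>_. []) (\<lambda>i. if i < length Ls then G i else {}) (runbody \<delta> pr N M E ar Ls as m q U)"
    (is "sat _ ?f ?F _") by blast
  have mf: "sat tlab ?f ?F (mfun Ls)" using G unfolding runbody_def sat_mconjs by simp
  obtain \<kappa> where l: "lrep tlab ?F Ls \<kappa>" using mfun_lrep[OF mf] by blast
  have "grun \<kappa>" using G unfolding sat_body[OF l mf] .
  then show "\<exists>\<kappa>. (\<forall>v. tlab v \<noteq> None \<longrightarrow> \<kappa> v \<in> set Ls) \<and> grun \<kappa>" using l unfolding lrep_def by blast
next
  assume "\<exists>\<kappa>. (\<forall>v. tlab v \<noteq> None \<longrightarrow> \<kappa> v \<in> set Ls) \<and> grun \<kappa>"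
  then obtain \<kappa> where \<kappa>: "\<And>v. tlab v \<noteq> None \<Longrightarrow> \<kappa> v \<in> set Ls" "grun \<kappa>" by blast
  define G where "G i = {v. tlab v \<noteq> None \<and> i < length Ls \<and> Ls ! i = \<kappa> v}" for i
  let ?F = "\<lambda>i. if i < length Ls then G i else {}"
  have l: "lrep tlab ?F Ls \<kappa>" unfolding G_def by (rule lrep_mfun(1)) (use \<kappa>(1) Ls(2) in blast)+
  have mf: "sat tlab (\<lambda>_. []) ?F (mfun Ls)" unfolding G_def by (rule lrep_mfun(2)) (use \<kappa>(1) Ls(2) in blast)+
  have "\<forall>i<length Ls. G i \<subseteq> {v. tlab v \<noteq> None}" unfolding G_def by blast
  then show "models t (runform \<delta> pr N M E ar Ls as m q U)"
    unfolding models_def runform_def sat_mexs using sat_body[OF l mf] \<kappa>(2) by (intro exI[of _ G]) (rule conjI, assumption, simp only:)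
qed

text \<open>The recurrences in \<open>grun\<close> determine states and maxima from the transitions,
  by induction on the address; outside the domain the transition is an arbitrary element of
  \<open>R\<close>.\<close>

lemma runform_prun: "models t (runform \<delta> pr N M E ar Ls as m q U) \<longleftrightarrow> (\<exists>\<rho>. prun \<delta> pr N R E tlab q U \<rho>)"
  unfolding runform_grun
proof
  assume "\<exists>\<kappa>. (\<forall>v. tlab v \<noteq> None \<longrightarrow> \<kappa> v \<in> set Ls) \<and> grun \<kappa>"
  then obtain \<kappa> where \<kappa>: "\<And>v. tlab v \<noteq> None \<Longrightarrow> \<kappa> v \<in> R \<times> Q \<times> {..M}" and g: "grun \<kappa>" unfolding Ls by blast
  obtain r0 where r0: "r0 \<in> R" using R by blast
  define \<rho> where "\<rho> v = (if tlab v \<noteq> None then fst (\<kappa> v) else r0)" for v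
  have st: "nst \<delta> q tlab \<rho> v = fst (snd (\<kappa> v)) \<and> nmx \<delta> pr q tlab \<rho> v = snd (snd (\<kappa> v))" if "tlab v \<noteq> None" for v
    using that
  proof (induction v rule: rev_induct)
    case Nil
    then show ?case using g unfolding grun_def by simp
  next
    case (snoc d v)
    obtain a where a: "a \<in> \<Sigma>" "tlab v = Some (Inl a)" "d < ar a" using wf_prefix(2)[OF t snoc.prems] by auto
    then have d: "d < N" using arN by (auto simp: less_le_trans)
    have IH: "nst \<delta> q tlab \<rho> v = fst (snd (\<kappa> v))" "nmx \<delta> pr q tlab \<rho> v = snd (snd (\<kappa> v))" using snoc.IH a(2) by simp_all
    have "\<rho> v = fst (\<kappa> v)" using a(2) by (simp add: \<rho>_def)
    then show ?case using g a(2) d snoc.prems IH unfolding grun_def by (simp add: nst_snoc nmx_snoc)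
  qed
  have "prun \<delta> pr N R E tlab q U \<rho>" unfolding prun_def
  proof (intro conjI allI impI)
    show "\<rho> v \<in> R" for v using \<kappa>[of v] r0 unfolding \<rho>_def by auto
    show "(j, nst \<delta> q tlab \<rho> v, nmx \<delta> pr q tlab \<rho> v) \<in> U" if "tlab v = Some (Inr j)" for v j
    proof -
      have "(j, snd (\<kappa> v)) \<in> U" using g that unfolding grun_def by blast
      then show ?thesis using st[of v] that by simp
    qed
    show "\<delta> (nst \<delta> q tlab \<rho> v) (tlab v, \<rho> v, d) \<in> E" if v: "tlab v = Some (Inl a)" "d < N" "tlab (v @ [d]) = None" for v a d
    proof -
      have "ar a \<le> d" using wf_Inl[OF t v(1), of d] v(3) by auto
      then have "\<delta> (fst (snd (\<kappa> v))) (Some (Inl a), fst (\<kappa> v), d) \<in> E" using g v unfolding grun_def by blast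
      then show ?thesis using st[of v] v(1) by (simp add: \<rho>_def)
    qed
    show "parity_ok (\<lambda>i. pr (nst \<delta> q tlab \<rho> (pre \<pi> i)))" if d: "\<forall>i. tlab (pre \<pi> i) \<noteq> None" for \<pi>
    proof -
      have "parity_ok (\<lambda>i. pr (fst (snd (\<kappa> (pre \<pi> i)))))" using g d unfolding grun_def by blast
      then show ?thesis using st d by simp
    qed
  qed
  then show "\<exists>\<rho>. prun \<delta> pr N R E tlab q U \<rho>" by blast
next
  assume "\<exists>\<rho>. prun \<delta> pr N R E tlab q U \<rho>"
  then obtain \<rho> where run: "prun \<delta> pr N R E tlab q U \<rho>" by blast
  have \<rho>R: "\<rho> v \<in> R" for v using run unfolding prun_def by blast
  define \<kappa> where "\<kappa> v = (\<rho> v, nst \<delta> q tlab \<rho> v, nmx \<delta> pr q tlab \<rho> v)" for v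
  have "\<kappa> v \<in> set Ls" if "tlab v \<noteq> None" for v
  proof -
    have "nst \<delta> q tlab \<rho> v \<in> Q" using nst_in[OF Qcl arN prM t q \<rho>R that] .
    moreover have "nmx \<delta> pr q tlab \<rho> v \<le> M" using prM by (intro nmx_le) simp
    ultimately show ?thesis unfolding Ls \<kappa>_def using \<rho>R by simp
  qed
  moreover have "grun \<kappa>" unfolding grun_def
  proof (intro conjI allI impI)
    show "fst (snd (\<kappa> [])) = q" "snd (snd (\<kappa> [])) = 0" by (simp_all add: \<kappa>_def)
    show "parity_ok (\<lambda>i. pr (fst (snd (\<kappa> (pre \<pi> i)))))" if "\<forall>i. tlab (pre \<pi> i) \<noteq> None" for \<pi>
      using run that unfolding prun_def \<kappa>_def by simp
    show "fst (snd (\<kappa> (v @ [d]))) = \<delta> (fst (snd (\<kappa> v))) (Some (Inl a), fst (\<kappa> v), d)"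
      "snd (snd (\<kappa> (v @ [d]))) = max (snd (snd (\<kappa> v))) (pr (fst (snd (\<kappa> v))))" if "tlab v = Some (Inl a)" for v a d
      using that by (simp_all add: \<kappa>_def nst_snoc nmx_snoc)
    show "(j, snd (\<kappa> v)) \<in> U" if "tlab v = Some (Inr j)" for v j
      using run that unfolding prun_def \<kappa>_def by simp
    show "\<delta> (fst (snd (\<kappa> v))) (Some (Inl a), fst (\<kappa> v), d) \<in> E" if v: "tlab v = Some (Inl a)" "ar a \<le> d" "d < N" for v a d
    proof -
      have "tlab (v @ [d]) = None" using wf_Inl[OF t v(1), of d] v(2) by auto
      then have "\<delta> (nst \<delta> q tlab \<rho> v) (tlab v, \<rho> v, d) \<in> E" using run v unfolding prun_def by blast
      then show ?thesis using v(1) by (simp add: \<kappa>_def)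
    qed
  qed
  ultimately show "\<exists>\<kappa>. (\<forall>v. tlab v \<noteq> None \<longrightarrow> \<kappa> v \<in> set Ls) \<and> grun \<kappa>" by blast
qed

end

text \<open>The formulae in \<open>\<Psi>\<close> say that a partial run from \<open>q\<close> with
  bound \<open>U\<close> exists. They are taken for every sort, since the labels of \<open>S\<close>
  and \<open>T\<close> have arbitrary sorts. By \<open>prun_flat\<close> their preservation on
  labels implies their preservation under \<open>flat\<close>, and \<open>\<phi>\<close> is
  equivalent to one of them at sort \<open>n0\<close>.\<close>

theorem compositional_extension:
  fixes \<Sigma> :: "'c set" and \<phi> :: "'c mso"
  assumes \<Sigma>: "finite \<Sigma>"
  shows "\<exists>\<Psi>. \<Psi> \<subseteq> MSO \<Sigma> \<and> (\<forall>m. finite {p \<in> \<Psi>. fst p = m}) \<and>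
     (\<forall>n S T. mmwf ar \<Sigma> n S \<longrightarrow> mmwf ar \<Sigma> n T \<longrightarrow> pw_le (sqsub \<Psi>) S T \<longrightarrow>
        sqsub \<Psi> (flat S) (flat T) \<and> (n = n0 \<longrightarrow> models (flat S) \<phi> \<longrightarrow> models (flat T) \<phi>))"
proof -
  \<comment> \<open>The successor makes \<open>N\<close> positive even if all letters are constants
    or there are none, as complementation of tree automata demands.\<close>
  define N where "N = Suc (Max (insert 0 (ar ` \<Sigma>)))"
  have N: "0 < N" by (simp add: N_def)
  have arN: "\<forall>a\<in>\<Sigma>. ar a \<le> N"
  proof
    fix a assume "a \<in> \<Sigma>"
    then have "ar a \<le> Max (insert 0 (ar ` \<Sigma>))" using \<Sigma> by (intro Max_ge) auto
    then show "ar a \<le> N" by (simp add: N_def)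
  qed
  obtain \<delta> :: "nat \<Rightarrow> ('c + nat) option \<times> nat \<times> nat \<Rightarrow> nat" and pr :: "nat \<Rightarrow> nat" and M and R Q E :: "nat set" and q0 and U0
    where fin: "finite Q" "finite R" and R: "R \<noteq> {}" and q0: "q0 \<in> Q"
    and Qcl: "\<forall>q\<in>Q. \<forall>a\<in>\<Sigma>. \<forall>r\<in>R. \<forall>d<N. \<delta> q (Some (Inl a), r, d) \<in> Q" and prM: "\<forall>q. pr q \<le> M"
    and U0: "U0 \<subseteq> {..<n0} \<times> Q \<times> {..M}"
    and mod: "\<forall>t. wf_tree False ar \<Sigma> n0 t \<longrightarrow> models t \<phi> = (\<exists>\<rho>. prun \<delta> pr N R E (snd t) q0 U0 \<rho>)"
    by (rule sentence_prun[OF \<Sigma> N arN, where \<phi> = \<phi> and ?n0.0 = n0])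
  obtain as where as: "set as = \<Sigma>" using finite_list[OF \<Sigma>] by blast
  have "finite (R \<times> Q \<times> {..M})" using fin by simp
  then obtain Ls where Ls: "set Ls = R \<times> Q \<times> {..M}" "distinct Ls" using finite_distinct_list by blast
  define rf where "rf m q U = runform \<delta> pr N M E ar Ls as m q U" for m q U
  have rf: "models t (rf m q U) \<longleftrightarrow> (\<exists>\<rho>. prun \<delta> pr N R E (snd t) q U \<rho>)" if "wf_tree False ar \<Sigma> m t" "q \<in> Q" for t m q U
    unfolding rf_def by (rule runform_prun[OF Qcl arN prM that(2) R that(1) Ls as])
  define \<Psi> where "\<Psi> = {(m, rf m q U) |m q U. q \<in> Q \<and> U \<subseteq> {..<m} \<times> Q \<times> {..M}}"
  have "\<Psi> \<subseteq> MSO \<Sigma>" unfolding \<Psi>_def rf_def using runform_MSO[of as \<Sigma>] as by auto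
  moreover have "finite {p \<in> \<Psi>. fst p = m}" for m
  proof -
    have "{p \<in> \<Psi>. fst p = m} \<subseteq> (\<lambda>(q, U). (m, rf m q U)) ` (Q \<times> Pow ({..<m} \<times> Q \<times> {..M}))"
      unfolding \<Psi>_def by auto
    moreover have "finite (Q \<times> Pow ({..<m} \<times> Q \<times> {..M}))" using fin by simp
    ultimately show ?thesis by (meson finite_imageI finite_subset)
  qed
  moreover have "sqsub \<Psi> (flat S) (flat T) \<and> (n = n0 \<longrightarrow> models (flat S) \<phi> \<longrightarrow> models (flat T) \<phi>)"
    if S: "mmwf ar \<Sigma> n S" and T: "mmwf ar \<Sigma> n T" and le: "pw_le (sqsub \<Psi>) S T" for n S T
  proof -
    have pw: "case (snd S v, snd T v) of (None, None) \<Rightarrow> True | (Some (Inr i), Some (Inr j)) \<Rightarrow> i = j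
          | (Some (Inl s), Some (Inl t)) \<Rightarrow> sqsub \<Psi> s t | _ \<Rightarrow> False" for v
      using le unfolding pw_le_def by blast
    have sh: "\<forall>v. (\<forall>l. snd S v = Some (Inr l) \<longleftrightarrow> snd T v = Some (Inr l)) \<and>
        ((\<exists>s. snd S v = Some (Inl s)) \<longleftrightarrow> (\<exists>t. snd T v = Some (Inl t)))"
    proof
      fix v
      show "(\<forall>l. snd S v = Some (Inr l) \<longleftrightarrow> snd T v = Some (Inr l)) \<and>
        ((\<exists>s. snd S v = Some (Inl s)) \<longleftrightarrow> (\<exists>t. snd T v = Some (Inl t)))"
        using pw[of v] by (cases "snd S v"; cases "snd T v") (auto split: sum.splits)
    qed
    have lab: "\<forall>v s t. snd S v = Some (Inl s) \<longrightarrow> snd T v = Some (Inl t) \<longrightarrow>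
       (\<forall>q\<in>Q. \<forall>U \<subseteq> {..<fst s} \<times> Q \<times> {..M}. (\<exists>\<rho>. prun \<delta> pr N R E (snd s) q U \<rho>) \<longrightarrow> (\<exists>\<rho>. prun \<delta> pr N R E (snd t) q U \<rho>))"
    proof (intro allI impI ballI)
      fix v s t q U
      assume s: "snd S v = Some (Inl s)" and t: "snd T v = Some (Inl t)" and q: "q \<in> Q"
        and U: "U \<subseteq> {..<fst s} \<times> Q \<times> {..M}" and ex: "\<exists>\<rho>. prun \<delta> pr N R E (snd s) q U \<rho>"
      have sq: "sqsub \<Psi> s t" using pw[of v] s t by simp
      then have fs: "fst s = fst t" unfolding sqsub_def by blast
      have "(fst s, rf (fst s) q U) \<in> \<Psi>" unfolding \<Psi>_def using q U by blast
      moreover have "models s (rf (fst s) q U)" using rf[OF mm_label[OF S s] q] ex by blast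
      ultimately have "models t (rf (fst s) q U)" using sq unfolding sqsub_def by blast
      then show "\<exists>\<rho>. prun \<delta> pr N R E (snd t) q U \<rho>" using rf[OF mm_label[OF T t] q] fs by simp
    qed
    have tr: "\<exists>\<rho>'. prun \<delta> pr N R E (snd (flat T)) q U \<rho>'" if "q \<in> Q" "prun \<delta> pr N R E (snd (flat S)) q U \<rho>" for q U \<rho>
      by (rule prun_flat[OF Qcl arN prM S T that sh lab])
    have fl: "fst (flat S) = n" "fst (flat T) = n" using flat_wf[OF S] flat_wf[OF T] unfolding wf_tree_def by blast+
    have "sqsub \<Psi> (flat S) (flat T)" unfolding sqsub_def
    proof (intro conjI ballI)
      show "fst (flat S) = fst (flat T)" using fl by simp
      fix x assume "x \<in> \<Psi>"
      then obtain m q U where x: "x = (m, rf m q U)" "q \<in> Q" unfolding \<Psi>_def by blast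
      show "case x of (n, \<phi>) \<Rightarrow> n = fst (flat S) \<longrightarrow> models (flat S) \<phi> \<longrightarrow> models (flat T) \<phi>"
        unfolding x(1) split_conv fl
      proof (intro impI)
        assume m: "m = n" "models (flat S) (rf m q U)"
        then obtain \<rho> where "prun \<delta> pr N R E (snd (flat S)) q U \<rho>" using rf[OF flat_wf[OF S] x(2)] by blast
        then show "models (flat T) (rf m q U)" using tr[OF x(2)] rf[OF flat_wf[OF T] x(2)] m(1) by blast
      qed
    qed
    moreover have "models (flat T) \<phi>" if n: "n = n0" "models (flat S) \<phi>"
    proof -
      obtain \<rho> where "prun \<delta> pr N R E (snd (flat S)) q0 U0 \<rho>" using mod flat_wf[OF S] n by blast
      then show ?thesis using tr[OF q0] mod flat_wf[OF T] n(1) by blast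
    qed
    ultimately show ?thesis by blast
  qed
  ultimately show ?thesis by (intro exI[of _ \<Psi>]) blast
qed

lemma MMtrees_TLin: "MMtrees TLin ar \<Sigma> n \<subseteq> MMtrees TTimes ar \<Sigma> n"
proof
  fix S assume "S \<in> MMtrees TLin ar \<Sigma> n"
  then have S: "wf_tree True fst (\<Union>k. Mtrees TLin ar \<Sigma> k) n S" by (simp add: MMtrees_def Mtrees_def)
  have sub: "(\<Union>k. Mtrees TLin ar \<Sigma> k) \<subseteq> (\<Union>k. Mtrees TTimes ar \<Sigma> k)"
    unfolding Mtrees_def wf_tree_def by auto
  have "wf_tree False fst (\<Union>k. Mtrees TTimes ar \<Sigma> k) n S"
    using S sub unfolding wf_tree_def by (simp add: subset_iff)
  then show "S \<in> MMtrees TTimes ar \<Sigma> n" by (simp add: MMtrees_def Mtrees_def)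
qed

lemma MMtrees_any_mmwf: "S \<in> MMtrees M ar \<Sigma> n \<Longrightarrow> mmwf ar \<Sigma> n S"
  using MMtrees_TLin[of ar \<Sigma> n] MMtrees_mmwf[of S ar \<Sigma> n] by (cases M) blast+

text \<open>Each sentence of \<open>\<Phi> \<Sigma>\<close> keeps its own automaton. The preorder of
  the union is contained in the preorder of each part, so the comparison of labels is inherited by
  every part, and the flattenings are then compared part by part.\<close>

theorem MSO_compositional:
  fixes ar :: "'c \<Rightarrow> nat"
  shows "compositional M ar MSO"
  unfolding compositional_def
proof (intro allI impI)
  fix \<Phi> :: "'c set \<Rightarrow> (nat \<times> 'c mso) set"
  assume \<Phi>: "\<forall>\<Sigma>. finite \<Sigma> \<longrightarrow> \<Phi> \<Sigma> \<subseteq> MSO \<Sigma> \<and> finite (\<Phi> \<Sigma>)"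
  let ?P = "\<lambda>\<Sigma> p \<Psi>. \<Psi> \<subseteq> MSO \<Sigma> \<and> (\<forall>m. finite {p \<in> \<Psi>. fst p = m}) \<and>
     (\<forall>n S T. mmwf ar \<Sigma> n S \<longrightarrow> mmwf ar \<Sigma> n T \<longrightarrow> pw_le (sqsub \<Psi>) S T \<longrightarrow>
        sqsub \<Psi> (flat S) (flat T) \<and> (n = fst p \<longrightarrow> models (flat S) (snd p) \<longrightarrow> models (flat T) (snd p)))"
  define \<Psi> where "\<Psi> \<Sigma> p = (SOME \<Psi>. ?P \<Sigma> p \<Psi>)" for \<Sigma> p
  have \<Psi>: "?P \<Sigma> p (\<Psi> \<Sigma> p)" if "finite \<Sigma>" for \<Sigma> p
    unfolding \<Psi>_def by (rule someI_ex[OF compositional_extension[OF that]])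
  define \<Delta> where "\<Delta> \<Sigma> = \<Phi> \<Sigma> \<union> (\<Union>p\<in>\<Phi> \<Sigma>. \<Psi> \<Sigma> p)" for \<Sigma>
  show "\<exists>\<Delta>. \<forall>\<Sigma>. finite \<Sigma> \<longrightarrow> \<Phi> \<Sigma> \<subseteq> \<Delta> \<Sigma> \<and> \<Delta> \<Sigma> \<subseteq> MSO \<Sigma>
      \<and> (\<forall>n. finite ((\<lambda>(m, \<phi>). {t \<in> Mtrees M ar \<Sigma> n. models t \<phi>}) ` {p \<in> \<Delta> \<Sigma>. fst p = n}))
      \<and> congruence_ordering M ar \<Sigma> (sqsub (\<Delta> \<Sigma>))"
  proof (rule exI[of _ \<Delta>], intro allI impI conjI)
    fix \<Sigma> :: "'c set" assume \<Sigma>: "finite \<Sigma>"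
    have P: "\<Psi> \<Sigma> p \<subseteq> MSO \<Sigma>" "finite {x \<in> \<Psi> \<Sigma> p. fst x = m}" for p m
      using \<Psi>[OF \<Sigma>, of p] by blast+
    show "\<Phi> \<Sigma> \<subseteq> \<Delta> \<Sigma>" unfolding \<Delta>_def by blast
    show "\<Delta> \<Sigma> \<subseteq> MSO \<Sigma>" unfolding \<Delta>_def using \<Phi> \<Sigma> P(1) by blast
    show "finite ((\<lambda>(m, \<phi>). {t \<in> Mtrees M ar \<Sigma> n. models t \<phi>}) ` {p \<in> \<Delta> \<Sigma>. fst p = n})" for n
    proof -
      have "{p \<in> \<Delta> \<Sigma>. fst p = n} \<subseteq> \<Phi> \<Sigma> \<union> (\<Union>p\<in>\<Phi> \<Sigma>. {x \<in> \<Psi> \<Sigma> p. fst x = n})" unfolding \<Delta>_def by blast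
      moreover have "finite (\<Phi> \<Sigma> \<union> (\<Union>p\<in>\<Phi> \<Sigma>. {x \<in> \<Psi> \<Sigma> p. fst x = n}))" using \<Phi> \<Sigma> P(2) by blast
      ultimately show ?thesis by (meson finite_imageI finite_subset)
    qed
    show "congruence_ordering M ar \<Sigma> (sqsub (\<Delta> \<Sigma>))" unfolding congruence_ordering_def
    proof (intro conjI allI ballI impI)
      show "sqsub (\<Delta> \<Sigma>) s s" for s by (auto simp: sqsub_def)
      show "sqsub (\<Delta> \<Sigma>) s u" if "sqsub (\<Delta> \<Sigma>) s t" "sqsub (\<Delta> \<Sigma>) t u" for s t u
        using that unfolding sqsub_def split_beta by metis
      fix n S T assume "S \<in> MMtrees M ar \<Sigma> n" "T \<in> MMtrees M ar \<Sigma> n" and le: "pw_le (sqsub (\<Delta> \<Sigma>)) S T"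
      then have ST: "mmwf ar \<Sigma> n S" "mmwf ar \<Sigma> n T" using MMtrees_any_mmwf by blast+
      have fl: "fst (flat S) = n" "fst (flat T) = n" using flat_wf[OF ST(1)] flat_wf[OF ST(2)] unfolding wf_tree_def by blast+
      have comp: "sqsub (\<Psi> \<Sigma> p) (flat S) (flat T) \<and> (n = fst p \<longrightarrow> models (flat S) (snd p) \<longrightarrow> models (flat T) (snd p))"
        if p: "p \<in> \<Phi> \<Sigma>" for p
      proof -
        have mono: "sqsub (\<Delta> \<Sigma>) s t \<Longrightarrow> sqsub (\<Psi> \<Sigma> p) s t" for s t unfolding sqsub_def \<Delta>_def using p by blast
        have "pw_le (sqsub (\<Psi> \<Sigma> p)) S T" unfolding pw_le_def
        proof (intro conjI allI)
          show "fst S = fst T" using le unfolding pw_le_def by blast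
          fix v
          have "case (snd S v, snd T v) of (None, None) \<Rightarrow> True | (Some (Inr i), Some (Inr j)) \<Rightarrow> i = j
             | (Some (Inl s), Some (Inl t)) \<Rightarrow> sqsub (\<Delta> \<Sigma>) s t | _ \<Rightarrow> False" using le unfolding pw_le_def by blast
          then show "case (snd S v, snd T v) of (None, None) \<Rightarrow> True | (Some (Inr i), Some (Inr j)) \<Rightarrow> i = j
             | (Some (Inl s), Some (Inl t)) \<Rightarrow> sqsub (\<Psi> \<Sigma> p) s t | _ \<Rightarrow> False"
            using mono by (auto split: option.splits sum.splits)
        qed
        then show ?thesis using \<Psi>[OF \<Sigma>, of p] ST by blast
      qed
      show "sqsub (\<Delta> \<Sigma>) (flat S) (flat T)" unfolding sqsub_def
      proof (intro conjI ballI)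
        show "fst (flat S) = fst (flat T)" using fl by simp
        fix x assume "x \<in> \<Delta> \<Sigma>"
        then consider "x \<in> \<Phi> \<Sigma>" | p where "p \<in> \<Phi> \<Sigma>" "x \<in> \<Psi> \<Sigma> p" unfolding \<Delta>_def by blast
        then show "case x of (n, \<phi>) \<Rightarrow> n = fst (flat S) \<longrightarrow> models (flat S) \<phi> \<longrightarrow> models (flat T) \<phi>"
        proof cases
          case 1
          then show ?thesis using comp[of x] fl by (cases x) simp
        next
          case 2
          then show ?thesis using comp[of p] unfolding sqsub_def by blast
        qed
      qed
    qed
  qed
qed

theorem theorem10p3:
  fixes ar :: "'c \<Rightarrow> nat"
  shows "compositional TTimes ar MSO \<and> compositional TLin ar MSO"
  by (intro conjI MSO_compositional)

end
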